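(* Let $D_1,D_2$ be positive coprime fundamental discriminants. Then $$\mathrm{Int}(D_1,D_2)=\sum_{n\in S_{D_1,D_2}}p(n)=2\sum_{n\in S_{D_1,D_2}}\ \sum_{d\mid\frac{D_1D_2-n^2}{4}}\epsilon(d),$$ where $d$ runs over positive divisors.
   Context: A positive fundamental discriminant is the discriminant of a real quadratic field (in particular not $1$). Write $[A,B,C]$ for the integral form $Ax^2+Bxy+Cy^2$, of discriminant $D=B^2-4AC$. A PIBQF is such a form with $\gcd(A,B,C)=1$ and $D>0$ not a perfect square. $\Gamma=\mathrm{PSL}(2,\mathbb Z)$ acts on forms by $(\gamma\circ q)(x,y)=q(ax+by,cx+dy)$ for $\gamma=\begin{pmatrix}a&b\\c&d\end{pmatrix}$; $q\sim q'$ means $q'=\gamma\circ q$ for some $\gamma\in\Gamma$, and $(q_1,q_2)\sim_2(q_1',q_2')$ means a single $\gamma\in\Gamma$ satisfies $\gamma\circ q_i=q_i'$ for $i=1,2$. $\mathrm{Cl}^+(D)$ is the set of $\sim$-classes of primitive forms of discriminant $D$. For a PIBQF $q=[A,B,C]$ the first root is $q_f=\frac{-B+\sqrt D}{2A}$ and the second root is $q_s=\frac{-B-\sqrt D}{2A}$; $\ell_q$ is the oriented geodesic in the upper half plane $\mathbb H$ from $q_s$ to $q_f$. The invariant automorph is $\gamma_q=\begin{pmatrix}\frac{T-BU}{2} & -CU \\ A U & \frac{T+BU}{2}\end{pmatrix}$, with $(T,U)$ the smallest positive integer solution of $t^2-Du^2=4$; it preserves $\ell_q$, so $\ell_q$ projects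 to a closed geodesic $\tilde\ell_q$ in $\Gamma\backslash\mathbb H$ depending only on the class of $q$. $\mathrm{Int}(q_1,q_2)$ is the (unsigned) number of transverse intersections of $\tilde\ell_{q_1}$ with $\tilde\ell_{q_2}$, counted as follows: fix any $z\in\ell_{q_2}$ and let $\dot\ell$ be the half-open segment of $\ell_{q_2}$ from $z$ (included) to $\gamma_{q_2}z$ (excluded); $\mathrm{Int}(q_1,q_2)$ is the number of pairs $(\ell,P)$ with $\ell$ an oriented geodesic that is a $\Gamma$-translate of $\ell_{q_1}$ and $P$ a transverse intersection point of $\ell$ with $\dot\ell$. It is independent of $z$ and depends only on the classes of $q_1,q_2$. The total intersection number is $$\mathrm{Int}(D_1,D_2):=\sum_{[q_1]\in \mathrm{Cl}^+(D_1)}\ \sum_{[q_2]\in \mathrm{Cl}^+(D_2)}\mathrm{Int}(q_1,q_2).$$ $S_{D_1,D_2}:=\{n\in\mathbb Z: |n|<\sqrt{D_1D_2},\ n\equiv D_1D_2\pmod 2\}$. Put $B_\Delta([A_1,B_1,C_1],[A_2,B_2,C_2])=B_1B_2-2A_1C_2-2A_2C_1$ and $$p(n)=\left|\{(q_1,q_2):\mathrm{disc}(q_1)=D_1,\ \mathrm{disc}(q_2)=D_2,\ B_\Delta(q_1,q_2)=n\}/\sim_2\right| .$$ For a prime $p$ with Kronecker symbol $\left(\frac{D_1D_2}{p}\right)\ne-1$, $\epsilon(p)$ is the nonzero value in $\left\{\left(\frac{D_1}{p}\right),\left(\frac{D_2}{p}\right)\right\}$, extended (completely) multiplicatively; it is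 defined on all divisors of $\frac{D_1D_2-n^2}{4}$ for $n\in S_{D_1,D_2}$. *)

theory Defs
  imports "HOL-Analysis.Analysis" "HOL-Number_Theory.Number_Theory"
begin

definition quad_elt :: "int \<Rightarrow> rat \<Rightarrow> rat \<Rightarrow> real" where
  "quad_elt m a b = of_rat a + of_rat b * sqrt (of_int m)"

text \<open>The ring of integers of \<open>\<rat>(\<surd>m)\<close>.\<close>

definition quad_integers :: "int \<Rightarrow> real set" where
  "quad_integers m = {x. (\<exists>a b. x = quad_elt m a b) \<and> algebraic_int x}"

text \<open>
  \<open>D\<close> is the square of \<open>\<omega>\<^sub>1 \<omega>\<^sub>2' - \<omega>\<^sub>2 \<omega>\<^sub>1'\<close> for an integral basis \<open>\<omega>\<^sub>1, \<omega>\<^sub>2\<close> of the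
  ring of integers, the conjugate of \<open>a + b \<surd>m\<close> being \<open>a - b \<surd>m\<close>. Two generators over the integers are
  automatically linearly independent, since \<open>1\<close> and \<open>\<surd>m\<close> are integers of the field.
\<close>

definition quad_field_disc :: "int \<Rightarrow> int \<Rightarrow> bool" where
  "quad_field_disc m D \<longleftrightarrow>
     (\<exists>a1 b1 a2 b2.
        quad_integers m =
          {of_int u * quad_elt m a1 b1 + of_int v * quad_elt m a2 b2 | (u::int) (v::int). True} \<and>
        real_of_int D =
          (quad_elt m a1 b1 * quad_elt m a2 (- b2) - quad_elt m a2 b2 * quad_elt m a1 (- b1))\<^sup>2)"

definition pos_fundamental_disc :: "int \<Rightarrow> bool" where
  "pos_fundamental_disc D \<longleftrightarrow>
     (\<exists>m>0. sqrt (of_int m) \<notin> \<rat> \<and> quad_field_disc m D)"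

datatype bqf = BQF (coefA: int) (coefB: int) (coefC: int)

fun bqf_eval :: "bqf \<Rightarrow> int \<Rightarrow> int \<Rightarrow> int" where
  "bqf_eval (BQF A B C) x y = A * x\<^sup>2 + B * x * y + C * y\<^sup>2"

definition bqf_disc :: "bqf \<Rightarrow> int" where
  "bqf_disc q = (coefB q)\<^sup>2 - 4 * coefA q * coefC q"

definition bqf_primitive :: "bqf \<Rightarrow> bool" where
  "bqf_primitive q \<longleftrightarrow> gcd (coefA q) (gcd (coefB q) (coefC q)) = 1"

definition B_Delta :: "bqf \<Rightarrow> bqf \<Rightarrow> int" where
  "B_Delta q1 q2 =
     coefB q1 * coefB q2 - 2 * coefA q1 * coefC q2 - 2 * coefA q2 * coefC q1"

text \<open>
  A quadruple \<open>(a, b, c, d)\<close> is the matrix with rows \<open>(a, b)\<close> and \<open>(c, d)\<close>. Elements of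
  \<open>PSL(2, \<int>)\<close> are given by either of their two lifts to \<open>SL(2, \<int>)\<close>; both lifts act in the
  same way on forms and on points.
\<close>

type_synonym mat2 = "int \<times> int \<times> int \<times> int"

definition Gamma :: "mat2 set" where
  "Gamma = {(a, b, c, d). a * d - b * c = 1}"

fun bqf_act :: "mat2 \<Rightarrow> bqf \<Rightarrow> bqf" where
  "bqf_act (a, b, c, d) (BQF A B C) =
     BQF (A * a\<^sup>2 + B * a * c + C * c\<^sup>2)
         (2 * A * a * b + B * (a * d + b * c) + 2 * C * c * d)
         (A * b\<^sup>2 + B * b * d + C * d\<^sup>2)"

lemma bqf_eval_act:
  "bqf_eval (bqf_act (a, b, c, d) q) x y = bqf_eval q (a * x + b * y) (c * x + d * y)"
  by (cases q) (simp add: algebra_simps power2_eq_square)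

definition bqf_equiv :: "(bqf \<times> bqf) set" where
  "bqf_equiv = {(q, q'). \<exists>g\<in>Gamma. q' = bqf_act g q}"

definition bqf_equiv2 :: "((bqf \<times> bqf) \<times> (bqf \<times> bqf)) set" where
  "bqf_equiv2 =
     {((q1, q2), (q1', q2')). \<exists>g\<in>Gamma. bqf_act g q1 = q1' \<and> bqf_act g q2 = q2'}"

definition Cl_plus :: "int \<Rightarrow> bqf set set" where
  "Cl_plus D = {q. bqf_primitive q \<and> bqf_disc q = D} // bqf_equiv"

fun moebius :: "mat2 \<Rightarrow> 'a::field \<Rightarrow> 'a" where
  "moebius (a, b, c, d) z = (of_int a * z + of_int b) / (of_int c * z + of_int d)"

text \<open>
  An oriented geodesic with finite endpoints is given by the pair (start, end) of its endpoints.
\<close>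

type_synonym geodesic = "real \<times> real"

fun geod_center :: "geodesic \<Rightarrow> complex" where
  "geod_center (s, f) = of_real ((s + f) / 2)"

fun geod_points :: "geodesic \<Rightarrow> complex set" where
  "geod_points (s, f) =
     {z. Im z > 0 \<and> dist z (geod_center (s, f)) = \<bar>f - s\<bar> / 2}"

text \<open>The tangent line at a point of the semicircle is orthogonal to the radius.\<close>

definition geod_tangent :: "geodesic \<Rightarrow> complex \<Rightarrow> complex" where
  "geod_tangent l P = \<i> * (P - geod_center l)"

definition transverse_at :: "geodesic \<Rightarrow> geodesic \<Rightarrow> complex \<Rightarrow> bool" where
  "transverse_at l l' P \<longleftrightarrow>
     P \<in> geod_points l \<and> P \<in> geod_points l' \<and>
     \<not> collinear {0, geod_tangent l P, geod_tangent l' P}"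

text \<open>
  The translate of a geodesic, for geodesics whose endpoints are irrational (so that no endpoint
  is sent to infinity).
\<close>

fun geod_act :: "mat2 \<Rightarrow> geodesic \<Rightarrow> geodesic" where
  "geod_act g (s, f) = (moebius g s, moebius g f)"

text \<open>
  The half-open segment from \<open>z\<close> (included) to \<open>w\<close> (excluded) of a geodesic through \<open>z\<close> and \<open>w\<close>:
  the real part is strictly monotone along a semicircle.
\<close>

definition geod_segment :: "geodesic \<Rightarrow> complex \<Rightarrow> complex \<Rightarrow> complex set" where
  "geod_segment l z w =
     {P \<in> geod_points l. Re P \<in> closed_segment (Re z) (Re w)} - {w}"

definition first_root :: "bqf \<Rightarrow> real" where
  "first_root q = (- of_int (coefB q) + sqrt (of_int (bqf_disc q))) / (2 * of_int (coefA q))"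

definition second_root :: "bqf \<Rightarrow> real" where
  "second_root q = (- of_int (coefB q) - sqrt (of_int (bqf_disc q))) / (2 * of_int (coefA q))"

definition root_geod :: "bqf \<Rightarrow> geodesic" where
  "root_geod q = (second_root q, first_root q)"

definition pell_solutions :: "int \<Rightarrow> (int \<times> int) set" where
  "pell_solutions D = {(t, u). t > 0 \<and> u > 0 \<and> t\<^sup>2 - D * u\<^sup>2 = 4}"

definition pell_min :: "int \<Rightarrow> int \<times> int" where
  "pell_min D =
     (THE s. s \<in> pell_solutions D \<and>
        (\<forall>s'\<in>pell_solutions D. fst s \<le> fst s' \<and> snd s \<le> snd s'))"

text \<open>The divisions by 2 are exact, because \<open>T \<equiv> D U \<equiv> B U\<close> modulo 2.\<close>

definition automorph :: "bqf \<Rightarrow> mat2" where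
  "automorph q =
     (let (T, U) = pell_min (bqf_disc q)
      in ((T - coefB q * U) div 2, - coefC q * U, coefA q * U, (T + coefB q * U) div 2))"

definition int_num_at :: "complex \<Rightarrow> bqf \<Rightarrow> bqf \<Rightarrow> nat" where
  "int_num_at z q1 q2 =
     card {(l, P). l \<in> (\<lambda>g. geod_act g (root_geod q1)) ` Gamma \<and>
                   P \<in> geod_segment (root_geod q2) z (moebius (automorph q2) z) \<and>
                   transverse_at l (root_geod q2) P}"

definition int_num :: "bqf \<Rightarrow> bqf \<Rightarrow> nat" where
  "int_num q1 q2 = int_num_at (SOME z. z \<in> geod_points (root_geod q2)) q1 q2"

definition total_int_num :: "int \<Rightarrow> int \<Rightarrow> nat" where
  "total_int_num D1 D2 =
     (\<Sum>K1\<in>Cl_plus D1. \<Sum>K2\<in>Cl_plus D2. int_num (SOME q. q \<in> K1) (SOME q. q \<in> K2))"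

definition S_set :: "int \<Rightarrow> int \<Rightarrow> int set" where
  "S_set D1 D2 =
     {n. real_of_int \<bar>n\<bar> < sqrt (of_int (D1 * D2)) \<and> [n = D1 * D2] (mod 2)}"

definition pair_count :: "int \<Rightarrow> int \<Rightarrow> int \<Rightarrow> nat" where
  "pair_count D1 D2 n =
     card ({(q1, q2). bqf_disc q1 = D1 \<and> bqf_disc q2 = D2 \<and> B_Delta q1 q2 = n} // bqf_equiv2)"

text \<open>The Kronecker symbol at a prime; at odd primes it is the Legendre symbol.\<close>

definition kronecker_prime :: "int \<Rightarrow> nat \<Rightarrow> int" where
  "kronecker_prime a p =
     (if p = 2 then (if even a then 0 else if a mod 8 = 1 \<or> a mod 8 = 7 then 1 else -1)
      else Legendre a (int p))"

text \<open>Unspecified at primes where the Kronecker symbols of \<open>D1\<close> and \<open>D2\<close> are \<open>1\<close> and \<open>-1\<close>.\<close>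

definition eps_prime :: "int \<Rightarrow> int \<Rightarrow> nat \<Rightarrow> int" where
  "eps_prime D1 D2 p = (THE e. e \<in> {kronecker_prime D1 p, kronecker_prime D2 p} \<and> e \<noteq> 0)"

definition eps :: "int \<Rightarrow> int \<Rightarrow> nat \<Rightarrow> int" where
  "eps D1 D2 d = (\<Prod>p\<in>#prime_factorization d. eps_prime D1 D2 p)"

end

theory Submission
  imports Defs "HOL-Analysis.Kronecker_Approximation_Theorem"
begin

text \<open>
  Two geodesics of forms \<open>q1, q2\<close> cross iff \<open>B_Delta(q1, q2)\<^sup>2 < D1 D2\<close>, and a segment from \<open>z\<close> to
  \<open>\<gamma> z\<close> is a fundamental domain for the stabiliser of \<open>q2\<close>, which is generated up to sign by the
  automorph \<open>\<gamma>\<close>. So intersections of the two closed geodesics are pairs of forms modulo simultaneous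
  equivalence, which is the first equality.

  For the second, put \<open>N = (D1 D2 - n\<^sup>2) / 4\<close>. Any two pairs with invariant \<open>n\<close> are conjugate over the
  rationals (Skolem--Noether), so up to orientation the classes of pairs correspond to the lattices, up
  to homothety, on which both forms of a fixed base pair are integral after rescaling. Such a lattice is
  a common root of the two forms modulo some \<open>m\<close>, necessarily a divisor of \<open>N\<close>; by the Chinese
  remainder theorem the number of common roots is a product of local factors, and each is
  \<open>\<Sum>j\<le>k. \<epsilon>(p)\<^sup>j\<close> with \<open>k\<close> the exponent of \<open>p\<close> in \<open>N\<close>. If the resulting sum is nonzero, a base pair
  exists: it amounts to a zero of the ternary form \<open>D1 a\<^sup>2 - 2 n a A + D2 A\<^sup>2 - u\<^sup>2\<close>, which after passing
  to a sublattice is a multiple of an integral form of discriminant \<open>\<plusminus>1\<close>, and such a form is isotropic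
  by Hermite reduction.
\<close>

section \<open>Fundamental discriminants\<close>

text \<open>The count of lattices is relative to a base pair and says nothing if there is none; that
  the divisor sum vanishes then is a separate existence problem. A prime with
  \<open>eps_prime\<close> -1 and odd exponent in N makes the sum zero. If there is no such prime,
  then D1 or D2 has a square root modulo every prime of odd exponent, and these square roots cut out
  the sublattice on which the ternary form becomes unimodular. The factor 2 is a sign: the index of
  a lattice may be taken negative, which reverses the orientation, and the two signs are never
  equivalent under determinant 1. The base pair is first moved so that the leading coefficient of
  its first form is prime to N; each lattice is then described by an index and a single residue.
  Sums and cardinalities over infinite sets are 0 by convention, so the classes of forms and the
  crossings have to be shown finite; for the crossings this is read off from the arithmetic
  count.\<close>

definition fund_disc :: "int \<Rightarrow> bool" where
  "fund_disc D \<longleftrightarrow> D > 0 \<and> sqrt (of_int D) \<notin> \<rat> \<and> (D mod 4 = 0 \<or> D mod 4 = 1) \<and>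
     (\<forall>p D'. prime p \<and> D = p\<^sup>2 * D' \<longrightarrow> \<not> (D' mod 4 = 0 \<or> D' mod 4 = 1))"

section \<open>Trace and norm of the algebraic integers in a real quadratic field\<close>

definition quad_lattice :: "int \<Rightarrow> real set" where
  "quad_lattice m = {of_int u + of_int v * sqrt (of_int m) | u v. True}"

lemma quad_latticeI: "x = of_int u + of_int v * sqrt (of_int m) \<Longrightarrow> x \<in> quad_lattice m"
  by (auto simp: quad_lattice_def)

lemma quad_latticeE:
  assumes "x \<in> quad_lattice m"
  obtains u v where "x = of_int u + of_int v * sqrt (of_int m)"
  using assms by (auto simp: quad_lattice_def)

lemma quad_lattice_add: "x \<in> quad_lattice m \<Longrightarrow> y \<in> quad_lattice m \<Longrightarrow> x + y \<in> quad_lattice m"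
proof -
  assume "x \<in> quad_lattice m" "y \<in> quad_lattice m"
  then obtain u v u' v' where "x = of_int u + of_int v * sqrt (of_int m)"
    "y = of_int u' + of_int v' * sqrt (of_int m)" by (auto elim!: quad_latticeE)
  then have "x + y = of_int (u + u') + of_int (v + v') * sqrt (of_int m)"
    by (simp add: algebra_simps)
  then show ?thesis by (rule quad_latticeI)
qed

lemma quad_lattice_mult:
  assumes "m > 0" "x \<in> quad_lattice m" "y \<in> quad_lattice m"
  shows "x * y \<in> quad_lattice m"
proof -
  obtain u v u' v' where xy: "x = of_int u + of_int v * sqrt (of_int m)"
    "y = of_int u' + of_int v' * sqrt (of_int m)" using assms by (auto elim!: quad_latticeE)
  have s: "sqrt (of_int m) * sqrt (of_int m) = of_int m" using assms by simp
  have "x * y = of_int u * of_int u' + of_int v * of_int v' * (sqrt (of_int m) * sqrt (of_int m)) + (of_int u * of_int v' + of_int v * of_int u') * sqrt (of_int m)"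
    unfolding xy by (simp add: algebra_simps)
  then have "x * y = of_int (u * u' + v * v' * m) + of_int (u * v' + v * u') * sqrt (of_int m)"
    unfolding s by simp
  then show ?thesis by (rule quad_latticeI)
qed

lemma quad_lattice_of_int: "of_int k \<in> quad_lattice m"
  by (rule quad_latticeI[of _ k 0]) simp

lemma quad_lattice_sum: "(\<And>i. i \<in> A \<Longrightarrow> f i \<in> quad_lattice m) \<Longrightarrow> sum f A \<in> quad_lattice m"
  by (induction A rule: infinite_finite_induct)
     (use quad_lattice_of_int[of 0] in \<open>auto intro: quad_lattice_add\<close>)

lemma quad_lattice_power: "m > 0 \<Longrightarrow> x \<in> quad_lattice m \<Longrightarrow> x ^ k \<in> quad_lattice m"
  by (induction k) (use quad_lattice_of_int[of 1] in \<open>auto intro: quad_lattice_mult\<close>)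

lemma irrational_combination_zero:
  fixes r s :: rat
  assumes "sqrt (of_int m) \<notin> \<rat>" "of_rat r + of_rat s * sqrt (of_int m) = 0"
  shows "r = 0 \<and> s = 0"
proof -
  have "s = 0"
  proof (rule ccontr)
    assume "s \<noteq> 0"
    then have "sqrt (of_int m) = of_rat (- r / s)"
      using assms(2) by (simp add: field_simps of_rat_divide of_rat_minus)
    then show False using assms(1) by auto
  qed
  then show ?thesis using assms(2) by simp
qed

lemma quad_elt_eq_iff:
  assumes "sqrt (of_int m) \<notin> \<rat>"
  shows "quad_elt m a b = quad_elt m c d \<longleftrightarrow> a = c \<and> b = d"
proof
  assume "quad_elt m a b = quad_elt m c d"
  then have "of_rat (a - c) + of_rat (b - d) * sqrt (of_int m) = 0"
    by (simp add: quad_elt_def of_rat_diff algebra_simps)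
  from irrational_combination_zero[OF assms this] show "a = c \<and> b = d" by simp
qed simp

lemma quad_lattice_Rats:
  assumes "sqrt (of_int m) \<notin> \<rat>" "of_rat r \<in> quad_lattice m"
  shows "r \<in> \<int>"
proof -
  obtain u v where "of_rat r = of_int u + of_int v * sqrt (of_int m)" using assms quad_latticeE by blast
  then have "quad_elt m r 0 = quad_elt m (of_int u) (of_int v)" by (simp add: quad_elt_def)
  then show ?thesis using quad_elt_eq_iff[OF assms(1)] by auto
qed

lemma quad_elt_times:
  assumes "m > 0"
  shows "quad_elt m a b * quad_elt m c d = quad_elt m (a * c + b * d * of_int m) (a * d + b * c)"
proof -
  have s: "sqrt (of_int m) * sqrt (of_int m) = of_int m" using assms by simp
  have "quad_elt m a b * quad_elt m c d = of_rat a * of_rat c + of_rat b * of_rat d * (sqrt (of_int m) * sqrt (of_int m)) + (of_rat a * of_rat d + of_rat b * of_rat c) * sqrt (of_int m)"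
    by (simp add: quad_elt_def algebra_simps)
  then show ?thesis unfolding s by (simp add: quad_elt_def of_rat_add of_rat_mult)
qed

lemma quad_elt_plus: "quad_elt m a b + quad_elt m c d = quad_elt m (a + c) (b + d)"
  by (simp add: quad_elt_def of_rat_add algebra_simps)

text \<open>Conjugation is a ring homomorphism fixing the integers, so it commutes with evaluating
  an integral polynomial. The coordinates r, s are carried through the induction because conjugation
  is expressed on coordinates and not as a map on the reals.\<close>

lemma poly_quad_elt_conj:
  fixes p :: "real poly"
  assumes "m > 0" "\<forall>i. Polynomial.coeff p i \<in> \<int>"
  shows "\<exists>r s. poly p (quad_elt m a b) = quad_elt m r s \<and> poly p (quad_elt m a (-b)) = quad_elt m r (-s)"
  using assms(2)
proof (induction p)
  case 0
  show ?case by (rule exI[of _ 0], rule exI[of _ 0]) (simp add: quad_elt_def)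
next
  case (pCons c p)
  have "\<forall>i. Polynomial.coeff p i \<in> \<int>"
    using pCons.prems by (metis coeff_pCons_Suc)
  then obtain r s where rs: "poly p (quad_elt m a b) = quad_elt m r s" "poly p (quad_elt m a (-b)) = quad_elt m r (-s)"
    using pCons.IH by blast
  obtain k where k: "c = of_int k" using pCons.prems[rule_format, of 0] by (auto simp: Ints_def)
  have c: "c = quad_elt m (of_int k) 0" by (simp add: quad_elt_def k)
  show ?case
    by (intro exI[of _ "of_int k + (a * r + b * s * of_int m)"] exI[of _ "a * s + b * r"])
       (simp add: rs quad_elt_times[OF assms(1)], simp add: c quad_elt_plus)
qed

lemma algebraic_int_quad_conj:
  assumes "m > 0" "sqrt (of_int m) \<notin> \<rat>" "algebraic_int (quad_elt m a b)"
  shows "algebraic_int (quad_elt m a (-b))"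
proof -
  obtain p where p: "lead_coeff p = 1" "\<forall>i. Polynomial.coeff p i \<in> \<int>" "poly p (quad_elt m a b) = 0"
    using assms(3) by (auto elim: algebraic_int.cases)
  obtain r s where rs: "poly p (quad_elt m a b) = quad_elt m r s" "poly p (quad_elt m a (-b)) = quad_elt m r (-s)"
    using poly_quad_elt_conj[OF assms(1) p(2)] by blast
  have "quad_elt m r s = quad_elt m 0 0" using p rs by (simp add: quad_elt_def)
  then have "r = 0" "s = 0" using quad_elt_eq_iff[OF assms(2)] by auto
  then have "poly p (quad_elt m a (-b)) = 0" using rs by (simp add: quad_elt_def)
  then show ?thesis using p algebraic_int.intros by blast
qed

lemma quad_elt_scaled:
  obtains q :: int where "q > 0" "of_int q * quad_elt m a b \<in> quad_lattice m"
proof -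
  obtain u v where uv: "a = of_int u / of_int v" "v > 0" by (meson quotient_of_div quotient_of_denom_pos prod.exhaust_sel)
  obtain u' v' where uv': "b = of_int u' / of_int v'" "v' > 0" by (meson quotient_of_div quotient_of_denom_pos prod.exhaust_sel)
  have "of_int (v * v') * quad_elt m a b = of_int (u * v') + of_int (u' * v) * sqrt (of_int m)"
    using uv(2) uv'(2) unfolding uv(1) uv'(1)
    by (simp add: quad_elt_def of_rat_divide of_rat_mult field_simps)
  then have "of_int (v * v') * quad_elt m a b \<in> quad_lattice m" by (rule quad_latticeI)
  then show thesis using that[of "v * v'"] uv uv' by auto
qed

text \<open>A monic equation of degree n rewrites every power w^k with k >= n through lower ones. So
  q^n, which clears the denominators of the powers below n, clears those of all powers.\<close>

lemma algebraic_int_quad_powers: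
  assumes "m > 0" "algebraic_int (quad_elt m a b)"
  obtains d :: int where "d > 0" "\<And>k. of_int d * quad_elt m a b ^ k \<in> quad_lattice m"
proof -
  define w where "w = quad_elt m a b"
  obtain q :: int where q: "q > 0" "of_int q * w \<in> quad_lattice m"
    unfolding w_def by (rule quad_elt_scaled)
  obtain p where p: "lead_coeff p = 1" "\<forall>i. Polynomial.coeff p i \<in> \<int>" "poly p w = 0"
    using assms(2) w_def by (auto elim: algebraic_int.cases)
  define n where "n = degree p"
  have rel: "w ^ n = - (\<Sum>i<n. Polynomial.coeff p i * w ^ i)"
  proof -
    have "0 = (\<Sum>i\<le>n. Polynomial.coeff p i * w ^ i)" using p(3) by (simp add: poly_altdef n_def)
    also have "\<dots> = (\<Sum>i<n. Polynomial.coeff p i * w ^ i) + w ^ n"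
      using p(1) by (simp add: n_def lessThan_Suc_atMost[symmetric])
    finally show ?thesis by simp
  qed
  have "of_int (q ^ n) * w ^ k \<in> quad_lattice m" for k
  proof (induction k rule: less_induct)
    case (less k)
    show ?case
    proof (cases "k < n")
      case True
      have "of_int (q ^ n) * w ^ k = of_int (q ^ (n - k)) * (of_int q * w) ^ k"
        using True by (simp add: power_mult_distrib flip: power_add)
      then show ?thesis
        using quad_lattice_mult[OF assms(1) quad_lattice_of_int quad_lattice_power[OF assms(1) q(2)]] by metis
    next
      case False
      have "of_int (q ^ n) * w ^ k = of_int (q ^ n) * w ^ (k - n) * w ^ n"
        using False by (simp flip: power_add mult.assoc)
      also have "\<dots> = (\<Sum>i<n. (- Polynomial.coeff p i) * (of_int (q ^ n) * w ^ (k - n + i)))"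
        unfolding rel by (simp add: sum_distrib_left power_add mult_ac sum_negf)
      also have "\<dots> \<in> quad_lattice m"
      proof (rule quad_lattice_sum)
        fix i assume i: "i \<in> {..<n}"
        have "of_int (q ^ n) * w ^ (k - n + i) \<in> quad_lattice m"
          using i False by (intro less.IH) auto
        moreover have "- Polynomial.coeff p i \<in> quad_lattice m"
          using p(2) by (metis Ints_cases Ints_minus quad_lattice_of_int)
        ultimately show "- Polynomial.coeff p i * (of_int (q ^ n) * w ^ (k - n + i)) \<in> quad_lattice m"
          using quad_lattice_mult[OF assms(1)] by blast
      qed
      finally show ?thesis .
    qed
  qed
  then show thesis using that[of "q ^ n"] q w_def by simp
qed

text \<open>If v is the reduced denominator of r, then v^k divides d for every k; as 2^d > d, only v
  = 1 is left.\<close>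

lemma rat_bounded_denominator_powers:
  fixes r :: rat
  assumes "d > 0" "\<And>k. of_int d * r ^ k \<in> \<int>"
  shows "r \<in> \<int>"
proof -
  obtain u v where uv: "r = of_int u / of_int v" "v > 0" "coprime u v"
    by (metis quotient_of_div quotient_of_denom_pos quotient_of_coprime prod.exhaust_sel)
  have dv: "v ^ k dvd d" for k
  proof -
    obtain z where "of_int d * r ^ k = of_int z" using assms(2)[of k] by (auto simp: Ints_def)
    then have "of_int d * of_int u ^ k = of_int z * (of_int v :: rat) ^ k"
      using uv by (simp add: power_divide field_simps)
    then have "d * u ^ k = z * v ^ k"
      by (metis of_int_eq_iff of_int_mult of_int_power)
    then have "v ^ k dvd d * u ^ k" by simp
    moreover have "coprime (v ^ k) (u ^ k)" using uv(3) by (simp add: coprime_commute)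
    ultimately show ?thesis by (simp add: coprime_dvd_mult_left_iff)
  qed
  have "v = 1"
  proof (rule ccontr)
    assume "v \<noteq> 1"
    then have "v \<ge> 2" using uv by simp
    then have "2 ^ nat d \<le> v ^ nat d" by (simp add: power_mono)
    moreover have "d < 2 ^ nat d"
      using of_nat_less_two_power[of "nat d", where 'a = int] assms(1) by simp
    moreover have "v ^ nat d \<le> d" using dv assms(1) by (simp add: zdvd_imp_le)
    ultimately show False by simp
  qed
  then show ?thesis using uv by simp
qed

text \<open>\<open>d * d'\<close> is a common denominator for all monomials in w and its conjugate.
  The binomial expansion therefore bounds the denominators of all powers of the trace, and a single
  monomial those of the norm.\<close>

lemma algebraic_int_quad_trace_norm:
  assumes "m > 0" "sqrt (of_int m) \<notin> \<rat>" "algebraic_int (quad_elt m a b)"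
  shows "2 * a \<in> \<int>" and "a\<^sup>2 - of_int m * b\<^sup>2 \<in> \<int>"
proof -
  define w w' where "w = quad_elt m a b" and "w' = quad_elt m a (-b)"
  obtain d where d: "d > 0" "\<And>k. of_int d * w ^ k \<in> quad_lattice m"
    using algebraic_int_quad_powers[OF assms(1,3)] w_def by metis
  obtain d' where d': "d' > 0" "\<And>k. of_int d' * w' ^ k \<in> quad_lattice m"
    using algebraic_int_quad_powers[OF assms(1) algebraic_int_quad_conj[OF assms]] w'_def by metis
  have sm: "w + w' = of_rat (2 * a)"
    by (simp add: w_def w'_def quad_elt_def of_rat_mult of_rat_minus)
  have pr: "w * w' = of_rat (a\<^sup>2 - of_int m * b\<^sup>2)"
    unfolding w_def w'_def quad_elt_times[OF assms(1)]
    by (simp add: quad_elt_def power2_eq_square algebra_simps)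
  have dd: "d * d' > 0" using d d' by simp
  have 1: "of_int (d * d') * (w ^ i * w' ^ j) \<in> quad_lattice m" for i j
    using quad_lattice_mult[OF assms(1) d(2)[of i] d'(2)[of j]] by (simp add: mult_ac)
  show "2 * a \<in> \<int>"
  proof (rule rat_bounded_denominator_powers[OF dd])
    fix k
    have "of_rat (of_int (d * d') * (2 * a) ^ k) = of_int (d * d') * (w + w') ^ k"
      by (simp add: sm of_rat_mult of_rat_power)
    also have "\<dots> = (\<Sum>i\<le>k. of_int (int (k choose i)) * (of_int (d * d') * (w ^ i * w' ^ (k - i))))"
      by (simp add: binomial_ring sum_distrib_left mult_ac)
    also have "\<dots> \<in> quad_lattice m"
      by (intro quad_lattice_sum quad_lattice_mult[OF assms(1) quad_lattice_of_int 1])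
    finally show "of_int (d * d') * (2 * a) ^ k \<in> \<int>" using quad_lattice_Rats[OF assms(2)] by blast
  qed
  show "a\<^sup>2 - of_int m * b\<^sup>2 \<in> \<int>"
  proof (rule rat_bounded_denominator_powers[OF dd])
    fix k
    have "of_rat (of_int (d * d') * (a\<^sup>2 - of_int m * b\<^sup>2) ^ k) = of_int (d * d') * (w ^ k * w' ^ k)"
      using pr by (simp add: of_rat_mult of_rat_power flip: power_mult_distrib)
    then show "of_int (d * d') * (a\<^sup>2 - of_int m * b\<^sup>2) ^ k \<in> \<int>"
      using 1 quad_lattice_Rats[OF assms(2)] by metis
  qed
qed

lemma square_mod_4: "(x::int)\<^sup>2 mod 4 = (if even x then 0 else 1)"
proof (cases "even x")
  case True then show ?thesis by (auto simp: power2_eq_square elim!: evenE)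
next
  case False
  then obtain k where "x = 2 * k + 1" by (auto elim: oddE)
  then have "x\<^sup>2 = 4 * (k\<^sup>2 + k) + 1" by (simp add: power2_eq_square algebra_simps)
  then have "x\<^sup>2 mod 4 = 1" by (simp only: mod_mult_self4) simp
  then show ?thesis using False by simp
qed

text \<open>\<open>fund_disc\<close> is all that the later arguments know about D: it is a
  discriminant from which no p^2 can be removed leaving another discriminant. The proof completes 1
  to an integral basis 1, X + Y sqrt m; then D is the square of the trace of the second element
  minus four times its norm.\<close>

lemma pos_fundamental_disc_imp_fund_disc:
  assumes "pos_fundamental_disc D"
  shows "fund_disc D"
proof -
  obtain m where m: "m > 0" "sqrt (of_int m) \<notin> \<rat>" and qf: "quad_field_disc m D"
    using assms by (auto simp: pos_fundamental_disc_def)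
  obtain a1 b1 a2 b2 where O: "quad_integers m =
          {of_int u * quad_elt m a1 b1 + of_int v * quad_elt m a2 b2 | (u::int) (v::int). True}"
    and Dr: "real_of_int D = (quad_elt m a1 b1 * quad_elt m a2 (- b2) - quad_elt m a2 b2 * quad_elt m a1 (- b1))\<^sup>2"
    using qf unfolding quad_field_disc_def by blast
  define e where "e = a1 * b2 - a2 * b1"
  have comb: "of_int u * quad_elt m a1 b1 + of_int v * quad_elt m a2 b2 =
     quad_elt m (of_int u * a1 + of_int v * a2) (of_int u * b1 + of_int v * b2)" for u v :: int
    by (simp add: quad_elt_def of_rat_add of_rat_mult algebra_simps)
  have inO: "\<exists>u v :: int. x = of_int u * a1 + of_int v * a2 \<and> y = of_int u * b1 + of_int v * b2"
    if "algebraic_int (quad_elt m x y)" for x y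
  proof -
    have "quad_elt m x y \<in> quad_integers m" using that by (auto simp: quad_integers_def)
    then obtain u v :: int where "quad_elt m x y = of_int u * quad_elt m a1 b1 + of_int v * quad_elt m a2 b2"
      unfolding O by blast
    then show ?thesis unfolding comb quad_elt_eq_iff[OF m(2)] by blast
  qed
  have Oin: "algebraic_int (quad_elt m (of_int u * a1 + of_int v * a2) (of_int u * b1 + of_int v * b2))" for u v :: int
  proof -
    have "quad_elt m (of_int u * a1 + of_int v * a2) (of_int u * b1 + of_int v * b2) \<in> quad_integers m"
      unfolding O comb[symmetric] by blast
    then show ?thesis by (simp add: quad_integers_def)
  qed
  obtain u v :: int where one: "1 = of_int u * a1 + of_int v * a2" "0 = of_int u * b1 + of_int v * b2"
    using inO[of 1 0] by (auto simp: quad_elt_def)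
  \<comment> \<open>1 is a primitive vector of the lattice of integers: otherwise 1 / g would be an
    algebraic integer.\<close>
  have g: "gcd u v = 1"
  proof -
    define g where "g = gcd u v"
    have "g \<noteq> 0" using one(1) g_def by auto
    then have gp: "g > 0" using g_def by (simp add: less_le)
    obtain u' v' where uv: "u = g * u'" "v = g * v'" using g_def by (meson dvdE gcd_dvd1 gcd_dvd2)
    have "of_int g * (of_int u' * a1 + of_int v' * a2) = 1" "of_int g * (of_int u' * b1 + of_int v' * b2) = 0"
      using one unfolding uv by (simp_all add: algebra_simps)
    then have "of_int u' * a1 + of_int v' * a2 = 1 / of_int g"
      using gp by (simp add: field_simps)
    moreover have "of_int u' * b1 + of_int v' * b2 = 0"
      using \<open>of_int g * (of_int u' * b1 + of_int v' * b2) = 0\<close> gp by (metis less_irrefl mult_eq_0_iff of_int_eq_0_iff)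
    ultimately have "of_int u' * a1 + of_int v' * a2 = 1 / of_int g" "of_int u' * b1 + of_int v' * b2 = 0"
      by simp_all
    then have "algebraic_int (quad_elt m (1 / of_int g) 0)" using Oin[of u' v'] by simp
    then have "algebraic_int (1 / of_int g :: real)" by (simp add: quad_elt_def of_rat_divide)
    then have "(1 / of_int g :: real) \<in> \<int>" by (rule rational_algebraic_int_is_int) auto
    then obtain z where "1 / of_int g = (of_int z :: real)" by (auto simp: Ints_def)
    then have "1 = of_int z * (of_int g :: real)" using gp by (simp add: field_simps)
    then have "1 = z * g" by (metis of_int_1 of_int_eq_iff of_int_mult)
    then show ?thesis using gp g_def by (metis abs_of_pos dvd_triv_right zdvd1_eq)
  qed
  obtain x y where xy: "x * u + y * v = 1" using bezout_int[of u v] g by auto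
  define X Y where "X = - of_int y * a1 + of_int x * a2" and "Y = - of_int y * b1 + of_int x * b2"
  have xyr: "of_int x * of_int u + of_int y * of_int v = (1::rat)"
    using xy by (metis of_int_1 of_int_add of_int_mult)
  \<comment> \<open>The change of basis with rows (u, v) and (-y, x) has determinant 1, so it
    preserves the determinant \<open>e\<close>.\<close>
  have Ye: "Y = e"
  proof -
    have "Y = Y * (of_int u * a1 + of_int v * a2) - X * (of_int u * b1 + of_int v * b2)"
      using one by simp
    also have "\<dots> = (of_int x * of_int u + of_int y * of_int v) * e"
      unfolding X_def Y_def e_def by (simp add: algebra_simps)
    finally show ?thesis using xyr by simp
  qed
  have alg: "algebraic_int (quad_elt m X Y)" using Oin[of "-y" x] by (simp add: X_def Y_def)
  have Dm: "real_of_int D = 4 * of_int m * (of_rat e)\<^sup>2"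
  proof -
    have s: "(sqrt (of_int m))\<^sup>2 = of_int m" using m(1) by simp
    have "real_of_int D = (- 2 * of_rat e * sqrt (of_int m))\<^sup>2"
      unfolding Dr quad_elt_def e_def
      by (rule arg_cong[where f = "\<lambda>x. x\<^sup>2"]) (simp add: of_rat_minus of_rat_diff of_rat_mult algebra_simps)
    then show ?thesis using s by (simp add: power_mult_distrib)
  qed
  have Dq: "(of_int D :: rat) = 4 * of_int m * e\<^sup>2"
  proof -
    have "(of_rat (of_int D) :: real) = of_rat (4 * of_int m * e\<^sup>2)"
      using Dm by (simp add: of_rat_mult of_rat_power)
    then show ?thesis by (simp only: of_rat_eq_iff)
  qed
  have e0: "e \<noteq> 0"
  proof
    assume "e = 0"
    have "algebraic_int (quad_elt m 0 1)" using m by (simp add: quad_elt_def algebraic_int_sqrt)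
    then obtain k l :: int where kl: "0 = of_int k * a1 + of_int l * a2" "1 = of_int k * b1 + of_int l * b2"
      using inO by blast
    have "(of_int u * a1 + of_int v * a2) * (of_int k * b1 + of_int l * b2) - (of_int k * a1 + of_int l * a2) * (of_int u * b1 + of_int v * b2) = (of_int u * of_int l - of_int v * of_int k) * e"
      unfolding e_def by (simp add: algebra_simps)
    then show False using \<open>e = 0\<close> one kl by simp
  qed
  have Dpos: "D > 0"
  proof -
    have "(of_int D :: rat) > 0" unfolding Dq using m e0 by simp
    then show ?thesis by simp
  qed
  have sD: "sqrt (of_int D) = of_rat (2 * \<bar>e\<bar>) * sqrt (of_int m)"
  proof -
    have "of_rat \<bar>e\<bar> = \<bar>of_rat e :: real\<bar>" by (simp add: abs_if of_rat_minus)
    then show ?thesis unfolding Dm by (simp add: real_sqrt_mult of_rat_mult)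
  qed
  have irr: "sqrt (of_int D) \<notin> \<rat>"
  proof
    assume "sqrt (of_int D) \<in> \<rat>"
    then have "of_rat (inverse (2 * \<bar>e\<bar>)) * sqrt (of_int D) \<in> \<rat>" by (intro Rats_mult) auto
    moreover have "of_rat (inverse (2 * \<bar>e\<bar>)) * sqrt (of_int D) = sqrt (of_int m)"
      unfolding sD using e0 by (simp add: of_rat_inverse of_rat_divide of_rat_mult field_simps)
    ultimately show False using m by simp
  qed
  have mod4: "D mod 4 = 0 \<or> D mod 4 = 1"
  proof -
    obtain t n where tn: "2 * X = of_int t" "X\<^sup>2 - of_int m * Y\<^sup>2 = of_int n"
      using algebraic_int_quad_trace_norm[OF m alg] by (auto simp: Ints_def)
    have "(of_int D :: rat) = (2 * X)\<^sup>2 - 4 * (X\<^sup>2 - of_int m * Y\<^sup>2)"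
      unfolding Dq Ye by (simp add: algebra_simps power2_eq_square)
    also have "\<dots> = of_int (t\<^sup>2 - 4 * n)" unfolding tn by simp
    finally have "D = t\<^sup>2 - 4 * n" by (simp only: of_int_eq_iff)
    moreover have "t\<^sup>2 mod 4 = 0 \<or> t\<^sup>2 mod 4 = 1" by (simp add: square_mod_4)
    ultimately show ?thesis by presburger
  qed
  have nosq: "\<not> (D' mod 4 = 0 \<or> D' mod 4 = 1)" if p: "prime p" "D = p\<^sup>2 * D'" for p D'
  proof
    assume D': "D' mod 4 = 0 \<or> D' mod 4 = 1"
    have pp: "p > 1" using p by (simp add: prime_gt_1_int)
    define z where "z = \<bar>e\<bar> / of_int p"
    have sD': "sqrt (of_int D') = of_rat (2 * z) * sqrt (of_int m)"
    proof -
      have "sqrt (of_int D) = of_int p * sqrt (of_int D')"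
        unfolding p(2) using pp by (simp add: real_sqrt_mult)
      then show ?thesis using sD pp by (simp add: z_def of_rat_mult of_rat_divide field_simps)
    qed
    \<comment> \<open>If D / p^2 were a discriminant, (D' + sqrt D') / 2 would be an integer of the
      field whose determinant with 1 is |e| / p, although all such determinants are multiples of
      e.\<close>
    define w where "w = quad_elt m (of_int D' / 2) z"
    have w: "w = (of_int D' + sqrt (of_int D')) / 2"
      unfolding w_def quad_elt_def sD' by (simp add: of_rat_divide of_rat_mult field_simps)
    have D'pos: "D' > 0" using Dpos p pp by (simp add: zero_less_mult_iff)
    have dv: "4 dvd D'\<^sup>2 - D'"
    proof -
      have "D'\<^sup>2 - D' = D' * (D' - 1)" by (simp add: power2_eq_square algebra_simps)
      moreover have "4 dvd D' \<or> 4 dvd D' - 1" using D' by presburger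
      ultimately show ?thesis by auto
    qed
    then obtain c where c: "D'\<^sup>2 - D' = 4 * c" by (auto elim: dvdE)
    have cr: "(of_int D')\<^sup>2 - of_int D' = 4 * (of_int c :: real)"
      using arg_cong[OF c, of "of_int :: int \<Rightarrow> real"] by simp
    have "algebraic_int w"
    proof (rule algebraic_int.intros[of "[: of_int c, - of_int D', 1:]"])
      have "(sqrt (of_int D'))\<^sup>2 = of_int D'" using D'pos by simp
      then have "4 * (of_int c + w * (w - of_int D')) = 0"
        unfolding w using cr by (simp add: field_simps power2_eq_square)
      then show "poly [: of_int c, - of_int D', 1:] w = 0" by (simp add: algebra_simps)
    qed (auto simp: coeff_pCons split: nat.splits)
    then obtain k l :: int where kl: "of_int D' / 2 = of_int k * a1 + of_int l * a2" "z = of_int k * b1 + of_int l * b2"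
      using inO w_def by blast
    have "(of_int u * a1 + of_int v * a2) * (of_int k * b1 + of_int l * b2) - (of_int k * a1 + of_int l * a2) * (of_int u * b1 + of_int v * b2) = (of_int u * of_int l - of_int v * of_int k) * e"
      unfolding e_def by (simp add: algebra_simps)
    then have "z = of_int (u * l - v * k) * e" using one kl by simp
    then have "\<bar>e\<bar> = of_int (p * (u * l - v * k)) * e" using pp by (simp add: z_def field_simps)
    then have "\<bar>\<bar>e\<bar>\<bar> = \<bar>of_int (p * (u * l - v * k))\<bar> * \<bar>e\<bar>" by (metis abs_mult)
    then have "\<bar>of_int (p * (u * l - v * k))\<bar> = (1::rat)" using e0 by simp
    then have "\<bar>p * (u * l - v * k)\<bar> = 1" by (metis of_int_1 of_int_abs of_int_eq_iff)
    then have "p dvd 1" by (metis dvd_abs_iff dvd_triv_left)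
    then show False using pp by simp
  qed
  show ?thesis
    unfolding fund_disc_def
  proof (intro conjI allI impI Dpos irr mod4)
    fix p D' assume "prime p \<and> D = p\<^sup>2 * D'"
    then show "\<not> (D' mod 4 = 0 \<or> D' mod 4 = 1)" using nosq[of p D'] by simp
  qed
qed

section \<open>Unimodular ternary forms\<close>

definition tern :: "int \<Rightarrow> int \<Rightarrow> int \<Rightarrow> int \<Rightarrow> int \<Rightarrow> int \<Rightarrow> int \<Rightarrow> int \<Rightarrow> int \<Rightarrow> int" where
  "tern a b c r s t x y z = a * x\<^sup>2 + b * y\<^sup>2 + c * z\<^sup>2 + r * y * z + s * x * z + t * x * y"

text \<open>Half the determinant of the matrix of second derivatives; a substitution of determinant
  k multiplies it by k^2.\<close>

definition tern_disc :: "int \<Rightarrow> int \<Rightarrow> int \<Rightarrow> int \<Rightarrow> int \<Rightarrow> int \<Rightarrow> int" where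
  "tern_disc a b c r s t = 4 * a * b * c + r * s * t - a * r\<^sup>2 - b * s\<^sup>2 - c * t\<^sup>2"

definition tern_isotropic :: "int \<Rightarrow> int \<Rightarrow> int \<Rightarrow> int \<Rightarrow> int \<Rightarrow> int \<Rightarrow> bool" where
  "tern_isotropic a b c r s t \<longleftrightarrow> (\<exists>x y z. (x, y, z) \<noteq> (0, 0, 0) \<and> tern a b c r s t x y z = 0)"

lemma exists_small_shift:
  fixes a t :: int
  assumes "a \<noteq> 0"
  obtains k where "\<bar>t + 2 * a * k\<bar> \<le> \<bar>a\<bar>"
proof -
  define b where "b = \<bar>a\<bar>"
  have b: "b > 0" using assms b_def by simp
  define j where "j = (t + b) div (2 * b)"
  have "t + b = 2 * b * j + (t + b) mod (2 * b)" unfolding j_def by simp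
  moreover have "0 \<le> (t + b) mod (2 * b)" "(t + b) mod (2 * b) < 2 * b" using b by auto
  ultimately have "\<bar>t - 2 * b * j\<bar> \<le> b" by linarith
  moreover have "t - 2 * b * j = t + 2 * a * (- sgn a * j)"
    using assms by (cases "a > 0") (auto simp: b_def)
  ultimately have "\<bar>t + 2 * a * (- sgn a * j)\<bar> \<le> \<bar>a\<bar>" by (simp only: b_def)
  then show thesis by (rule that)
qed

lemma tern_shift_xy:
  "tern a (a * k\<^sup>2 + t * k + b) c (r + s * k) s (t + 2 * a * k) x y z = tern a b c r s t (x + k * y) y z"
  "tern_disc a (a * k\<^sup>2 + t * k + b) c (r + s * k) s (t + 2 * a * k) = tern_disc a b c r s t"
  by (simp_all add: tern_def tern_disc_def power2_eq_square algebra_simps)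

lemma tern_shift_yz:
  "tern a b (b * k\<^sup>2 + r * k + c) (r + 2 * b * k) (s + t * k) t x y z = tern a b c r s t x (y + k * z) z"
  "tern_disc a b (b * k\<^sup>2 + r * k + c) (r + 2 * b * k) (s + t * k) t = tern_disc a b c r s t"
  by (simp_all add: tern_def tern_disc_def power2_eq_square algebra_simps)

lemma tern_isotropic_shift_xy:
  "tern_isotropic a (a * k\<^sup>2 + t * k + b) c (r + s * k) s (t + 2 * a * k) \<Longrightarrow> tern_isotropic a b c r s t"
  unfolding tern_isotropic_def tern_shift_xy
  by (elim exE conjE, rule_tac x = "x + k * y" in exI, rule_tac x = y in exI, rule_tac x = z in exI) auto

lemma tern_isotropic_shift_yz:
  "tern_isotropic a b (b * k\<^sup>2 + r * k + c) (r + 2 * b * k) (s + t * k) t \<Longrightarrow> tern_isotropic a b c r s t"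
  unfolding tern_isotropic_def tern_shift_yz
  by (elim exE conjE, rule_tac x = x in exI, rule_tac x = "y + k * z" in exI, rule_tac x = z in exI) auto

lemma tern_isotropic_swap_xy: "tern_isotropic b a c s r t \<Longrightarrow> tern_isotropic a b c r s t"
  unfolding tern_isotropic_def
  by (elim exE conjE, rule_tac x = y in exI, rule_tac x = x in exI, rule_tac x = z in exI)
     (auto simp: tern_def algebra_simps)

lemma tern_isotropic_swap_yz: "tern_isotropic a c b r t s \<Longrightarrow> tern_isotropic a b c r s t"
  unfolding tern_isotropic_def
  by (elim exE conjE, rule_tac x = x in exI, rule_tac x = z in exI, rule_tac x = y in exI)
     (auto simp: tern_def algebra_simps)

lemma tern_isotropic_leading_zero: "tern_isotropic 0 b c r s t"
  unfolding tern_isotropic_def by (rule exI[of _ 1], rule exI[of _ 0], rule exI[of _ 0]) (simp add: tern_def)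

lemma square_le_abs_mult: "\<bar>a\<bar> \<le> \<bar>x\<bar> \<Longrightarrow> a\<^sup>2 \<le> \<bar>(a::int) * x\<bar>"
  using mult_left_mono[of "\<bar>a\<bar>" "\<bar>x\<bar>" "\<bar>a\<bar>"] by (simp add: power2_eq_square abs_mult)

lemma square_le_abs: "\<bar>x\<bar> \<le> \<bar>a\<bar> \<Longrightarrow> x\<^sup>2 \<le> (a::int)\<^sup>2"
  by (simp add: abs_le_square_iff)

text \<open>
  Hermite's reduction: alternately reduce the binary form in \<open>x, y\<close> and the form
  \<open>4 a F - (2 a x + t y + s z)\<^sup>2\<close> in \<open>y, z\<close>. When neither step makes progress,
  \<open>27 \<bar>a\<bar>\<^sup>3 \<le> 16\<close>, so \<open>a = 0\<close>.
\<close>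

lemma tern_isotropic_unit_disc:
  assumes "\<bar>tern_disc a b c r s t\<bar> = 1"
  shows "tern_isotropic a b c r s t"
  using assms
proof (induction "nat \<bar>a\<bar> + nat \<bar>4 * a * b - t\<^sup>2\<bar>" arbitrary: a b c r s t rule: less_induct)
  case less
  show ?case
  proof (cases "a = 0")
    case True
    then show ?thesis by (simp add: tern_isotropic_leading_zero)
  next
    case a0: False
    obtain k where k: "\<bar>t + 2 * a * k\<bar> \<le> \<bar>a\<bar>" using exists_small_shift[OF a0] .
    define b1 r1 t1 where "b1 = a * k\<^sup>2 + t * k + b" and "r1 = r + s * k" and "t1 = t + 2 * a * k"
    have d1: "\<bar>tern_disc a b1 c r1 s t1\<bar> = 1"
      using less.prems unfolding b1_def r1_def t1_def tern_shift_xy .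
    have del1: "4 * a * b1 - t1\<^sup>2 = 4 * a * b - t\<^sup>2"
      unfolding b1_def t1_def by (simp add: power2_eq_square algebra_simps)
    have back1: "tern_isotropic a b1 c r1 s t1 \<Longrightarrow> ?thesis"
      unfolding b1_def r1_def t1_def by (rule tern_isotropic_shift_xy)
    \<comment> \<open>Exchanging x and y keeps 4 a b - t^2 and lowers |a|; exchanging y and z below
      keeps a and lowers |4 a b - t^2|. Either way the measure drops.\<close>
    show ?thesis
    proof (cases "\<bar>b1\<bar> < \<bar>a\<bar>")
      case True
      have "tern_isotropic b1 a c s r1 t1"
      proof (rule less.hyps)
        have "4 * b1 * a - t1\<^sup>2 = 4 * a * b - t\<^sup>2" using del1 by (simp add: mult_ac)
        then show "nat \<bar>b1\<bar> + nat \<bar>4 * b1 * a - t1\<^sup>2\<bar> < nat \<bar>a\<bar> + nat \<bar>4 * a * b - t\<^sup>2\<bar>"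
          using True by (simp add: nat_less_eq_zless)
        show "\<bar>tern_disc b1 a c s r1 t1\<bar> = 1" using d1 by (simp add: tern_disc_def algebra_simps)
      qed
      then show ?thesis using back1 tern_isotropic_swap_xy by blast
    next
      case b1: False
      define \<Delta> where "\<Delta> = 4 * a * b - t\<^sup>2"
      have D1: "4 * a * b1 - t1\<^sup>2 = \<Delta>" using del1 \<Delta>_def by simp
      have bound1: "3 * a\<^sup>2 \<le> \<bar>\<Delta>\<bar>"
      proof -
        have "a\<^sup>2 \<le> \<bar>a * b1\<bar>" using b1 by (intro square_le_abs_mult) simp
        moreover have "t1\<^sup>2 \<le> a\<^sup>2" using k t1_def square_le_abs by blast
        ultimately show ?thesis
          unfolding D1[symmetric] mult.assoc using zero_le_power2[of t1] by linarith
      qed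
      have \<Delta>0: "\<Delta> \<noteq> 0" using bound1 a0 by auto
      \<comment> \<open>In the current coefficients 4 a F - (2 a x + t y + s z)^2 is \<Delta> y^2 +
        m y z + (4 a c - s^2) z^2; the shift by l reduces its middle coefficient modulo 2
        \<Delta>.\<close>
      define m where "m = 2 * (2 * a * r1 - s * t1)"
      obtain l where l: "\<bar>m + 2 * \<Delta> * l\<bar> \<le> \<bar>\<Delta>\<bar>" using exists_small_shift[OF \<Delta>0] .
      define c2 r2 s2 where "c2 = b1 * l\<^sup>2 + r1 * l + c" and "r2 = r1 + 2 * b1 * l" and "s2 = s + t1 * l"
      have d2: "\<bar>tern_disc a b1 c2 r2 s2 t1\<bar> = 1"
        using d1 unfolding c2_def r2_def s2_def tern_shift_yz .
      have back2: "tern_isotropic a b1 c2 r2 s2 t1 \<Longrightarrow> ?thesis"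
        using back1 unfolding c2_def r2_def s2_def by (blast intro: tern_isotropic_shift_yz)
      define \<Delta>' where "\<Delta>' = 4 * a * c2 - s2\<^sup>2"
      have m2: "2 * (2 * a * r2 - s2 * t1) = m + 2 * \<Delta> * l"
        unfolding m_def r2_def s2_def D1[symmetric] by (simp add: power2_eq_square algebra_simps)
      show ?thesis
      proof (cases "\<bar>\<Delta>'\<bar> < \<bar>\<Delta>\<bar>")
        case True
        have "tern_isotropic a c2 b1 r2 t1 s2"
        proof (rule less.hyps)
          show "nat \<bar>a\<bar> + nat \<bar>4 * a * c2 - s2\<^sup>2\<bar> < nat \<bar>a\<bar> + nat \<bar>4 * a * b - t\<^sup>2\<bar>"
            using True by (simp add: \<Delta>'_def \<Delta>_def)
          show "\<bar>tern_disc a c2 b1 r2 t1 s2\<bar> = 1" using d2 by (simp add: tern_disc_def algebra_simps)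
        qed
        then show ?thesis using back2 tern_isotropic_swap_yz by blast
      next
        case False
        define M where "M = 2 * a * r2 - s2 * t1"
        have "(2 * M)\<^sup>2 \<le> \<Delta>\<^sup>2" using l unfolding M_def m2 by (rule square_le_abs)
        then have M: "4 * M\<^sup>2 \<le> \<Delta>\<^sup>2" by (simp add: power_mult_distrib)
        \<comment> \<open>Jacobi's identity for the 2x2 minors of the symmetric 3x3 matrix of the
          form.\<close>
        have "\<Delta> * \<Delta>' - M\<^sup>2 = 4 * a * tern_disc a b1 c2 r2 s2 t1"
          unfolding D1[symmetric] \<Delta>'_def M_def tern_disc_def by (simp add: power2_eq_square algebra_simps)
        then have "\<bar>\<Delta> * \<Delta>' - M\<^sup>2\<bar> = 4 * \<bar>a\<bar>" using d2 by (simp add: abs_mult)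
        moreover have "\<Delta>\<^sup>2 \<le> \<bar>\<Delta> * \<Delta>'\<bar>"
          using False by (intro square_le_abs_mult) simp
        ultimately have "3 * \<Delta>\<^sup>2 \<le> 16 * \<bar>a\<bar>" using M zero_le_power2[of M] by linarith
        moreover have "(3 * a\<^sup>2)\<^sup>2 \<le> \<Delta>\<^sup>2" using bound1 by (intro square_le_abs) simp
        ultimately have 1: "27 * (a\<^sup>2 * a\<^sup>2) \<le> 16 * \<bar>a\<bar>" by (simp add: power2_eq_square)
        have "\<bar>a\<bar> \<ge> 1" using a0 by simp
        then have "\<bar>a\<bar> \<le> a\<^sup>2" using mult_left_mono[of 1 "\<bar>a\<bar>" "\<bar>a\<bar>"] by (simp add: power2_eq_square)
        moreover have "1 \<le> a\<^sup>2" using calculation \<open>\<bar>a\<bar> \<ge> 1\<close> by linarith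
        ultimately have "\<bar>a\<bar> * 1 \<le> a\<^sup>2 * a\<^sup>2" by (intro mult_mono) auto
        then show ?thesis using 1 a0 by linarith
      qed
    qed
  qed
qed

section \<open>Congruences and the conic of a pair\<close>

lemma kronecker_oneD:
  assumes "kronecker_prime D p = 1" "prime p"
  shows "\<not> int p dvd D" and "p = 2 \<Longrightarrow> D mod 8 = 1 \<or> D mod 8 = 7" and "p \<noteq> 2 \<Longrightarrow> \<exists>y. int p dvd y\<^sup>2 - D"
proof -
  show "p = 2 \<Longrightarrow> D mod 8 = 1 \<or> D mod 8 = 7"
    using assms by (auto simp: kronecker_prime_def split: if_splits)
  have L: "Legendre D (int p) = 1" if "p \<noteq> 2" using assms that by (simp add: kronecker_prime_def)
  show "p \<noteq> 2 \<Longrightarrow> \<exists>y. int p dvd y\<^sup>2 - D"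
    using L by (auto simp: Legendre_def QuadRes_def cong_iff_dvd_diff split: if_splits)
  show "\<not> int p dvd D"
  proof (cases "p = 2")
    case True then show ?thesis using assms by (auto simp: kronecker_prime_def split: if_splits)
  next
    case False then show ?thesis using L by (auto simp: Legendre_def cong_0_iff split: if_splits)
  qed
qed

lemma linear_cong_solvable:
  fixes a m :: int
  assumes "coprime a m"
  obtains x where "m dvd a * x - b"
proof -
  obtain x where "[a * x = b] (mod m)" using cong_solve_dvd_int[of a m b] assms
    by (metis coprime_iff_gcd_eq_1 one_dvd)
  then show thesis using that by (simp add: cong_iff_dvd_diff)
qed

text \<open>A square root b of D modulo 4 E is lifted by b + 2 E x, since (b + 2 E x)^2 - D = 4 E (c
  + b x + E x^2), and the bracket has to vanish modulo p. If p divides E it is linear in x with unit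
  slope b; otherwise it is a quadratic of discriminant D.\<close>

lemma sqrt_cong_step:
  fixes D E :: int and p :: nat
  assumes p: "prime p" and k: "kronecker_prime D p = 1" and D4: "D mod 4 = 0 \<or> D mod 4 = 1"
    and b: "4 * E dvd b\<^sup>2 - D"
  shows "\<exists>b'. 4 * (int p * E) dvd b'\<^sup>2 - D"
proof -
  obtain c where "b\<^sup>2 - D = 4 * E * c" using b by (auto elim: dvdE)
  then have c: "b\<^sup>2 = D + 4 * E * c" by simp
  have step: ?thesis if x: "int p dvd c + b * x + E * x\<^sup>2" for x
  proof -
    obtain y where y: "c + b * x + E * x\<^sup>2 = int p * y" using x by (auto elim: dvdE)
    have "(b + 2 * E * x)\<^sup>2 - D = 4 * E * (c + b * x + E * x\<^sup>2)"
      using c by (simp add: power2_eq_square algebra_simps)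
    also have "\<dots> = 4 * (int p * E) * y" unfolding y by simp
    finally show ?thesis by (metis dvd_triv_left)
  qed
  have pp: "prime (int p)" using p by simp
  show ?thesis
  proof (cases "int p dvd E")
    case True
    have "\<not> int p dvd b"
    proof
      assume "int p dvd b"
      then have "int p dvd b\<^sup>2 - 4 * E * c" using True by (simp add: power2_eq_square)
      then show False using c kronecker_oneD(1)[OF k p] by simp
    qed
    then have "coprime b (int p)" using pp by (metis coprime_commute prime_imp_coprime)
    then obtain x where x: "int p dvd b * x - (- c)" using linear_cong_solvable by metis
    have "int p dvd (b * x - (- c)) + E * x\<^sup>2" using True x by (intro dvd_add) auto
    then have "int p dvd c + b * x + E * x\<^sup>2" by (simp add: algebra_simps)
    then show ?thesis by (rule step)
  next
    case False
    show ?thesis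
    proof (cases "p = 2")
      case True
      \<comment> \<open>\<open>kronecker_prime\<close> at 2 is 1 for the residues 1 and 7 modulo 8;
        a discriminant can only have the first. This makes E c even, so that x = 0 works.\<close>
      have D8: "D mod 8 = 1" using kronecker_oneD(2)[OF k p True] D4 by presburger
      have "odd b"
      proof
        assume "even b"
        then have "even (b\<^sup>2 - 4 * E * c)" by simp
        then show False using c D8 by simp presburger
      qed
      then obtain j where j: "b = 2 * j + 1" by (auto elim: oddE)
      have "even (j * (j + 1))" by simp
      then obtain i where i: "j * (j + 1) = 2 * i" by (rule evenE)
      have "b\<^sup>2 = 4 * (j * (j + 1)) + 1" unfolding j by (simp add: power2_eq_square algebra_simps)
      then have "8 * i + 1 = D + 4 * (E * c)" unfolding i using c by simp
      moreover have "D = 8 * (D div 8) + 1" using D8 by presburger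
      ultimately have "E * c = 2 * (i - D div 8)" by simp
      then have "even (E * c)" by simp
      then have "int p dvd c + b * 0 + E * 0\<^sup>2" using False True by simp
      then show ?thesis by (rule step)
    next
      case p2: False
      obtain y where y: "int p dvd y\<^sup>2 - D" using kronecker_oneD(3)[OF k p p2] by blast
      have "coprime (2::int) (int p)"
        using p p2 prime_odd_nat[of p] prime_ge_2_nat[OF p] by simp
      moreover have "coprime E (int p)" using False pp by (metis coprime_commute prime_imp_coprime)
      ultimately have cop: "coprime (2 * E) (int p)" by simp
      then obtain x where x: "int p dvd 2 * E * x - (y - b)" using linear_cong_solvable by metis
      have "int p dvd (2 * E * x - (y - b)) * (2 * E * x + b + y) + (y\<^sup>2 - D)" using x y by simp
      also have "(2 * E * x - (y - b)) * (2 * E * x + b + y) + (y\<^sup>2 - D) = 2 * E * (2 * (c + b * x + E * x\<^sup>2))"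
        using c by (simp add: power2_eq_square algebra_simps)
      finally have "int p dvd 2 * (c + b * x + E * x\<^sup>2)"
        using cop by (simp only: coprime_commute coprime_dvd_mult_right_iff)
      then have "int p dvd c + b * x + E * x\<^sup>2"
        using \<open>coprime (2::int) (int p)\<close> by (simp only: coprime_commute coprime_dvd_mult_right_iff)
      then show ?thesis by (rule step)
    qed
  qed
qed

lemma sqrt_cong_exists:
  fixes D :: int and E :: nat
  assumes "E > 0" "D mod 4 = 0 \<or> D mod 4 = 1"
    and "\<And>p. prime p \<Longrightarrow> p dvd E \<Longrightarrow> kronecker_prime D p = 1"
  shows "\<exists>b. 4 * int E dvd b\<^sup>2 - D"
  using assms(1,3)
proof (induction E rule: less_induct)
  case (less E)
  show ?case
  proof (cases "E = 1")
    case True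
    show ?thesis
    proof (cases "D mod 4 = 0")
      case True then have "4 * int E dvd 0\<^sup>2 - D" using \<open>E = 1\<close> by (simp add: mod_eq_0_iff_dvd)
      then show ?thesis by blast
    next
      case False
      then have "4 dvd 1 - D" using assms(2) by presburger
      then have "4 * int E dvd 1\<^sup>2 - D" using \<open>E = 1\<close> by simp
      then show ?thesis by blast
    qed
  next
    case False
    then obtain p where p: "prime p" "p dvd E" using prime_factor_nat by blast
    obtain E' where E': "E = p * E'" using p by (auto elim: dvdE)
    have pos: "E' > 0" using E' less.prems by (cases E') auto
    have "E' < E" using E' pos prime_gt_1_nat[OF p(1)] by simp
    then have "\<exists>b. 4 * int E' dvd b\<^sup>2 - D"
      by (rule less.IH) (use E' pos less.prems in auto)
    then show ?thesis using sqrt_cong_step[OF p(1) less.prems(2)[OF p] assms(2)] E' by auto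
  qed
qed

text \<open>The coefficients arise from replacing x, y, z by \<alpha> x + \<beta> y + \<gamma> z,
  \<delta> x + \<epsilon> y, \<zeta> y, a substitution of determinant \<gamma> \<delta> \<zeta>.
  This is the shape of the basis used for the conic.\<close>

lemma tern_subst_disc:
  fixes a b c t :: int
  shows "tern_disc (a * \<alpha>\<^sup>2 + t * \<alpha> * \<delta> + b * \<delta>\<^sup>2)
     (a * \<beta>\<^sup>2 + t * \<beta> * \<epsilon> + b * \<epsilon>\<^sup>2 + c * \<zeta>\<^sup>2) (a * \<gamma>\<^sup>2)
     (2 * a * \<beta> * \<gamma> + t * \<gamma> * \<epsilon>) (2 * a * \<alpha> * \<gamma> + t * \<gamma> * \<delta>)
     (2 * a * \<alpha> * \<beta> + t * (\<alpha> * \<epsilon> + \<beta> * \<delta>) + 2 * b * \<delta> * \<epsilon>)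
   = (\<gamma> * \<delta> * \<zeta>)\<^sup>2 * tern_disc a b c 0 0 t"
  unfolding tern_disc_def by (simp add: power2_eq_square algebra_simps)

lemma tern_subst:
  fixes a b c t :: int
  shows "tern (a * \<alpha>\<^sup>2 + t * \<alpha> * \<delta> + b * \<delta>\<^sup>2)
     (a * \<beta>\<^sup>2 + t * \<beta> * \<epsilon> + b * \<epsilon>\<^sup>2 + c * \<zeta>\<^sup>2) (a * \<gamma>\<^sup>2)
     (2 * a * \<beta> * \<gamma> + t * \<gamma> * \<epsilon>) (2 * a * \<alpha> * \<gamma> + t * \<gamma> * \<delta>)
     (2 * a * \<alpha> * \<beta> + t * (\<alpha> * \<epsilon> + \<beta> * \<delta>) + 2 * b * \<delta> * \<epsilon>) x y z
   = tern a b c 0 0 t (\<alpha> * x + \<beta> * y + \<gamma> * z) (\<delta> * x + \<epsilon> * y) (\<zeta> * y)"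
  unfolding tern_def by (simp add: power2_eq_square algebra_simps)

lemma tern_divides_coeffs:
  assumes "\<And>x y z. M dvd tern a b c r s t x y z"
  shows "M dvd a" "M dvd b" "M dvd c" "M dvd r" "M dvd s" "M dvd t"
proof -
  show a: "M dvd a" using assms[of 1 0 0] by (simp add: tern_def)
  show b: "M dvd b" using assms[of 0 1 0] by (simp add: tern_def)
  show c: "M dvd c" using assms[of 0 0 1] by (simp add: tern_def)
  have "M dvd b + c + r" "M dvd a + c + s" "M dvd a + b + t"
    using assms[of 0 1 1] assms[of 1 0 1] assms[of 1 1 0] by (simp_all add: tern_def add_ac)
  then show "M dvd r" "M dvd s" "M dvd t"
    using a b c by (meson dvd_add dvd_add_right_iff)+
qed

lemma odd_imp_coprime_4: "odd x \<Longrightarrow> coprime (x::int) 4"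
  by (metis coprime_right_2_iff_odd coprime_mult_right_iff mult_2_right numeral_Bit0)

text \<open>
  On a sublattice of index \<open>2 N\<close> the form \<open>D1 a\<^sup>2 - 2 n a A + D2 A\<^sup>2 - u\<^sup>2\<close> is divisible by \<open>4 N\<close>,
  and the quotient has unit discriminant.
\<close>

lemma conic_isotropic:
  fixes D1 D2 n N E1 E2 G t1 t2 :: int
  assumes N: "D1 * D2 - n\<^sup>2 = 4 * N" "N = E1 * E2 * G\<^sup>2" and pos: "E1 > 0" "E2 > 0" "G > 0"
    and t1: "4 * E1 dvd t1\<^sup>2 - D1" and t2: "E2 dvd t2\<^sup>2 - D2"
    and E2: "E2 dvd D1" "E2 dvd n" and odd: "odd D1" and cop: "coprime D1 (E1 * G)" "coprime D2 E2"
  shows "\<exists>a A u. (a, A, u) \<noteq> (0, 0, 0) \<and> D1 * a\<^sup>2 - 2 * n * a * A + D2 * A\<^sup>2 = u\<^sup>2"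
proof -
  \<comment> \<open>The sublattice is cut out by G | u, by D2 A = t2 u modulo E2 and by D1 a - n A =
    t1 u modulo 2 E1 G. The numbers s, r, w are the coefficients of a basis that solves these
    congruences; the index is 2 E1 G * E2 * G = 2 N.\<close>
  have c2: "coprime D1 (2 * E1 * G)" using odd cop(1) by (simp add: mult.assoc)
  obtain s where "2 * E1 * G dvd D1 * s - n" using linear_cong_solvable[OF c2] .
  then obtain s' where "D1 * s - n = 2 * E1 * G * s'" by (rule dvdE)
  then have s: "D1 * s = n + 2 * E1 * G * s'" by simp
  obtain r where "2 * E1 * G dvd D1 * r - G * t1" using linear_cong_solvable[OF c2] .
  then obtain r' where "D1 * r - G * t1 = 2 * E1 * G * r'" by (rule dvdE)
  then have r: "D1 * r = G * t1 + 2 * E1 * G * r'" by simp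
  obtain w where "E2 dvd D2 * w - t2 * G" using linear_cong_solvable[OF cop(2)] .
  then obtain w' where "D2 * w - t2 * G = E2 * w'" by (rule dvdE)
  then have w: "D2 * w = t2 * G + E2 * w'" by simp
  define a' where "a' x y z = s * E2 * x + (s * w + r) * y + 2 * E1 * G * z" for x y z
  define A' where "A' x y = E2 * x + w * y" for x y
  define f where "f x y z = tern D1 D2 (-1) 0 0 (-2 * n) (a' x y z) (A' x y) (G * y)" for x y z
  have div: "4 * N dvd f x y z" for x y z
  proof -
    define a A u where "a = a' x y z" and "A = A' x y" and "u = G * y"
    have fe: "f x y z = D1 * a\<^sup>2 - 2 * n * a * A + D2 * A\<^sup>2 - u\<^sup>2"
      unfolding f_def tern_def a_def A_def u_def by simp
    define v where "v = s' * A + r' * y + D1 * z"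
    have ae: "a = s * A + r * y + 2 * E1 * G * z"
      unfolding a_def A_def a'_def A'_def by (simp add: algebra_simps)
    have "D1 * a - n * A = (D1 * s - n) * A + D1 * r * y + 2 * E1 * G * D1 * z"
      unfolding ae by (simp add: algebra_simps)
    also have "\<dots> = G * (t1 * y + 2 * E1 * v)"
      unfolding s r v_def by (simp add: algebra_simps)
    finally have X: "D1 * a - n * A = G * (t1 * y + 2 * E1 * v)" .
    \<comment> \<open>Completing the square: modulo 4 E1 G^2 the middle term vanishes and the outer
      two combine to G^2 (t1^2 - D1) y^2. D1 is a unit there and cancels.\<close>
    have "D1 * f x y z = (D1 * a - n * A)\<^sup>2 + (D1 * D2 - n\<^sup>2) * A\<^sup>2 - D1 * u\<^sup>2"
      unfolding fe by (simp add: power2_eq_square algebra_simps)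
    also have "\<dots> = G\<^sup>2 * ((t1\<^sup>2 - D1) * y\<^sup>2 + 4 * E1 * (t1 * y * v + E1 * v\<^sup>2)) + 4 * E1 * G\<^sup>2 * (E2 * A\<^sup>2)"
      unfolding X N u_def by (simp add: power2_eq_square algebra_simps)
    also have "4 * E1 * G\<^sup>2 dvd \<dots>"
    proof (rule dvd_add)
      have "4 * E1 dvd (t1\<^sup>2 - D1) * y\<^sup>2 + 4 * E1 * (t1 * y * v + E1 * v\<^sup>2)"
        using t1 by simp
      then show "4 * E1 * G\<^sup>2 dvd G\<^sup>2 * ((t1\<^sup>2 - D1) * y\<^sup>2 + 4 * E1 * (t1 * y * v + E1 * v\<^sup>2))"
        by (metis mult.commute mult_dvd_mono dvd_refl)
    qed simp
    finally have "4 * E1 * G\<^sup>2 dvd D1 * f x y z" .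
    have cD: "coprime D1 (4 * E1 * G\<^sup>2)"
    proof -
      have "coprime D1 (4 * (E1 * G) * G)" using odd cop(1) odd_imp_coprime_4 by simp
      then show ?thesis by (simp add: power2_eq_square mult_ac)
    qed
    then have d1: "4 * E1 * G\<^sup>2 dvd f x y z"
      using \<open>4 * E1 * G\<^sup>2 dvd D1 * f x y z\<close> by (simp only: coprime_commute coprime_dvd_mult_right_iff)
    have d2: "E2 dvd f x y z"
    proof -
      have "D2 * A = t2 * u + E2 * (D2 * x + w' * y)"
        unfolding A_def A'_def u_def using arg_cong[OF w, of "\<lambda>x. x * y"] by (simp add: algebra_simps)
      then have "D2 * f x y z = D1 * (D2 * a\<^sup>2) - n * (2 * D2 * a * A) + (t2\<^sup>2 - D2) * u\<^sup>2
          + E2 * (2 * t2 * u * (D2 * x + w' * y) + E2 * (D2 * x + w' * y)\<^sup>2)"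
      proof -
        have "D2 * f x y z = D1 * (D2 * a\<^sup>2) - n * (2 * D2 * a * A) + (D2 * A)\<^sup>2 - D2 * u\<^sup>2"
          unfolding fe by (simp add: power2_eq_square algebra_simps)
        then show ?thesis unfolding \<open>D2 * A = _\<close> by (simp add: power2_eq_square algebra_simps)
      qed
      then have "E2 dvd D2 * f x y z" using E2 t2 by simp
      then show ?thesis using cop(2) by (simp only: coprime_commute coprime_dvd_mult_right_iff)
    qed
    have "coprime E2 (4 * E1 * G\<^sup>2)" using cD E2(1) coprime_divisors[of E2 D1 "4 * E1 * G\<^sup>2" "4 * E1 * G\<^sup>2"] by simp
    then have "E2 * (4 * E1 * G\<^sup>2) dvd f x y z" using d1 d2 by (simp add: divides_mult)
    then show ?thesis unfolding N by (simp add: mult_ac)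
  qed
  define \<alpha> \<beta> \<gamma> where "\<alpha> = s * E2" and "\<beta> = s * w + r" and "\<gamma> = 2 * E1 * G"
  have fe: "f x y z = tern D1 D2 (-1) 0 0 (-2 * n) (\<alpha> * x + \<beta> * y + \<gamma> * z) (E2 * x + w * y) (G * y)" for x y z
    unfolding f_def a'_def A'_def \<alpha>_def \<beta>_def \<gamma>_def by (simp add: algebra_simps)
  note subst = tern_subst[of D1 \<alpha> "-2 * n" E2 D2 \<beta> w "-1" G \<gamma>]
  note disc = tern_subst_disc[of D1 \<alpha> "-2 * n" E2 D2 \<beta> w "-1" G \<gamma>]
  \<comment> \<open>From here on the six coefficients are opaque: only the values of the form and
    its discriminant matter.\<close>
  obtain c1 c2 c3 c4 c5 c6 where
    ft: "\<And>x y z. tern c1 c2 c3 c4 c5 c6 x y z = f x y z" and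
    fd: "tern_disc c1 c2 c3 c4 c5 c6 = (\<gamma> * E2 * G)\<^sup>2 * tern_disc D1 D2 (-1) 0 0 (-2 * n)"
    by (rule that[OF trans[OF subst fe[symmetric]] disc])
  have "4 * N dvd tern c1 c2 c3 c4 c5 c6 x y z" for x y z using div ft by simp
  note dv = tern_divides_coeffs[OF this]
  obtain e1 e2 e3 e4 e5 e6 where e: "c1 = 4 * N * e1" "c2 = 4 * N * e2" "c3 = 4 * N * e3"
    "c4 = 4 * N * e4" "c5 = 4 * N * e5" "c6 = 4 * N * e6"
    using dv unfolding dvd_def by blast
  have N0: "N > 0" using N(2) pos by simp
  \<comment> \<open>(2 N)^2 comes from the index, -16 N from the original form and (4 N)^3 from
    dividing the coefficients by 4 N; they leave -1.\<close>
  have "(4 * N) ^ 3 * tern_disc e1 e2 e3 e4 e5 e6 = tern_disc c1 c2 c3 c4 c5 c6"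
    unfolding e tern_disc_def by (simp add: power2_eq_square power3_eq_cube algebra_simps)
  also have "\<dots> = (2 * N)\<^sup>2 * (- 4 * (D1 * D2 - n\<^sup>2))"
  proof -
    have "\<gamma> * E2 * G = 2 * N" unfolding \<gamma>_def N(2) by (simp add: power2_eq_square)
    moreover have "tern_disc D1 D2 (-1) 0 0 (-2 * n) = - 4 * (D1 * D2 - n\<^sup>2)"
      by (simp add: tern_disc_def power2_eq_square algebra_simps)
    ultimately show ?thesis unfolding fd by simp
  qed
  also have "\<dots> = (4 * N) ^ 3 * (-1)" unfolding N(1) by (simp add: power2_eq_square power3_eq_cube)
  finally have "tern_disc e1 e2 e3 e4 e5 e6 = -1"
    using N0 by (simp only: mult_cancel_left) simp
  then have "tern_isotropic e1 e2 e3 e4 e5 e6" by (intro tern_isotropic_unit_disc) simp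
  then obtain x y z where xyz: "(x, y, z) \<noteq> (0, 0, 0)" "tern e1 e2 e3 e4 e5 e6 x y z = 0"
    by (auto simp: tern_isotropic_def)
  have "f x y z = 4 * N * tern e1 e2 e3 e4 e5 e6 x y z"
    unfolding ft[symmetric] e tern_def by (simp add: algebra_simps)
  then have f0: "f x y z = 0" using xyz by simp
  have "(a' x y z, A' x y, G * y) \<noteq> (0, 0, 0)"
    using xyz(1) pos by (auto simp: a'_def A'_def)
  moreover have "D1 * (a' x y z)\<^sup>2 - 2 * n * a' x y z * A' x y + D2 * (A' x y)\<^sup>2 = (G * y)\<^sup>2"
    using f0 unfolding f_def tern_def by simp
  ultimately show ?thesis by blast
qed

section \<open>From a zero of the conic to a pair of forms\<close>

lemma fund_disc_not_square:
  assumes "fund_disc D" "D * x\<^sup>2 = y\<^sup>2"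
  shows "x = 0"
proof (rule ccontr)
  assume "x \<noteq> 0"
  have D: "D > 0" "sqrt (of_int D) \<notin> \<rat>" using assms by (auto simp: fund_disc_def)
  have "of_int D * (of_int x)\<^sup>2 = (of_int y :: real)\<^sup>2"
    using arg_cong[OF assms(2), of "of_int :: int \<Rightarrow> real"] by simp
  then have "of_int D = (of_int y / of_int x :: real)\<^sup>2" using \<open>x \<noteq> 0\<close> by (simp add: power_divide field_simps)
  then have "sqrt (of_int D) = \<bar>of_int y / of_int x\<bar>" by simp
  then show False using D by (metis Rats_abs_iff Rats_divide Rats_of_int)
qed

lemma four_dvd_square_diff:
  fixes x D :: int
  assumes "D mod 4 = 0 \<or> D mod 4 = 1" "even x \<longleftrightarrow> even D"
  shows "4 dvd x\<^sup>2 - D"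
proof -
  have "x\<^sup>2 mod 4 = D mod 4" using assms unfolding square_mod_4 by presburger
  then show ?thesis by (simp add: mod_eq_dvd_iff)
qed

text \<open>For [A, B, C] and [a, b, c] one has (A b - a B)^2 = D1 a^2 - 2 n a A + D2 A^2, so a zero
  of the conic prescribes the leading coefficients and u = A b - a B. A congruence modulo A gives B,
  then b; it remains to see that the discriminants provide integral C and c.\<close>

lemma conic_pair_odd:
  fixes a A u n D1 D2 :: int
  assumes con: "D1 * a\<^sup>2 - 2 * n * a * A + D2 * A\<^sup>2 = u\<^sup>2" and cop: "coprime a A" and odd: "odd A" and a0: "a \<noteq> 0"
    and D: "D1 mod 4 = 0 \<or> D1 mod 4 = 1" "D2 mod 4 = 0 \<or> D2 mod 4 = 1" and n: "even n \<longleftrightarrow> even (D1 * D2)"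
  shows "\<exists>q1 q2. bqf_disc q1 = D1 \<and> bqf_disc q2 = D2 \<and> B_Delta q1 q2 = n"
proof -
  have A0: "A \<noteq> 0" using odd by auto
  obtain B0 where B0: "A dvd a * B0 - (- u)" using linear_cong_solvable[OF cop] .
  \<comment> \<open>Both choices solve the congruence; adding the odd number A changes the parity,
    which has to be that of D1.\<close>
  define B where "B = (if even B0 \<longleftrightarrow> even D1 then B0 else B0 + A)"
  have Bpar: "even B \<longleftrightarrow> even D1" using odd by (auto simp: B_def)
  have "A dvd a * B + u"
  proof (cases "even B0 \<longleftrightarrow> even D1")
    case True then show ?thesis using B0 by (simp add: B_def)
  next
    case False
    have "a * B + u = (a * B0 - (- u)) + a * A" using False by (simp add: B_def algebra_simps)
    then show ?thesis using B0 by (metis dvd_add dvd_triv_right)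
  qed
  then obtain b where "a * B + u = A * b" by (auto elim: dvdE)
  then have b: "u = A * b - a * B" by simp
  have upar: "even u \<longleftrightarrow> even (D1 * a + D2 * A)"
  proof -
    have "even (u\<^sup>2) \<longleftrightarrow> even (D1 * a\<^sup>2 - 2 * n * a * A + D2 * A\<^sup>2)" using con by simp
    then show ?thesis by simp
  qed
  have bpar: "even b \<longleftrightarrow> even D2"
  proof -
    have "even u \<longleftrightarrow> even (A * b - a * B)" using b by simp
    then show ?thesis using upar odd Bpar by auto
  qed
  have e1: "4 dvd B\<^sup>2 - D1" by (rule four_dvd_square_diff[OF D(1) Bpar])
  have e2: "4 dvd b\<^sup>2 - D2" by (rule four_dvd_square_diff[OF D(2) bpar])
  have id1: "a\<^sup>2 * (B\<^sup>2 - D1) = A * (A * D2 - 2 * n * a - A * b\<^sup>2 + 2 * b * a * B)"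
    using con unfolding b by (simp add: power2_eq_square algebra_simps)
  have id2: "A\<^sup>2 * (b\<^sup>2 - D2) = a * (D1 * a - 2 * n * A + 2 * u * B + a * B\<^sup>2)"
    using con unfolding b by (simp add: power2_eq_square algebra_simps)
  have "A dvd a\<^sup>2 * (B\<^sup>2 - D1)" unfolding id1 by simp
  then have "A dvd B\<^sup>2 - D1" using cop by (simp add: coprime_commute coprime_dvd_mult_right_iff)
  moreover have "coprime A 4" using odd by (rule odd_imp_coprime_4)
  ultimately have "A * 4 dvd B\<^sup>2 - D1" using e1 by (simp add: divides_mult)
  then obtain C where "B\<^sup>2 - D1 = A * 4 * C" by (rule dvdE)
  then have C: "B\<^sup>2 - D1 = 4 * A * C" by simp
  have "a * 4 dvd b\<^sup>2 - D2"
  proof (cases "even a")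
    case False
    have "a dvd A\<^sup>2 * (b\<^sup>2 - D2)" unfolding id2 by simp
    then have "a dvd b\<^sup>2 - D2" using cop by (simp add: coprime_commute coprime_dvd_mult_right_iff)
    moreover have "coprime a 4" using False by (rule odd_imp_coprime_4)
    ultimately show ?thesis using e2 by (simp add: divides_mult)
  next
    \<comment> \<open>Here a and 4 are not coprime. The bracket in \<open>id2\<close> is shown to be
      divisible by 4 directly, since u B and n A have the same parity.\<close>
    case True
    then obtain k where k: "a = 2 * k" by (auto elim: evenE)
    have "even (u * B - n * A)" using upar True odd Bpar n by auto
    then obtain l where l: "u * B - n * A = 2 * l" by (rule evenE)
    obtain c where c: "B\<^sup>2 = D1 + 4 * c" using e1 by (auto elim!: dvdE simp: algebra_simps)
    have "D1 * a - 2 * n * A + 2 * u * B + a * B\<^sup>2 = a * (D1 + B\<^sup>2) + 2 * (u * B - n * A)"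
      by (simp add: algebra_simps)
    also have "\<dots> = 4 * (k * D1 + 2 * k * c + l)" unfolding l c k by (simp add: algebra_simps)
    finally have "A\<^sup>2 * (b\<^sup>2 - D2) = (a * 4) * (k * D1 + 2 * k * c + l)" unfolding id2 by simp
    then have "a * 4 dvd A\<^sup>2 * (b\<^sup>2 - D2)" by simp
    moreover have "coprime (a * 4) (A\<^sup>2)"
    proof -
      have "coprime A 4" by fact
      then show ?thesis using cop by (simp add: coprime_commute)
    qed
    ultimately show ?thesis by (simp add: coprime_dvd_mult_right_iff)
  qed
  then obtain c where "b\<^sup>2 - D2 = a * 4 * c" by (rule dvdE)
  then have c: "b\<^sup>2 - D2 = 4 * a * c" by simp
  have D1e: "D1 = B\<^sup>2 - 4 * A * C" and D2e: "D2 = b\<^sup>2 - 4 * a * c" using C c by simp_all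
  have "2 * A * a * (B * b - 2 * A * c - 2 * a * C - n) = 0"
    using con unfolding b D1e D2e by (simp add: power2_eq_square algebra_simps)
  then have "B * b - 2 * A * c - 2 * a * C = n" using A0 a0 by simp
  then show ?thesis using D1e D2e
    by (intro exI[of _ "BQF A B C"] exI[of _ "BQF a b c"]) (simp add: bqf_disc_def B_Delta_def)
qed

lemma B_Delta_commute: "B_Delta q1 q2 = B_Delta q2 q1"
  by (simp add: B_Delta_def)

text \<open>A common factor of a and A divides u as well, so the zero can be made primitive; then a
  or A is odd, and the two forms may be exchanged.\<close>

lemma conic_pair:
  assumes con: "D1 * a\<^sup>2 - 2 * n * a * A + D2 * A\<^sup>2 = u\<^sup>2" and nz: "(a, A, u) \<noteq> (0, 0, 0)"
    and D: "fund_disc D1" "fund_disc D2" and n: "even n \<longleftrightarrow> even (D1 * D2)"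
  shows "\<exists>q1 q2. bqf_disc q1 = D1 \<and> bqf_disc q2 = D2 \<and> B_Delta q1 q2 = n"
proof -
  have A0: "A \<noteq> 0"
  proof
    assume A: "A = 0"
    then have "D1 * a\<^sup>2 = u\<^sup>2" using con by simp
    then have "a = 0" using fund_disc_not_square D by blast
    then show False using nz con A by simp
  qed
  have a0: "a \<noteq> 0"
  proof
    assume a: "a = 0"
    then have "D2 * A\<^sup>2 = u\<^sup>2" using con by simp
    then show False using fund_disc_not_square D A0 by blast
  qed
  define g where "g = gcd a A"
  have g0: "g \<noteq> 0" using a0 g_def by simp
  obtain a' A' where aA: "a = g * a'" "A = g * A'" "coprime a' A'"
    using gcd_coprime_exists[of a A] g0 unfolding g_def by (metis mult.commute)
  have "g\<^sup>2 * (D1 * a'\<^sup>2 - 2 * n * a' * A' + D2 * A'\<^sup>2) = u\<^sup>2"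
    using con unfolding aA by (simp add: power2_eq_square algebra_simps)
  then have "g\<^sup>2 dvd u\<^sup>2" by (metis dvd_triv_left)
  then have "g dvd u" by simp
  then obtain u' where u': "u = g * u'" by (auto elim: dvdE)
  have "g\<^sup>2 * (D1 * a'\<^sup>2 - 2 * n * a' * A' + D2 * A'\<^sup>2) = g\<^sup>2 * u'\<^sup>2"
    using \<open>g\<^sup>2 * _ = u\<^sup>2\<close> u' by (simp add: power_mult_distrib)
  then have con': "D1 * a'\<^sup>2 - 2 * n * a' * A' + D2 * A'\<^sup>2 = u'\<^sup>2" using g0 by simp
  have nz': "a' \<noteq> 0" "A' \<noteq> 0" using a0 A0 aA by auto
  have D4: "D1 mod 4 = 0 \<or> D1 mod 4 = 1" "D2 mod 4 = 0 \<or> D2 mod 4 = 1"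
    using D by (auto simp: fund_disc_def)
  show ?thesis
  proof (cases "odd A'")
    case True
    show ?thesis by (rule conic_pair_odd[OF con' aA(3) True nz'(1) D4 n])
  next
    case False
    then have "odd a'" using aA(3) by auto
    have "D2 * A'\<^sup>2 - 2 * n * A' * a' + D1 * a'\<^sup>2 = u'\<^sup>2" using con' by (simp add: algebra_simps)
    then have "\<exists>q2 q1. bqf_disc q2 = D2 \<and> bqf_disc q1 = D1 \<and> B_Delta q2 q1 = n"
      by (rule conic_pair_odd) (use aA(3) \<open>odd a'\<close> nz' D4 n in \<open>auto simp: coprime_commute\<close>)
    then show ?thesis using B_Delta_commute by metis
  qed
qed

section \<open>Existence of pairs\<close>

lemma kronecker_zero_iff:
  assumes "prime p"
  shows "kronecker_prime D p = 0 \<longleftrightarrow> int p dvd D"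
proof (cases "p = 2")
  case True then show ?thesis by (auto simp: kronecker_prime_def)
next
  case False then show ?thesis by (auto simp: kronecker_prime_def Legendre_def cong_0_iff)
qed

lemma kronecker_range: "kronecker_prime D p \<in> {0, 1, -1}"
  by (auto simp: kronecker_prime_def Legendre_def)

text \<open>If x = u^2 is a unit modulo p, then y = (n / u)^2.\<close>

lemma QuadRes_transfer:
  fixes x y n :: int
  assumes p: "prime p" and x: "\<not> p dvd x" and xy: "p dvd x * y - n\<^sup>2" and q: "QuadRes p x"
  shows "QuadRes p y"
proof -
  obtain u where u: "[u\<^sup>2 = x] (mod p)" using q by (auto simp: QuadRes_def)
  have "\<not> p dvd u"
  proof
    assume "p dvd u"
    then have "p dvd u\<^sup>2" by (simp add: power2_eq_square)
    then show False using u x cong_dvd_iff by blast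
  qed
  then have "coprime u p" using p by (metis coprime_commute prime_imp_coprime)
  then obtain z where z: "[u * z = 1] (mod p)" using cong_solve_coprime_int by blast
  have "[(n * z)\<^sup>2 = n\<^sup>2 * z\<^sup>2] (mod p)" by (simp add: power_mult_distrib)
  also have "[n\<^sup>2 * z\<^sup>2 = x * y * z\<^sup>2] (mod p)"
    using xy by (intro cong_scalar_right) (simp add: cong_iff_dvd_diff dvd_diff_commute)
  also have "[x * y * z\<^sup>2 = u\<^sup>2 * (y * z\<^sup>2)] (mod p)"
    unfolding mult.assoc by (intro cong_scalar_right) (rule cong_sym[OF u])
  also have "u\<^sup>2 * (y * z\<^sup>2) = y * (u * z)\<^sup>2" by (simp add: power_mult_distrib)
  also have "[y * (u * z)\<^sup>2 = y * 1\<^sup>2] (mod p)" by (intro cong_scalar_left cong_pow z)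
  finally show ?thesis unfolding QuadRes_def by auto
qed

lemma odd_square_mod_8: "odd (n::int) \<Longrightarrow> n\<^sup>2 mod 8 = 1"
proof -
  assume "odd n"
  then obtain j where j: "n = 2 * j + 1" by (auto elim: oddE)
  have "even (j * (j + 1))" by simp
  then obtain i where i: "j * (j + 1) = 2 * i" by (rule evenE)
  have "n\<^sup>2 = 4 * (j * (j + 1)) + 1" unfolding j by (simp add: power2_eq_square algebra_simps)
  then have "n\<^sup>2 = 8 * i + 1" unfolding i by simp
  then show ?thesis by (simp only: mod_mult_self4) simp
qed

section \<open>The primes dividing N\<close>

locale disc_pair =
  fixes D1 D2 n N :: int
  assumes fund: "fund_disc D1" "fund_disc D2" and cop: "coprime D1 D2"
    and N: "D1 * D2 - n\<^sup>2 = 4 * N" and N_pos: "N > 0"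
begin

lemma disc_mod_4: "D1 mod 4 = 0 \<or> D1 mod 4 = 1" "D2 mod 4 = 0 \<or> D2 mod 4 = 1"
  using fund by (auto simp: fund_disc_def)

lemma swap: "disc_pair D2 D1 n N"
  using fund cop N N_pos by unfold_locales (simp_all add: coprime_commute mult.commute)

lemma even_n_iff: "even n \<longleftrightarrow> even (D1 * D2)"
proof -
  have "even (D1 * D2 - n\<^sup>2)" unfolding N by simp
  then show ?thesis by simp
qed

lemma not_dvd_both:
  assumes "prime p" "int p dvd D1" shows "\<not> int p dvd D2"
proof
  assume "int p dvd D2"
  then have "is_unit (int p)" using assms cop coprime_common_divisor by blast
  then show False using assms by simp
qed

text \<open>Modulo p the product D1 D2 is the square n^2. For p = 2 it is an odd square modulo 8,
  where both discriminants are 1 or 5. This is what makes the choice in \<open>eps_prime\<close>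
  unambiguous.\<close>

lemma kronecker_eq:
  assumes p: "prime p" "int p dvd N" and nd: "\<not> int p dvd D1" "\<not> int p dvd D2"
  shows "kronecker_prime D1 p = kronecker_prime D2 p"
proof (cases "p = 2")
  case True
  have o: "odd D1" "odd D2" using nd True by auto
  then have "odd n" using even_n_iff by simp
  have m4: "D1 mod 4 = 1" "D2 mod 4 = 1" using disc_mod_4 o by presburger+
  obtain k where k: "N = 2 * k" using p(2) True by (auto elim: evenE)
  have "D1 * D2 = n\<^sup>2 + 8 * k" using N k by simp
  then have "(D1 * D2) mod 8 = n\<^sup>2 mod 8" by (simp only: mod_mult_self2)
  then have "((D1 mod 8) * (D2 mod 8)) mod 8 = 1"
    unfolding mod_mult_eq using odd_square_mod_8[OF \<open>odd n\<close>] by (rule trans)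
  moreover have "D1 mod 8 = 1 \<or> D1 mod 8 = 5" "D2 mod 8 = 1 \<or> D2 mod 8 = 5" using m4 by presburger+
  moreover have "x = y" if "(x * y) mod 8 = 1" "x = 1 \<or> x = 5" "y = 1 \<or> y = 5" for x y :: int
    using that by auto
  ultimately have "D1 mod 8 = D2 mod 8" by blast
  then show ?thesis using True o by (simp add: kronecker_prime_def)
next
  case False
  have pp: "prime (int p)" using p by simp
  have dv: "int p dvd D1 * D2 - n\<^sup>2" unfolding N using p(2) by simp
  then have dv': "int p dvd D2 * D1 - n\<^sup>2" by (simp add: mult.commute)
  have "QuadRes (int p) D1 \<longleftrightarrow> QuadRes (int p) D2"
    using QuadRes_transfer[OF pp nd(1) dv] QuadRes_transfer[OF pp nd(2) dv'] by blast
  then show ?thesis using False nd by (simp add: kronecker_prime_def Legendre_def cong_0_iff)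
qed

lemma eps_prime_swap: "eps_prime D2 D1 p = eps_prime D1 D2 p"
  by (simp add: eps_prime_def insert_commute)

lemma eps_prime_eq:
  assumes p: "prime p" "int p dvd N" and nd: "\<not> int p dvd D1"
  shows "eps_prime D1 D2 p = kronecker_prime D1 p"
proof -
  have nz: "kronecker_prime D1 p \<noteq> 0" using kronecker_zero_iff[OF p(1)] nd by simp
  have "e = kronecker_prime D1 p" if "e \<in> {kronecker_prime D1 p, kronecker_prime D2 p}" "e \<noteq> 0" for e
  proof (cases "int p dvd D2")
    case True
    then show ?thesis using that kronecker_zero_iff[OF p(1), of D2] by blast
  next
    case False
    then show ?thesis using that kronecker_eq[OF p nd] by (metis insert_iff singletonD)
  qed
  then show ?thesis unfolding eps_prime_def using nz by (intro the_equality) auto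
qed

text \<open>If p^2 divided N, then D1 / p^2 would again be a discriminant: for odd p because p
  divides n, hence p^2 divides D1 D2; for p = 2 because D1 D2 / 4 is a square modulo 4 and D2 is 1
  there. So ramified primes occur in N at most to the first power.\<close>

lemma not_square_dvd_N:
  assumes p: "prime p" "int p dvd D1"
  shows "\<not> (int p)\<^sup>2 dvd N"
proof
  assume "(int p)\<^sup>2 dvd N"
  then obtain k where k: "N = (int p)\<^sup>2 * k" by (auto elim: dvdE)
  have pp: "prime (int p)" using p by simp
  have nosq: "\<not> (D' mod 4 = 0 \<or> D' mod 4 = 1)" if "D1 = (int p)\<^sup>2 * D'" for D'
  proof -
    have all: "\<forall>p D'. prime p \<and> D1 = p\<^sup>2 * D' \<longrightarrow> \<not> (D' mod 4 = 0 \<or> D' mod 4 = 1)"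
      using fund(1) unfolding fund_disc_def by (elim conjE)
    show ?thesis by (rule mp[OF spec[OF spec[OF all]] conjI[OF pp that]])
  qed
  show False
  proof (cases "p = 2")
    case True
    then have "even D1" using p by simp
    then have "D1 mod 4 = 0" using disc_mod_4(1) by presburger
    then obtain D' where D': "D1 = 4 * D'" by (auto simp: mod_eq_0_iff_dvd elim: dvdE)
    have "odd D2" using not_dvd_both[OF p] True by simp
    then have D2: "D2 mod 4 = 1" using disc_mod_4(2) by presburger
    have "even n" using even_n_iff D' by simp
    then obtain j where j: "n = 2 * j" by (auto elim: evenE)
    have "D' * D2 = j\<^sup>2 + 4 * k" using N unfolding D' j k True by (simp add: power2_eq_square)
    then have "((D' mod 4) * (D2 mod 4)) mod 4 = j\<^sup>2 mod 4" by (simp only: mod_mult_eq mod_mult_self2)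
    then have "D' mod 4 = j\<^sup>2 mod 4" unfolding D2 by simp
    then have "D' mod 4 = 0 \<or> D' mod 4 = 1" by (simp add: square_mod_4)
    moreover have "D1 = (int p)\<^sup>2 * D'" unfolding D' True by simp
    ultimately show False by (rule notE[OF nosq, rotated])
  next
    case False
    have "n\<^sup>2 = D1 * D2 - (int p)\<^sup>2 * (4 * k)" using N k by simp
    moreover have "int p dvd D1 * D2 - (int p)\<^sup>2 * (4 * k)" using p(2) by (simp add: power2_eq_square)
    ultimately have "int p dvd n\<^sup>2" by simp
    then have "int p dvd n" using pp prime_dvd_power by blast
    then have "(int p)\<^sup>2 dvd n\<^sup>2" by simp
    moreover have "D1 * D2 = n\<^sup>2 + (int p)\<^sup>2 * (4 * k)" using N k by simp
    ultimately have "(int p)\<^sup>2 dvd D1 * D2" by simp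
    moreover have "coprime ((int p)\<^sup>2) D2"
      using prime_imp_coprime[OF pp not_dvd_both[OF p]] by simp
    ultimately have "(int p)\<^sup>2 dvd D1" by (simp add: coprime_dvd_mult_left_iff)
    then obtain D' where D': "D1 = (int p)\<^sup>2 * D'" by (auto elim: dvdE)
    have "odd (int p)" using p(1) False prime_odd_nat[of p] prime_ge_2_nat[OF p(1)] by simp
    then have "(int p)\<^sup>2 mod 4 = 1" by (simp add: square_mod_4)
    then have "(((int p)\<^sup>2 mod 4) * D') mod 4 = D' mod 4" by simp
    then have "D1 mod 4 = D' mod 4" unfolding D' by (simp only: mod_mult_left_eq)
    then show False using nosq[OF D'] disc_mod_4 by simp
  qed
qed

end

text \<open>Primes violating \<open>P\<close> are removed two at a time and go into G; all others go
  into E.\<close>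

lemma square_part_decomposition:
  fixes M :: nat
  assumes "M > 0" "\<And>p. prime p \<Longrightarrow> p dvd M \<Longrightarrow> \<not> P p \<Longrightarrow> even (multiplicity p M)"
  shows "\<exists>E G. M = E * G\<^sup>2 \<and> (\<forall>p. prime p \<longrightarrow> p dvd E \<longrightarrow> P p)"
  using assms
proof (induction M rule: less_induct)
  case (less M)
  show ?case
  proof (cases "M = 1")
    case True then show ?thesis by (intro exI[of _ 1]) (auto dest: prime_gt_1_nat)
  next
    case False
    then obtain p where p: "prime p" "p dvd M" using prime_factor_nat by blast
    define e where "e = (if P p then 1 else 2 :: nat)"
    have mult: "e \<le> multiplicity p M"
    proof -
      have "multiplicity p M \<ge> 1" using p less.prems(1) by (simp add: prime_multiplicity_gt_zero_iff Suc_leI)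
      then show ?thesis using less.prems(2)[OF p] by (auto simp: e_def elim!: evenE)
    qed
    then have "p ^ e dvd M" by (simp add: multiplicity_dvd')
    then obtain M' where M': "M = p ^ e * M'" by (auto elim: dvdE)
    have pos: "M' > 0" using M' less.prems by (cases M') auto
    have p1: "p > 1" using p prime_gt_1_nat by blast
    have "p ^ e > 1" using p1 by (intro one_less_power) (simp_all add: e_def)
    then have lt: "M' < M" using M' pos by simp
    have mm: "multiplicity r M = multiplicity r (p ^ e) + multiplicity r M'" if "prime r" for r
      unfolding M' using that pos p1 by (intro prime_elem_multiplicity_mult_distrib) auto
    have "even (multiplicity r M')" if r: "prime r" "r dvd M'" "\<not> P r" for r
    proof -
      have "even (multiplicity r M)" using less.prems(2)[OF r(1) _ r(3)] r(2) M' by simp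
      moreover have "even (multiplicity r (p ^ e))"
      proof (cases "r = p")
        case True then show ?thesis using r p by (simp add: e_def)
      next
        case False
        then have "multiplicity r (p ^ e) = 0"
          using r p by (metis not_dvd_imp_multiplicity_0 prime_dvd_power primes_dvd_imp_eq)
        then show ?thesis by simp
      qed
      ultimately show ?thesis using mm[OF r(1)] by simp
    qed
    then obtain E G where EG: "M' = E * G\<^sup>2" "\<forall>p. prime p \<longrightarrow> p dvd E \<longrightarrow> P p"
      using less.IH[OF lt pos] by blast
    show ?thesis
    proof (cases "P p")
      case True
      have "M = (p * E) * G\<^sup>2" unfolding M' EG by (simp add: e_def True)
      moreover have "\<forall>r. prime r \<longrightarrow> r dvd p * E \<longrightarrow> P r"
        using True EG(2) p by (metis prime_dvd_mult_iff primes_dvd_imp_eq)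
      ultimately show ?thesis by blast
    next
      case False
      have "M = E * (p * G)\<^sup>2" unfolding M' EG by (simp add: e_def False power_mult_distrib)
      then show ?thesis using EG(2) by blast
    qed
  qed
qed

text \<open>N is E2 M with E2 = gcd(N, D1), and M is prime to D1 because E2 already contains every
  ramified prime to its full power. Primes of odd exponent in M split, so M = E1 G^2 with D1 a
  square modulo 4 E1, while D2 is a square modulo E2. These are the data for
  \<open>conic_isotropic\<close>.\<close>

lemma (in disc_pair) pair_exists_odd:
  assumes ev: "\<And>p. prime p \<Longrightarrow> int p dvd N \<Longrightarrow> eps_prime D1 D2 p \<noteq> 1 \<Longrightarrow> even (multiplicity p (nat N))"
    and odd: "odd D1"
  shows "\<exists>q1 q2. bqf_disc q1 = D1 \<and> bqf_disc q2 = D2 \<and> B_Delta q1 q2 = n"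
proof -
  define E2 where "E2 = nat (gcd N D1)"
  have gp: "gcd N D1 > 0" using N_pos by simp
  have E2: "int E2 = gcd N D1" using gp by (simp add: E2_def)
  obtain M' where M': "N = int E2 * M'" unfolding E2 by (meson dvdE gcd_dvd1)
  have "int E2 > 0" unfolding E2 by (fact gp)
  then have E2p: "E2 > 0" by simp
  have "M' > 0" using M' N_pos E2p by (simp add: zero_less_mult_iff)
  then obtain M where M: "M' = int M" "M > 0" by (metis of_nat_0_less_iff pos_int_cases)
  have NM: "N = int E2 * int M" using M' M by simp
  have natN: "nat N = E2 * M" unfolding NM by (simp add: nat_mult_distrib)
  have primeE2: "int p dvd D1" "int p dvd N" if "prime p" "p dvd E2" for p
  proof -
    have "int p dvd gcd N D1" using that E2 by (metis int_dvd_int_iff)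
    then show "int p dvd D1" "int p dvd N" by simp_all
  qed
  have copM: "\<not> int p dvd D1" if p: "prime p" "p dvd M" for p
  proof
    assume d: "int p dvd D1"
    have "int p dvd N" unfolding NM using p by simp
    then have "int p dvd int E2" using d E2 by simp
    then have "int p * int p dvd N" unfolding NM using p(2) by (intro mult_dvd_mono) auto
    then show False using not_square_dvd_N[OF p(1) d] by (simp add: power2_eq_square)
  qed
  have cM: "coprime D1 (int M)"
  proof (rule ccontr)
    assume "\<not> coprime D1 (int M)"
    then have "gcd (nat \<bar>D1\<bar>) M \<noteq> 1" by (metis abs_of_nat coprime_iff_gcd_eq_1 gcd_int_def nat_int of_nat_1)
    then obtain p where p: "prime p" "p dvd gcd (nat \<bar>D1\<bar>) M" using prime_factor_nat by blast
    then have "p dvd nat \<bar>D1\<bar>" "p dvd M" using dvd_trans gcd_dvd1 gcd_dvd2 by blast+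
    then show False using copM[OF p(1)] by (simp add: dvd_nat_abs_iff)
  qed
  have "even (multiplicity p M)" if p: "prime p" "p dvd M" "\<not> kronecker_prime D1 p = 1" for p
  proof -
    have pN: "int p dvd N" unfolding NM using p by simp
    have "eps_prime D1 D2 p \<noteq> 1" using eps_prime_eq[OF p(1) pN copM[OF p(1,2)]] p(3) by simp
    then have "even (multiplicity p (E2 * M))" using ev[OF p(1) pN] natN by simp
    moreover have "multiplicity p (E2 * M) = multiplicity p E2 + multiplicity p M"
      using p E2p M by (intro prime_elem_multiplicity_mult_distrib) auto
    moreover have "\<not> p dvd E2" using primeE2(1)[OF p(1)] copM[OF p(1,2)] by blast
    ultimately show ?thesis by (simp add: not_dvd_imp_multiplicity_0)
  qed
  then obtain E1 G where EG: "M = E1 * G\<^sup>2" "\<forall>p. prime p \<longrightarrow> p dvd E1 \<longrightarrow> kronecker_prime D1 p = 1"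
    using square_part_decomposition[OF M(2), of "\<lambda>p. kronecker_prime D1 p = 1"] by blast
  have EGp: "E1 > 0" "G > 0" using EG M by (auto intro: Nat.gr0I)
  obtain t1 where t1: "4 * int E1 dvd t1\<^sup>2 - D1"
    using sqrt_cong_exists[OF EGp(1) disc_mod_4(1)] EG(2) by blast
  have "kronecker_prime D2 p = 1" if p: "prime p" "p dvd E2" for p
  proof -
    have nd: "\<not> int p dvd D2" using not_dvd_both[OF p(1)] primeE2[OF p] by blast
    have e: "eps_prime D1 D2 p = kronecker_prime D2 p"
      using disc_pair.eps_prime_eq[OF swap p(1) primeE2(2)[OF p] nd] eps_prime_swap by simp
    have dvN: "m dvd nat N \<longleftrightarrow> int m dvd N" for m
      using N_pos int_dvd_int_iff[of m "nat N"] by simp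
    have "\<not> p\<^sup>2 dvd nat N"
      unfolding dvN using not_square_dvd_N[OF p(1) primeE2(1)[OF p]] by simp
    moreover have "p dvd nat N" unfolding dvN by (rule primeE2(2)[OF p])
    ultimately have "multiplicity p (nat N) = 1"
      by (intro multiplicity_eqI) (simp_all add: numeral_2_eq_2)
    then have "eps_prime D1 D2 p = 1" using ev[OF p(1) primeE2(2)[OF p]] by force
    then show ?thesis using e by simp
  qed
  then obtain t2 where "4 * int E2 dvd t2\<^sup>2 - D2"
    using sqrt_cong_exists[OF E2p disc_mod_4(2)] by blast
  then have t2: "int E2 dvd t2\<^sup>2 - D2" by (metis dvd_mult_right)
  have E2D: "int E2 dvd D1" unfolding E2 by simp
  \<comment> \<open>E2 divides n^2 and is squarefree by \<open>not_square_dvd_N\<close>.\<close>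
  have E2n: "int E2 dvd n"
  proof -
    have "n\<^sup>2 = D1 * D2 - 4 * N" using N by simp
    also have "int E2 dvd \<dots>" using E2D NM by simp
    finally have "int E2 dvd (int (nat \<bar>n\<bar>))\<^sup>2" by simp
    then have "E2 dvd (nat \<bar>n\<bar>)\<^sup>2" by (metis int_dvd_int_iff of_nat_power)
    have "E2 dvd nat \<bar>n\<bar>"
    proof (rule ccontr)
      assume nd: "\<not> E2 dvd nat \<bar>n\<bar>"
      define g where "g = gcd E2 (nat \<bar>n\<bar>)"
      obtain e where e: "E2 = g * e" unfolding g_def by (meson dvdE gcd_dvd1)
      have "e \<noteq> 1" using nd e unfolding g_def by (metis gcd_dvd2 mult.right_neutral)
      then obtain p where p: "prime p" "p dvd e" using prime_factor_nat by blast
      have pE: "p dvd E2" using p e by simp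
      then have "p dvd (nat \<bar>n\<bar>)\<^sup>2" using \<open>E2 dvd (nat \<bar>n\<bar>)\<^sup>2\<close> dvd_trans by blast
      then have "p dvd nat \<bar>n\<bar>" using p prime_dvd_power by blast
      then have "p dvd g" unfolding g_def by (intro gcd_greatest pE)
      then have "p * p dvd E2" unfolding e using p(2) by (intro mult_dvd_mono)
      then have "int (p * p) dvd int E2" by (simp only: int_dvd_int_iff)
      then have "(int p)\<^sup>2 dvd N" unfolding NM by (simp add: power2_eq_square)
      then show False using not_square_dvd_N[OF p(1) primeE2(1)[OF p(1) pE]] by blast
    qed
    then show ?thesis by (simp add: dvd_nat_abs_iff)
  qed
  have c1: "coprime D1 (int E1 * int G)"
    using cM unfolding EG by (simp add: power2_eq_square)
  have c2: "coprime D2 (int E2)" using cop E2D by (meson coprime_commute coprime_divisors dvd_refl)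
  have NE: "N = int E1 * int E2 * (int G)\<^sup>2" unfolding NM EG by simp
  obtain a A u where "(a, A, u) \<noteq> (0, 0, 0)" "D1 * a\<^sup>2 - 2 * n * a * A + D2 * A\<^sup>2 = u\<^sup>2"
    using conic_isotropic[OF N NE _ _ _ t1 t2 E2D E2n odd c1 c2] EGp E2p by auto
  then show ?thesis using conic_pair[OF _ _ fund even_n_iff] by blast
qed

lemma (in disc_pair) pair_exists:
  assumes ev: "\<And>p. prime p \<Longrightarrow> int p dvd N \<Longrightarrow> eps_prime D1 D2 p \<noteq> 1 \<Longrightarrow> even (multiplicity p (nat N))"
  shows "\<exists>q1 q2. bqf_disc q1 = D1 \<and> bqf_disc q2 = D2 \<and> B_Delta q1 q2 = n"
proof (cases "odd D1")
  case True
  show ?thesis by (rule pair_exists_odd[OF ev True])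
next
  case False
  then have "odd D2" using not_dvd_both[OF two_is_prime_nat] by simp
  have "\<exists>q2 q1. bqf_disc q2 = D2 \<and> bqf_disc q1 = D1 \<and> B_Delta q2 q1 = n"
    by (rule disc_pair.pair_exists_odd[OF swap _ \<open>odd D2\<close>]) (simp add: ev eps_prime_swap)
  then show ?thesis by (metis B_Delta_commute)
qed

section \<open>Similarity of pairs\<close>

fun mat_mult :: "mat2 \<Rightarrow> mat2 \<Rightarrow> mat2" where
  "mat_mult (a, b, c, d) (a', b', c', d') = (a * a' + b * c', a * b' + b * d', c * a' + d * c', c * b' + d * d')"

fun mat_det :: "mat2 \<Rightarrow> int" where "mat_det (a, b, c, d) = a * d - b * c"

fun mat_adj :: "mat2 \<Rightarrow> mat2" where "mat_adj (a, b, c, d) = (d, - b, - c, a)"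

fun bqf_scale :: "int \<Rightarrow> bqf \<Rightarrow> bqf" where
  "bqf_scale k (BQF A B C) = BQF (k * A) (k * B) (k * C)"

lemma Gamma_iff: "g \<in> Gamma \<longleftrightarrow> mat_det g = 1"
  by (cases g) (simp add: Gamma_def)

lemma mat_det_mult: "mat_det (mat_mult g h) = mat_det g * mat_det h"
  by (cases g; cases h) (simp add: algebra_simps)

lemma mat_det_adj [simp]: "mat_det (mat_adj g) = mat_det g"
  by (cases g) (simp add: algebra_simps)

text \<open>The action is a right action and is defined for every integral matrix. For determinant k
  the adjugate takes the place of the inverse at the cost of a factor k^2, so rational similitudes
  can be handled with integral matrices.\<close>

lemma bqf_act_mult: "bqf_act g (bqf_act h q) = bqf_act (mat_mult h g) q"
  by (cases g; cases h; cases q) (simp add: power2_eq_square algebra_simps)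

lemma bqf_act_adj: "bqf_act (mat_adj g) (bqf_act g q) = bqf_scale ((mat_det g)\<^sup>2) q"
  by (cases g; cases q) (simp add: power2_eq_square algebra_simps)

lemma bqf_act_adj': "bqf_act g (bqf_act (mat_adj g) q) = bqf_scale ((mat_det g)\<^sup>2) q"
  by (cases g; cases q) (simp add: power2_eq_square algebra_simps)

lemma bqf_act_scale: "bqf_act g (bqf_scale k q) = bqf_scale k (bqf_act g q)"
  by (cases g; cases q) (simp add: power2_eq_square algebra_simps)

lemma bqf_scale_scale: "bqf_scale k (bqf_scale l q) = bqf_scale (k * l) q"
  by (cases q) (simp add: algebra_simps)

lemma bqf_scale_one [simp]: "bqf_scale 1 q = q"
  by (cases q) simp

lemma bqf_scale_cancel: "k \<noteq> 0 \<Longrightarrow> bqf_scale k q = bqf_scale k q' \<longleftrightarrow> q = q'"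
  by (cases q; cases q') simp

lemma bqf_disc_act: "bqf_disc (bqf_act g q) = (mat_det g)\<^sup>2 * bqf_disc q"
  by (cases g; cases q) (simp add: bqf_disc_def power2_eq_square algebra_simps)

lemma B_Delta_act: "B_Delta (bqf_act g q) (bqf_act g q') = (mat_det g)\<^sup>2 * B_Delta q q'"
  by (cases g; cases q; cases q') (simp add: B_Delta_def power2_eq_square algebra_simps)

lemma Gamma_act_one: "bqf_act (1, 0, 0, 1) q = q"
  by (cases q) simp

lemma Gamma_adj: "g \<in> Gamma \<Longrightarrow> mat_adj g \<in> Gamma"
  by (simp add: Gamma_iff)

lemma Gamma_mult: "g \<in> Gamma \<Longrightarrow> h \<in> Gamma \<Longrightarrow> mat_mult g h \<in> Gamma"
  by (simp add: Gamma_iff mat_det_mult)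

lemma Gamma_act_adj: "g \<in> Gamma \<Longrightarrow> bqf_act (mat_adj g) (bqf_act g q) = q"
  by (simp add: Gamma_iff bqf_act_adj)

lemma equiv_bqf_equiv2: "equiv UNIV bqf_equiv2"
proof (rule equivI)
  show "refl bqf_equiv2"
  proof (rule refl_onI)
    fix q :: "bqf \<times> bqf"
    have "(1, 0, 0, 1) \<in> Gamma" by (simp add: Gamma_iff)
    then show "(q, q) \<in> bqf_equiv2"
      by (cases q) (auto simp: bqf_equiv2_def Gamma_act_one intro: bexI[of _ "(1, 0, 0, 1)"])
  qed
  show "sym bqf_equiv2"
  proof (rule symI)
    fix q q' assume "(q, q') \<in> bqf_equiv2"
    then obtain g where g: "g \<in> Gamma" "bqf_act g (fst q) = fst q'" "bqf_act g (snd q) = snd q'"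
      by (auto simp: bqf_equiv2_def)
    have "bqf_act (mat_adj g) (fst q') = fst q" "bqf_act (mat_adj g) (snd q') = snd q"
      unfolding g(2,3)[symmetric] by (rule Gamma_act_adj[OF g(1)])+
    then show "(q', q) \<in> bqf_equiv2"
      using Gamma_adj[OF g(1)] by (cases q; cases q') (simp add: bqf_equiv2_def, blast)
  qed
  show "trans bqf_equiv2"
  proof (rule transI)
    fix q q' q'' assume "(q, q') \<in> bqf_equiv2" "(q', q'') \<in> bqf_equiv2"
    then obtain g h where g: "g \<in> Gamma" "bqf_act g (fst q) = fst q'" "bqf_act g (snd q) = snd q'"
      and h: "h \<in> Gamma" "bqf_act h (fst q') = fst q''" "bqf_act h (snd q') = snd q''"
      by (auto simp: bqf_equiv2_def)
    have "bqf_act (mat_mult g h) (fst q) = fst q''" "bqf_act (mat_mult g h) (snd q) = snd q''"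
      using g h by (simp_all flip: bqf_act_mult)
    then show "(q, q'') \<in> bqf_equiv2"
      using Gamma_mult[OF g(1) h(1)] by (cases q; cases q'') (simp add: bqf_equiv2_def, blast)
  qed
qed auto

lemma bqf_equiv_iff: "(q, q') \<in> bqf_equiv \<longleftrightarrow> ((q, q), (q', q')) \<in> bqf_equiv2"
  by (auto simp: bqf_equiv_def bqf_equiv2_def)

lemma equiv_bqf_equiv: "equiv UNIV bqf_equiv"
proof (rule equivI)
  show "refl bqf_equiv"
    using equiv_bqf_equiv2 by (simp add: equiv_def refl_on_def bqf_equiv_iff)
  show "sym bqf_equiv"
    using equiv_bqf_equiv2 unfolding equiv_def sym_def bqf_equiv_iff by blast
  show "trans bqf_equiv"
    using equiv_bqf_equiv2 unfolding equiv_def trans_def bqf_equiv_iff by blast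
qed auto

lemma bqf_equiv2_iff:
  "((q1, q2), (q1', q2')) \<in> bqf_equiv2 \<longleftrightarrow> (\<exists>g\<in>Gamma. bqf_act g q1 = q1' \<and> bqf_act g q2 = q2')"
  by (simp add: bqf_equiv2_def)

text \<open>Serves twice: for the lattices attached to a base pair, and for the forms crossing one
  period of a geodesic.\<close>

lemma bij_betw_quotient_transversal:
  assumes r: "equiv UNIV r" and f: "f ` T \<subseteq> X"
    and ex: "\<And>x. x \<in> X \<Longrightarrow> \<exists>t\<in>T. (f t, x) \<in> r"
    and un: "\<And>t t'. t \<in> T \<Longrightarrow> t' \<in> T \<Longrightarrow> (f t, f t') \<in> r \<Longrightarrow> t = t'"
  shows "bij_betw (\<lambda>t. r `` {f t}) T (X // r)"
proof (rule bij_betwI')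
  fix t t' assume t: "t \<in> T" "t' \<in> T"
  show "(r `` {f t} = r `` {f t'}) = (t = t')"
    using un[OF t] eq_equiv_class_iff[OF r, of "f t" "f t'"] by auto
next
  fix t assume "t \<in> T"
  then show "r `` {f t} \<in> X // r" using f by (intro quotientI) auto
next
  fix K assume "K \<in> X // r"
  then obtain x where x: "x \<in> X" "K = r `` {x}" by (rule quotientE)
  then obtain t where t: "t \<in> T" "(f t, x) \<in> r" using ex by blast
  then show "\<exists>t\<in>T. K = r `` {f t}" using x equiv_class_eq[OF r t(2)] by auto
qed

text \<open>The bracket is the resultant of the two quadratic polynomials. Its sign decides whether
  the geodesics cross, and its value, -N for a pair, is divisible by every modulus in which the
  forms have a common root.\<close>

lemma bqf_resultant:
  "4 * ((coefA q1 * coefC q2 - coefA q2 * coefC q1)\<^sup>2 -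
     (coefA q1 * coefB q2 - coefA q2 * coefB q1) * (coefB q1 * coefC q2 - coefB q2 * coefC q1))
   = (B_Delta q1 q2)\<^sup>2 - bqf_disc q1 * bqf_disc q2"
  by (cases q1; cases q2) (simp add: B_Delta_def bqf_disc_def power2_eq_square algebra_simps)

text \<open>Multiplication by the inverse of g makes the condition linear: g lies in the span of 1
  and the matrix with rows (-B, -2 C) and (2 A, B). In coordinates, an invertible matrix annihilates
  (\<open>P\<close>, \<open>Q\<close>).\<close>

lemma similitude_commutes:
  assumes "bqf_act (a, b, c, d) q = bqf_scale (a * d - b * c) q" "a * d - b * c \<noteq> 0"
  shows "c * coefB q = coefA q * (d - a)" and "c * coefC q = - (coefA q * b)"
proof -
  obtain A B C where q: "q = BQF A B C" by (cases q)
  have e1: "A * a\<^sup>2 + B * a * c + C * c\<^sup>2 = (a * d - b * c) * A"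
    and e2: "2 * A * a * b + B * (a * d + b * c) + 2 * C * c * d = (a * d - b * c) * B"
    using assms(1) by (simp_all add: q)
  define P Q where "P = A * a + B * c - A * d" and "Q = C * c + A * b"
  have 1: "a * P + c * Q = 0" using e1 unfolding P_def Q_def by (simp add: power2_eq_square algebra_simps)
  have 2: "b * P + d * Q = 0" using e2 unfolding P_def Q_def by (simp add: power2_eq_square algebra_simps)
  have "(a * d - b * c) * P = d * (a * P + c * Q) - c * (b * P + d * Q)" by (simp add: algebra_simps)
  then have "P = 0" using 1 2 assms(2) by simp
  have "(a * d - b * c) * Q = a * (b * P + d * Q) - b * (a * P + c * Q)" by (simp add: algebra_simps)
  then have "Q = 0" using 1 2 assms(2) by simp
  show "c * coefB q = coefA q * (d - a)" using \<open>P = 0\<close> by (simp add: q P_def algebra_simps)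
  show "c * coefC q = - (coefA q * b)" using \<open>Q = 0\<close> by (simp add: q Q_def algebra_simps)
qed

text \<open>Hilbert's theorem 90 for z = x + u sqrt D and z' = x' + u' sqrt D of equal norm: y = p +
  r sqrt D has to satisfy z y = z' conj(y). The witness is y = sqrt D (z' - conj(z)), and y = 2
  conj(z) in case z' = conj(z).\<close>

lemma hilbert90_solution:
  fixes x u x' u' D :: int
  assumes "x\<^sup>2 - D * u\<^sup>2 = x'\<^sup>2 - D * u'\<^sup>2" "(x, u) \<noteq> (0, 0)" "D \<noteq> 0"
  obtains p r where "(p, r) \<noteq> (0, 0)" "x * p + D * u * r = x' * p - D * u' * r" "x * r + u * p = u' * p - x' * r"
proof (cases "D * (u + u') = 0 \<and> x' - x = 0")
  case False
  show thesis
    by (rule that[of "D * (u + u')" "x' - x"])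
       (use False assms(1) in \<open>auto simp: power2_eq_square algebra_simps\<close>)
next
  case True
  then have "u' = - u" "x' = x" using assms(3) by auto
  then show thesis
    by (intro that[of "x + x'" "u' - u"]) (use assms(2) in \<open>auto simp: power2_eq_square algebra_simps\<close>)
qed

context disc_pair
begin

definition pairs :: "(bqf \<times> bqf) set" where
  "pairs = {(q1, q2). bqf_disc q1 = D1 \<and> bqf_disc q2 = D2 \<and> B_Delta q1 q2 = n}"

lemma leading_nonzero: "bqf_disc q = D1 \<Longrightarrow> coefA q \<noteq> 0"
  using fund_disc_not_square[OF fund(1), of 1 "coefB q"] by (auto simp: bqf_disc_def)

lemma pairs_resultant:
  assumes "(q1, q2) \<in> pairs"
  shows "N = (coefA q1 * coefB q2 - coefA q2 * coefB q1) * (coefB q1 * coefC q2 - coefB q2 * coefC q1)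
     - (coefA q1 * coefC q2 - coefA q2 * coefC q1)\<^sup>2"
  using bqf_resultant[of q1 q2] N assms by (simp add: pairs_def)

lemma jacobian_nonzero:
  assumes "(q1, q2) \<in> pairs"
  shows "coefA q1 * coefB q2 - coefA q2 * coefB q1 \<noteq> 0"
proof
  assume "coefA q1 * coefB q2 - coefA q2 * coefB q1 = 0"
  then have "N \<le> 0" using pairs_resultant[OF assms] by simp
  then show False using N_pos by simp
qed

lemma pairs_act: "g \<in> Gamma \<Longrightarrow> (q1, q2) \<in> pairs \<Longrightarrow> (bqf_act g q1, bqf_act g q2) \<in> pairs"
  by (simp add: pairs_def bqf_disc_act B_Delta_act Gamma_iff)

text \<open>By \<open>similitude_commutes\<close> g commutes with two matrices that are not
  proportional, which only scalars do.\<close>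

lemma common_similitude_scalar:
  assumes p: "(q1, q2) \<in> pairs" and d: "a * d - b * c \<noteq> 0"
    and 1: "bqf_act (a, b, c, d) q1 = bqf_scale (a * d - b * c) q1"
    and 2: "bqf_act (a, b, c, d) q2 = bqf_scale (a * d - b * c) q2"
  shows "b = 0 \<and> c = 0 \<and> d = a"
proof -
  have A1: "coefA q1 \<noteq> 0" using p leading_nonzero by (simp add: pairs_def)
  have "c * (coefA q1 * coefB q2 - coefA q2 * coefB q1) = coefA q1 * (c * coefB q2) - coefA q2 * (c * coefB q1)"
    by (simp add: algebra_simps)
  also have "\<dots> = 0" unfolding similitude_commutes(1)[OF 1 d] similitude_commutes(1)[OF 2 d] by simp
  finally have c: "c = 0" using jacobian_nonzero[OF p] by simp
  then show ?thesis using similitude_commutes[OF 1 d] A1 by simp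
qed

text \<open>
  In the coordinates that turn \<open>q1\<close> into a multiple of \<open>[4, 0, -D1]\<close>, the second form of a pair
  is determined by an element \<open>\<xi> + u \<surd>D1\<close> of norm \<open>-4 N A\<^sup>2\<close>; multiplication by \<open>p + r \<surd>D1\<close>
  preserves the first form up to scaling and multiplies that element by \<open>(p + r \<surd>D1) / (p - r \<surd>D1)\<close>.
\<close>

lemma pairs_similar:
  assumes p: "(q1, q2) \<in> pairs" and p': "(q1', q2') \<in> pairs"
  obtains g where "mat_det g \<noteq> 0" "bqf_act g q1 = bqf_scale (mat_det g) q1'" "bqf_act g q2 = bqf_scale (mat_det g) q2'"
proof -
  \<comment> \<open>Replacing x by 2 x - B y and y by 2 A y completes the square in q1. The last
    coefficient of the transformed q2 is then forced by the invariant n.\<close>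
  define W where "W A a u = BQF (4 * a) (4 * u) (a * D1 - 2 * A * n)" for A a u
  have norm: "bqf_act (2, - coefB q1, 0, 2 * coefA q1) q1 = bqf_scale (coefA q1) (BQF 4 0 (- D1))"
    "bqf_act (2, - coefB q1, 0, 2 * coefA q1) q2 = W (coefA q1) (coefA q2) (coefA q1 * coefB q2 - coefA q2 * coefB q1)"
    "(D1 * coefA q2 - n * coefA q1)\<^sup>2 - D1 * (coefA q1 * coefB q2 - coefA q2 * coefB q1)\<^sup>2 = - 4 * N * (coefA q1)\<^sup>2"
    if "(q1, q2) \<in> pairs" for q1 q2
  proof -
    obtain A B C a b c where q: "q1 = BQF A B C" "q2 = BQF a b c" by (cases q1; cases q2)
    have D: "D1 = B\<^sup>2 - 4 * A * C" "D2 = b\<^sup>2 - 4 * a * c" "n = B * b - 2 * A * c - 2 * a * C"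
      using that by (simp_all add: pairs_def q bqf_disc_def B_Delta_def)
    have N4: "4 * N = D1 * D2 - n\<^sup>2" using N by simp
    show "bqf_act (2, - coefB q1, 0, 2 * coefA q1) q1 = bqf_scale (coefA q1) (BQF 4 0 (- D1))"
      unfolding q D by (simp add: power2_eq_square algebra_simps)
    show "bqf_act (2, - coefB q1, 0, 2 * coefA q1) q2 = W (coefA q1) (coefA q2) (coefA q1 * coefB q2 - coefA q2 * coefB q1)"
      unfolding q D W_def by (simp add: power2_eq_square algebra_simps)
    have "(D1 * a - n * A)\<^sup>2 - D1 * (A * b - a * B)\<^sup>2 = - (D1 * D2 - n\<^sup>2) * A\<^sup>2"
      unfolding D by (simp add: power2_eq_square algebra_simps)
    then show "(D1 * coefA q2 - n * coefA q1)\<^sup>2 - D1 * (coefA q1 * coefB q2 - coefA q2 * coefB q1)\<^sup>2 = - 4 * N * (coefA q1)\<^sup>2"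
      unfolding q N by simp
  qed
  define A a u where "A = coefA q1" and "a = coefA q2" and "u = coefA q1 * coefB q2 - coefA q2 * coefB q1"
  define A' a' u' where "A' = coefA q1'" and "a' = coefA q2'" and "u' = coefA q1' * coefB q2' - coefA q2' * coefB q1'"
  define x x' where "x = D1 * a - n * A" and "x' = D1 * a' - n * A'"
  have A0: "A \<noteq> 0" "A' \<noteq> 0" using p p' leading_nonzero by (simp_all add: pairs_def A_def A'_def)
  have u0: "u \<noteq> 0" using jacobian_nonzero[OF p] u_def by simp
  have D10: "D1 > 0" using fund by (simp add: fund_disc_def)
  have nx: "x\<^sup>2 - D1 * u\<^sup>2 = - 4 * N * A\<^sup>2" "x'\<^sup>2 - D1 * u'\<^sup>2 = - 4 * N * A'\<^sup>2"
    using norm(3)[OF p] norm(3)[OF p'] unfolding x_def x'_def A_def a_def u_def A'_def a'_def u'_def by simp_all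
  \<comment> \<open>The norms are in the ratio of the squares of A and A'; cross-multiplication
    makes them equal, as Hilbert 90 requires.\<close>
  have "(A' * x)\<^sup>2 - D1 * (A' * u)\<^sup>2 = A'\<^sup>2 * (x\<^sup>2 - D1 * u\<^sup>2)"
    "(A * x')\<^sup>2 - D1 * (A * u')\<^sup>2 = A\<^sup>2 * (x'\<^sup>2 - D1 * u'\<^sup>2)" by (simp_all add: power2_eq_square algebra_simps)
  then have "(A' * x)\<^sup>2 - D1 * (A' * u)\<^sup>2 = (A * x')\<^sup>2 - D1 * (A * u')\<^sup>2" unfolding nx by simp
  then obtain s r where sr: "(s, r) \<noteq> (0, 0)"
    and e1: "A' * x * s + D1 * (A' * u) * r = A * x' * s - D1 * (A * u') * r"
    and e2: "A' * x * r + A' * u * s = A * u' * s - A * x' * r"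
    using hilbert90_solution[of "A' * x" D1 "A' * u" "A * x'" "A * u'"] A0 u0 D10 by auto
  \<comment> \<open>Twice the multiplication by s + r sqrt D1, acting on 2 x + y sqrt D1, whose norm
    is the form [4, 0, -D1].\<close>
  define k :: mat2 where "k = (2 * s, r * D1, 4 * r, 2 * s)"
  define M where "M = s\<^sup>2 - D1 * r\<^sup>2"
  have detk: "mat_det k = 4 * M" by (simp add: k_def M_def power2_eq_square algebra_simps)
  have M0: "M \<noteq> 0"
  proof
    assume "M = 0"
    then have "D1 * r\<^sup>2 = s\<^sup>2" by (simp add: M_def)
    then have "r = 0" using fund_disc_not_square[OF fund(1)] by blast
    then show False using \<open>D1 * r\<^sup>2 = s\<^sup>2\<close> sr by simp
  qed
  have k1: "bqf_act k (BQF 4 0 (- D1)) = bqf_scale (4 * M) (BQF 4 0 (- D1))"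
    by (simp add: k_def M_def power2_eq_square algebra_simps)
  have E1: "A' * (x * s\<^sup>2 + 2 * D1 * u * s * r + x * D1 * r\<^sup>2) = A * x' * M"
  proof -
    have "A' * (x * s\<^sup>2 + 2 * D1 * u * s * r + x * D1 * r\<^sup>2) =
      s * (A' * x * s + D1 * (A' * u) * r) + D1 * r * (A' * x * r + A' * u * s)"
      by (simp add: power2_eq_square algebra_simps)
    also have "\<dots> = A * x' * M" unfolding e1 e2 M_def by (simp add: power2_eq_square algebra_simps)
    finally show ?thesis .
  qed
  have E2: "A' * (2 * x * s * r + u * (s\<^sup>2 + D1 * r\<^sup>2)) = A * u' * M"
  proof -
    have "A' * (2 * x * s * r + u * (s\<^sup>2 + D1 * r\<^sup>2)) =
      r * (A' * x * s + D1 * (A' * u) * r) + s * (A' * x * r + A' * u * s)"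
      by (simp add: power2_eq_square algebra_simps)
    also have "\<dots> = A * u' * M" unfolding e1 e2 M_def by (simp add: power2_eq_square algebra_simps)
    finally show ?thesis .
  qed
  have k2: "bqf_scale A' (bqf_act k (W A a u)) = bqf_scale (A * (4 * M)) (W A' a' u')"
  proof -
    \<comment> \<open>The factor D1 is there because a enters \<open>E1\<close> only through x = D1
      a - n A.\<close>
    have c1: "D1 * (A' * (4 * a * (2 * s)\<^sup>2 + 4 * u * (2 * s) * (4 * r) + (a * D1 - 2 * A * n) * (4 * r)\<^sup>2))
       = D1 * (A * (4 * M) * (4 * a'))"
    proof -
      have "D1 * (A' * (4 * a * (2 * s)\<^sup>2 + 4 * u * (2 * s) * (4 * r) + (a * D1 - 2 * A * n) * (4 * r)\<^sup>2))
        = 16 * (A' * (x * s\<^sup>2 + 2 * D1 * u * s * r + x * D1 * r\<^sup>2)) + 16 * A * A' * n * M"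
        unfolding x_def M_def by (simp add: power2_eq_square algebra_simps)
      also have "\<dots> = D1 * (A * (4 * M) * (4 * a'))"
        unfolding E1 x'_def by (simp add: power2_eq_square algebra_simps)
      finally show ?thesis .
    qed
    have c2: "A' * (2 * (4 * a) * (2 * s) * (r * D1) + 4 * u * ((2 * s) * (2 * s) + r * D1 * (4 * r)) + 2 * (a * D1 - 2 * A * n) * (4 * r) * (2 * s))
       = A * (4 * M) * (4 * u')"
    proof -
      have "A' * (2 * (4 * a) * (2 * s) * (r * D1) + 4 * u * ((2 * s) * (2 * s) + r * D1 * (4 * r)) + 2 * (a * D1 - 2 * A * n) * (4 * r) * (2 * s))
        = 16 * (A' * (2 * x * s * r + u * (s\<^sup>2 + D1 * r\<^sup>2)))"
        unfolding x_def by (simp add: power2_eq_square algebra_simps)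
      then show ?thesis unfolding E2 by simp
    qed
    have c3: "A' * (4 * a * (r * D1)\<^sup>2 + 4 * u * (r * D1) * (2 * s) + (a * D1 - 2 * A * n) * (2 * s)\<^sup>2)
       = A * (4 * M) * (a' * D1 - 2 * A' * n)"
    proof -
      have "A' * (4 * a * (r * D1)\<^sup>2 + 4 * u * (r * D1) * (2 * s) + (a * D1 - 2 * A * n) * (2 * s)\<^sup>2)
        = 4 * (A' * (x * s\<^sup>2 + 2 * D1 * u * s * r + x * D1 * r\<^sup>2)) - 4 * A * A' * n * M"
        unfolding x_def M_def by (simp add: power2_eq_square algebra_simps)
      also have "\<dots> = A * (4 * M) * (a' * D1 - 2 * A' * n)"
        unfolding E1 x'_def by (simp add: power2_eq_square algebra_simps)
      finally show ?thesis .
    qed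
    show ?thesis
      unfolding W_def k_def bqf_act.simps bqf_scale.simps bqf.inject
      using c1 c2 c3 D10 by simp
  qed
  define g1 g1' :: mat2 where "g1 = (2, - coefB q1, 0, 2 * coefA q1)" and "g1' = (2, - coefB q1', 0, 2 * coefA q1')"
  have det1: "mat_det g1 = 4 * A" "mat_det g1' = 4 * A'" by (simp_all add: g1_def g1'_def A_def A'_def)
  define g where "g = mat_mult (mat_mult g1 k) (mat_adj g1')"
  have detg: "mat_det g = (4 * A) * (4 * M) * (4 * A')" by (simp add: g_def mat_det_mult det1 detk)
  have act: "bqf_act g q = bqf_act (mat_adj g1') (bqf_act k (bqf_act g1 q))" for q
    by (simp add: g_def bqf_act_mult)
  have undo: "bqf_act (mat_adj g1') (bqf_act g1' q) = bqf_scale (16 * A'\<^sup>2) q" for q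
    by (simp add: bqf_act_adj det1 power_mult_distrib)
  have "bqf_scale A' (bqf_act g q1) = bqf_scale A' (bqf_scale (mat_det g) q1')"
  proof -
    have "bqf_scale A' (bqf_act g q1) = bqf_scale A' (bqf_scale A (bqf_act (mat_adj g1') (bqf_act k (BQF 4 0 (- D1)))))"
      unfolding act g1_def norm(1)[OF p] by (simp only: bqf_act_scale A_def)
    also have "\<dots> = bqf_scale (A * (4 * M)) (bqf_act (mat_adj g1') (bqf_scale A' (BQF 4 0 (- D1))))"
      unfolding k1 bqf_act_scale bqf_scale_scale by (simp only: mult_ac)
    also have "bqf_scale A' (BQF 4 0 (- D1)) = bqf_act g1' q1'"
      unfolding g1'_def norm(1)[OF p'] A'_def ..
    finally show ?thesis unfolding undo bqf_scale_scale detg by (simp add: power2_eq_square mult_ac)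
  qed
  then have r1: "bqf_act g q1 = bqf_scale (mat_det g) q1'" using bqf_scale_cancel[OF A0(2)] by blast
  have "bqf_scale A' (bqf_act g q2) = bqf_scale A' (bqf_scale (mat_det g) q2')"
  proof -
    have "bqf_scale A' (bqf_act g q2) = bqf_act (mat_adj g1') (bqf_scale A' (bqf_act k (W A a u)))"
      unfolding act g1_def norm(2)[OF p] by (simp only: bqf_act_scale A_def a_def u_def)
    also have "\<dots> = bqf_scale (A * (4 * M)) (bqf_act (mat_adj g1') (W A' a' u'))"
      unfolding k2 bqf_act_scale ..
    also have "W A' a' u' = bqf_act g1' q2'"
      unfolding g1'_def norm(2)[OF p'] A'_def a'_def u'_def ..
    finally show ?thesis unfolding undo bqf_scale_scale detg by (simp add: power2_eq_square mult_ac)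
  qed
  then have r2: "bqf_act g q2 = bqf_scale (mat_det g) q2'" using bqf_scale_cancel[OF A0(2)] by blast
  have "mat_det g \<noteq> 0" unfolding detg using A0 M0 by simp
  then show thesis using r1 r2 by (rule that)
qed

end

section \<open>Pairs and sublattices\<close>

text \<open>The form on the lattice spanned by (a, 0) and (\<beta>, 1), divided by a. For negative a
  both the orientation of the basis and the sign of the scaling are reversed.\<close>

definition sublattice_form :: "int \<times> int \<Rightarrow> bqf \<Rightarrow> bqf" where
  "sublattice_form = (\<lambda>(a, \<beta>) q. BQF (coefA q * a) (2 * coefA q * \<beta> + coefB q) (bqf_eval q \<beta> 1 div a))"

lemma bqf_act_sublattice:
  assumes "a \<noteq> 0" "a dvd bqf_eval q \<beta> 1"
  shows "bqf_act (a, \<beta>, 0, 1) q = bqf_scale a (sublattice_form (a, \<beta>) q)"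
proof -
  obtain A B C where q: "q = BQF A B C" by (cases q)
  have "a * (bqf_eval q \<beta> 1 div a) = bqf_eval q \<beta> 1" using assms by simp
  then show ?thesis unfolding q by (simp add: sublattice_form_def power2_eq_square algebra_simps)
qed

lemma bqf_disc_scale: "bqf_disc (bqf_scale k q) = k\<^sup>2 * bqf_disc q"
  by (cases q) (simp add: bqf_disc_def power2_eq_square algebra_simps)

lemma B_Delta_scale: "B_Delta (bqf_scale k q) (bqf_scale k q') = k\<^sup>2 * B_Delta q q'"
  by (cases q; cases q') (simp add: B_Delta_def power2_eq_square algebra_simps)

lemma sublattice_form_translate:
  assumes "a \<noteq> 0" "a dvd bqf_eval q \<beta> 1"
  shows "bqf_act (1, k, 0, 1) (sublattice_form (a, \<beta>) q) = sublattice_form (a, \<beta> + a * k) q"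
    and "a dvd bqf_eval q (\<beta> + a * k) 1"
proof -
  obtain A B C where q: "q = BQF A B C" by (cases q)
  have e: "bqf_eval q (\<beta> + a * k) 1 = bqf_eval q \<beta> 1 + a * (2 * A * \<beta> * k + A * a * k\<^sup>2 + B * k)"
    unfolding q by (simp add: power2_eq_square algebra_simps)
  show d: "a dvd bqf_eval q (\<beta> + a * k) 1" unfolding e using assms by simp
  have g: "mat_mult (a, \<beta>, 0, 1) (1, k, 0, 1) = (a, \<beta> + a * k, 0, 1)" by (simp add: algebra_simps)
  have "bqf_scale a (bqf_act (1, k, 0, 1) (sublattice_form (a, \<beta>) q)) = bqf_scale a (sublattice_form (a, \<beta> + a * k) q)"
    by (simp only: bqf_act_scale[symmetric] bqf_act_sublattice[OF assms, symmetric] bqf_act_mult g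
        bqf_act_sublattice[OF assms(1) d])
  then show "bqf_act (1, k, 0, 1) (sublattice_form (a, \<beta>) q) = sublattice_form (a, \<beta> + a * k) q"
    using bqf_scale_cancel[OF assms(1)] by blast
qed

definition common_roots :: "bqf \<Rightarrow> bqf \<Rightarrow> nat \<Rightarrow> int set" where
  "common_roots q1 q2 m = {\<beta>. 0 \<le> \<beta> \<and> \<beta> < int m \<and> int m dvd bqf_eval q1 \<beta> 1 \<and> int m dvd bqf_eval q2 \<beta> 1}"

lemma finite_common_roots [simp]: "finite (common_roots q1 q2 m)"
  by (rule finite_subset[of _ "{0..<int m}"]) (auto simp: common_roots_def)

lemma coprime_int_primeI:
  fixes a b :: int
  assumes "\<And>p. prime p \<Longrightarrow> p dvd a \<Longrightarrow> p dvd b \<Longrightarrow> False" "b \<noteq> 0"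
  shows "coprime a b"
proof (rule ccontr)
  assume "\<not> coprime a b"
  then have "\<not> is_unit (gcd a b)" by (simp add: coprime_iff_gcd_eq_1)
  moreover have "gcd a b \<noteq> 0" using assms(2) by simp
  ultimately obtain p where "p dvd gcd a b" "prime p" using prime_divisor_exists by metis
  then show False using assms(1)[of p] by simp
qed

context disc_pair
begin

text \<open>The resultant lies in the ideal generated by the values of the two polynomials at any
  \<beta>.\<close>

lemma common_root_dvd_N:
  assumes p: "(q1, q2) \<in> pairs" and "m dvd bqf_eval q1 \<beta> 1" "m dvd bqf_eval q2 \<beta> 1"
  shows "m dvd N"
proof -
  obtain A B C a b c where q: "q1 = BQF A B C" "q2 = BQF a b c" by (cases q1; cases q2)
  define u where "u = A * b - a * B"
  define e1 e2 where "e1 = bqf_eval q1 \<beta> 1" and "e2 = bqf_eval q2 \<beta> 1"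
  have "N = u * (B * c - b * C) - (A * c - a * C)\<^sup>2"
    using pairs_resultant[OF p] by (simp add: q u_def)
  also have "\<dots> = u * (B * e2 - b * e1) - (A * e2 - a * e1) * (A * c - a * C - u * \<beta>)"
    unfolding u_def e1_def e2_def q by (simp add: power2_eq_square algebra_simps)
  finally show ?thesis using assms(2,3) unfolding e1_def e2_def by simp
qed

definition sublattices :: "bqf \<Rightarrow> bqf \<Rightarrow> (int \<times> int) set" where
  "sublattices q1 q2 = {(a, \<beta>). a \<noteq> 0 \<and> 0 \<le> \<beta> \<and> \<beta> < \<bar>a\<bar> \<and> a dvd bqf_eval q1 \<beta> 1 \<and> a dvd bqf_eval q2 \<beta> 1}"

lemma sublattice_pair:
  assumes "(q1, q2) \<in> pairs" "a \<noteq> 0" "a dvd bqf_eval q1 \<beta> 1" "a dvd bqf_eval q2 \<beta> 1"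
  shows "(sublattice_form (a, \<beta>) q1, sublattice_form (a, \<beta>) q2) \<in> pairs"
proof -
  note s1 = bqf_act_sublattice[OF assms(2,3)] and s2 = bqf_act_sublattice[OF assms(2,4)]
  have det: "(mat_det (a, \<beta>, 0, 1))\<^sup>2 = a\<^sup>2" by simp
  have a2: "a\<^sup>2 \<noteq> 0" using assms(2) by simp
  have "a\<^sup>2 * bqf_disc q1 = a\<^sup>2 * bqf_disc (sublattice_form (a, \<beta>) q1)"
    "a\<^sup>2 * bqf_disc q2 = a\<^sup>2 * bqf_disc (sublattice_form (a, \<beta>) q2)"
    "a\<^sup>2 * B_Delta q1 q2 = a\<^sup>2 * B_Delta (sublattice_form (a, \<beta>) q1) (sublattice_form (a, \<beta>) q2)"
    using arg_cong[OF s1, of bqf_disc] arg_cong[OF s2, of bqf_disc] arg_cong2[OF s1 s2, of B_Delta]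
    by (simp_all only: bqf_disc_scale B_Delta_scale bqf_disc_act B_Delta_act det)
  then show ?thesis using assms(1) a2 unfolding pairs_def by simp
qed

text \<open>If h identifies the two pairs of forms, then \<open>K\<close> is a similitude of the
  base pair and hence a scalar. So g h and g' are proportional; as both g and g' are triangular with
  last row (0, 1) and \<beta> is reduced, they coincide.\<close>

lemma sublattice_pair_injective:
  assumes p: "(q1, q2) \<in> pairs" and t: "(a, \<beta>) \<in> sublattices q1 q2" "(a', \<beta>') \<in> sublattices q1 q2"
    and h: "h \<in> Gamma" "bqf_act h (sublattice_form (a, \<beta>) q1) = sublattice_form (a', \<beta>') q1"
      "bqf_act h (sublattice_form (a, \<beta>) q2) = sublattice_form (a', \<beta>') q2"
  shows "(a, \<beta>) = (a', \<beta>')"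
proof -
  have t1: "a \<noteq> 0" "0 \<le> \<beta>" "\<beta> < \<bar>a\<bar>" "a dvd bqf_eval q1 \<beta> 1" "a dvd bqf_eval q2 \<beta> 1"
    and t2: "a' \<noteq> 0" "0 \<le> \<beta>'" "\<beta>' < \<bar>a'\<bar>" "a' dvd bqf_eval q1 \<beta>' 1" "a' dvd bqf_eval q2 \<beta>' 1"
    using t by (auto simp: sublattices_def)
  define g g' :: mat2 where "g = (a, \<beta>, 0, 1)" and "g' = (a', \<beta>', 0, 1)"
  define K where "K = mat_mult (mat_mult g h) (mat_adj g')"
  have dets: "mat_det g = a" "mat_det g' = a'" "mat_det h = 1"
    using h(1) by (simp_all add: g_def g'_def Gamma_iff)
  have detK: "mat_det K = a * a'" by (simp add: K_def mat_det_mult dets)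
  have Kq: "bqf_act K q = bqf_scale (a * a') q"
    if e: "bqf_act h (sublattice_form (a, \<beta>) q) = sublattice_form (a', \<beta>') q"
      and d: "a dvd bqf_eval q \<beta> 1" "a' dvd bqf_eval q \<beta>' 1" for q
  proof -
    have "bqf_scale a' (bqf_act K q) = bqf_act (mat_adj g') (bqf_scale a' (bqf_act h (bqf_act g q)))"
      by (simp only: K_def bqf_act_mult bqf_act_scale)
    also have "\<dots> = bqf_act (mat_adj g') (bqf_scale a (bqf_act g' q))"
      unfolding g_def g'_def bqf_act_sublattice[OF t1(1) d(1)] bqf_act_sublattice[OF t2(1) d(2)]
        bqf_act_scale e bqf_scale_scale by (simp only: mult.commute)
    also have "\<dots> = bqf_scale a' (bqf_scale (a * a') q)"
      unfolding bqf_act_scale bqf_act_adj bqf_scale_scale dets by (simp add: power2_eq_square mult_ac)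
    finally show ?thesis using bqf_scale_cancel[OF t2(1)] by blast
  qed
  obtain k1 k2 k3 k4 where Kc: "K = (k1, k2, k3, k4)" by (cases K)
  have det': "k1 * k4 - k2 * k3 = a * a'" using detK by (simp add: Kc)
  have "k2 = 0 \<and> k3 = 0 \<and> k4 = k1"
    using common_similitude_scalar[OF p, of k1 k4 k2 k3] Kq[OF h(2) t1(4) t2(4)] Kq[OF h(3) t1(5) t2(5)]
      t1(1) t2(1) unfolding det' Kc by simp
  then have K: "K = (k1, 0, 0, k1)" "k1 * k1 = a * a'" using Kc det' by simp_all
  obtain x y z w where hc: "h = (x, y, z, w)" by (cases h)
  have "mat_mult K g' = mat_mult (mat_mult g h) (a', 0, 0, a')"
    unfolding K_def g_def g'_def hc by (simp add: algebra_simps)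
  then have eqs: "z = 0" "k1 = w * a'" "w * a' = a * x" "w * a' * \<beta>' = (a * y + \<beta> * w) * a'"
    using t2(1) unfolding K g_def g'_def hc by auto
  have z: "z = 0" by (fact eqs(1))
  then have xw: "x * w = 1" using h(1) by (simp add: hc Gamma_def)
  have "a * x = w * a'" using eqs(3) by simp
  moreover have xw': "x = w" "x = 1 \<or> x = -1" using xw by (auto simp: zmult_eq_1_iff)
  ultimately have aa: "a = a'" by auto
  have "a' * (w * \<beta>') = a' * (a * y + \<beta> * w)" using eqs(4) by (simp only: mult_ac)
  then have "w * \<beta>' = a * y + \<beta> * w" using t2(1) by (simp only: mult_cancel_left) simp
  then have "\<beta>' - \<beta> = a * (y * w)" using xw' by auto
  then have "a dvd \<beta>' - \<beta>" by simp
  then have "\<bar>a\<bar> dvd \<beta>' - \<beta>" by simp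
  then have "\<beta>' mod \<bar>a\<bar> = \<beta> mod \<bar>a\<bar>" by (simp add: mod_eq_dvd_iff)
  then have "\<beta>' = \<beta>" using t1 t2 aa by simp
  then show ?thesis using aa by simp
qed

text \<open>A prime factor of e divides A a and A b^2 for either form. Since the matrix is
  primitive, it divides both leading coefficients and therefore N, against the normalisation of q1.
  Thus every lattice has a basis (a, 0), (b, 1).\<close>

lemma triangular_similitude_unimodular:
  assumes p: "(q1, q2) \<in> pairs" and cop: "coprime (coefA q1) N"
    and e: "e > 0" and g: "gcd a (gcd b e) = 1" and a0: "a \<noteq> 0"
    and s1: "bqf_act (a, b, 0, e) q1 = bqf_scale (a * e) q1'" and s2: "bqf_act (a, b, 0, e) q2 = bqf_scale (a * e) q2'"
  shows "e = 1"
proof (rule ccontr)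
  assume "e \<noteq> 1"
  then obtain p where p: "prime p" "p dvd e" using e prime_divisor_exists[of e] by auto
  have key: "p dvd coefA q" if s: "bqf_act (a, b, 0, e) q = bqf_scale (a * e) q'" for q q'
  proof -
    obtain A B C A' B' C' where q: "q = BQF A B C" "q' = BQF A' B' C'" by (cases q; cases q')
    have s': "A * a\<^sup>2 = a * e * A'" "A * b\<^sup>2 + B * b * e + C * e\<^sup>2 = a * e * C'"
      using s by (simp_all add: q)
    have "a * (A * a) = a * (e * A')" using s'(1) by (simp add: power2_eq_square)
    then have "A * a = e * A'" using a0 by simp
    then have 1: "p dvd A * a" using p by simp
    have "A * b\<^sup>2 = e * (a * C' - B * b - C * e)" using s'(2) by (simp add: power2_eq_square algebra_simps)
    then have 2: "p dvd A * b\<^sup>2" using p by simp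
    have "p dvd A"
    proof (rule ccontr)
      assume "\<not> p dvd A"
      then have "p dvd a" "p dvd b" using 1 2 p(1) prime_dvd_mult_iff prime_dvd_power by blast+
      then have "p dvd gcd a (gcd b e)" using p by (intro gcd_greatest)
      then have "is_unit p" unfolding g .
      then show False using p(1) not_prime_unit by blast
    qed
    then show ?thesis by (simp add: q)
  qed
  have "p dvd coefA q1" "p dvd coefA q2" using key s1 s2 by blast+
  then have "p dvd N" using pairs_resultant[OF assms(1)] by (simp add: power2_eq_square)
  then have "is_unit p" using cop \<open>p dvd coefA q1\<close> coprime_common_divisor by blast
  then show False using p(1) not_prime_unit by blast
qed

text \<open>Column operations in \<open>Gamma\<close> bring the similitude of
  \<open>pairs_similar\<close> to triangular form; after division by its content the last entry is 1
  by \<open>triangular_similitude_unimodular\<close>, and a translation reduces b modulo a.\<close>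

lemma sublattice_pair_surjective:
  assumes p: "(q1, q2) \<in> pairs" and cop: "coprime (coefA q1) N" and p': "(q1', q2') \<in> pairs"
  obtains a \<beta> h where "(a, \<beta>) \<in> sublattices q1 q2" "h \<in> Gamma"
    "bqf_act h (sublattice_form (a, \<beta>) q1) = q1'" "bqf_act h (sublattice_form (a, \<beta>) q2) = q2'"
proof -
  obtain g where g: "mat_det g \<noteq> 0" "bqf_act g q1 = bqf_scale (mat_det g) q1'" "bqf_act g q2 = bqf_scale (mat_det g) q2'"
    using pairs_similar[OF p p'] .
  obtain ga gb gc gd where gc: "g = (ga, gb, gc, gd)" by (cases g)
  define \<gamma> where "\<gamma> = gcd gc gd"
  have \<gamma>: "\<gamma> > 0" using g(1) unfolding \<gamma>_def gc by auto
  obtain c' d' where cd: "gc = \<gamma> * c'" "gd = \<gamma> * d'" "coprime c' d'"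
    using gcd_coprime_exists[of gc gd] \<gamma> unfolding \<gamma>_def by (metis less_irrefl mult.commute)
  obtain x y where xy: "x * c' + y * d' = 1" using cd(3) bezout_int[of c' d'] by auto
  \<comment> \<open>Bezout coefficients complete the primitive part (c', d') of the bottom row to a
    matrix clearing the lower left entry.\<close>
  define h0 :: mat2 where "h0 = (d', x, - c', y)"
  have h0: "h0 \<in> Gamma" using xy by (simp add: h0_def Gamma_def algebra_simps)
  define a0 b0 where "a0 = ga * d' - gb * c'" and "b0 = ga * x + gb * y"
  have gh: "mat_mult g h0 = (a0, b0, 0, \<gamma>)"
  proof -
    have "\<gamma> * c' * x + \<gamma> * d' * y = \<gamma> * (x * c' + y * d')" by (simp add: algebra_simps)
    also have "\<dots> = \<gamma>" unfolding xy by simp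
    finally show ?thesis unfolding gc h0_def a0_def b0_def cd(1,2) by (simp add: algebra_simps)
  qed
  have detg: "mat_det g = a0 * \<gamma>"
  proof -
    have "mat_det (mat_mult g h0) = mat_det g" using h0 by (simp add: mat_det_mult Gamma_iff)
    then show ?thesis unfolding gh by simp
  qed
  then have a00: "a0 \<noteq> 0" using g(1) by auto
  define t where "t = gcd a0 (gcd b0 \<gamma>)"
  have t: "t > 0" using \<gamma> t_def by simp
  obtain a b e where abe: "a0 = t * a" "b0 = t * b" "\<gamma> = t * e"
    unfolding t_def by (meson dvdE dvd_trans gcd_dvd1 gcd_dvd2)
  have gcd1: "gcd a (gcd b e) = 1"
  proof -
    have "t * 1 = gcd a0 (gcd b0 \<gamma>)" by (simp add: t_def)
    also have "\<dots> = gcd (t * a) (gcd (t * b) (t * e))" by (simp only: abe[symmetric])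
    also have "\<dots> = t * gcd a (gcd b e)" using t by (simp add: gcd_mult_left abs_mult)
    finally show ?thesis using t by simp
  qed
  have e: "e > 0" using \<gamma> t abe(3) by (simp add: zero_less_mult_iff)
  have an0: "a \<noteq> 0" using a00 abe by auto
  have sim: "bqf_act (a, b, 0, e) q = bqf_scale (a * e) (bqf_act h0 q')"
    if "bqf_act g q = bqf_scale (mat_det g) q'" for q q'
  proof -
    have "bqf_scale (t\<^sup>2) (bqf_act (a, b, 0, e) q) = bqf_act (mat_mult g h0) q"
      unfolding gh abe by (cases q) (simp add: power2_eq_square algebra_simps)
    also have "\<dots> = bqf_scale (t\<^sup>2) (bqf_scale (a * e) (bqf_act h0 q'))"
      unfolding bqf_act_mult[symmetric] that bqf_act_scale detg bqf_scale_scale abe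
      by (simp add: power2_eq_square mult_ac)
    finally show ?thesis using bqf_scale_cancel[of "t\<^sup>2"] t by simp
  qed
  note s1 = sim[OF g(2)] and s2 = sim[OF g(3)]
  have e1: "e = 1" by (rule triangular_similitude_unimodular[OF p cop e gcd1 an0 s1 s2])
  have form: "a dvd bqf_eval q b 1 \<and> bqf_act h0 q' = sublattice_form (a, b) q"
    if s: "bqf_act (a, b, 0, e) q = bqf_scale (a * e) (bqf_act h0 q')" for q q'
  proof -
    obtain A B C A' B' C' where q: "q = BQF A B C" "bqf_act h0 q' = BQF A' B' C'"
      by (cases q; cases "bqf_act h0 q'")
    have "A * b\<^sup>2 + B * b + C = a * C'" using s e1 by (simp add: q)
    then have d: "a dvd bqf_eval q b 1" by (simp add: q)
    have "bqf_scale a (sublattice_form (a, b) q) = bqf_scale a (bqf_act h0 q')"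
      using s e1 bqf_act_sublattice[OF an0 d] by simp
    then show ?thesis using d bqf_scale_cancel[OF an0] by simp
  qed
  define \<beta> where "\<beta> = b mod \<bar>a\<bar>"
  define k where "k = (b - \<beta>) div a"
  have "\<bar>a\<bar> dvd b - \<beta>" unfolding \<beta>_def by (simp add: mod_eq_dvd_iff[symmetric])
  then have "a dvd b - \<beta>" by simp
  then have bk: "b = \<beta> + a * k" "\<beta> = b + a * (- k)" unfolding k_def by auto
  have \<beta>: "0 \<le> \<beta>" "\<beta> < \<bar>a\<bar>" unfolding \<beta>_def using an0 by simp_all
  have d: "a dvd bqf_eval q1 \<beta> 1" "a dvd bqf_eval q2 \<beta> 1"
    unfolding bk(2) using sublattice_form_translate(2)[OF an0] form[OF s1] form[OF s2] by blast+
  have kG: "(1, k, 0, 1) \<in> Gamma" by (simp add: Gamma_iff)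
  show thesis
  proof (rule that[of a \<beta> "mat_mult (1, k, 0, 1) (mat_adj h0)"])
    show "(a, \<beta>) \<in> sublattices q1 q2" using an0 \<beta> d by (simp add: sublattices_def)
    show "mat_mult (1, k, 0, 1) (mat_adj h0) \<in> Gamma" using kG h0 Gamma_adj Gamma_mult by blast
    have "bqf_act (mat_mult (1, k, 0, 1) (mat_adj h0)) (sublattice_form (a, \<beta>) q) = q'"
      if "a dvd bqf_eval q \<beta> 1" "bqf_act h0 q' = sublattice_form (a, b) q" for q q'
    proof -
      have "bqf_act (mat_mult (1, k, 0, 1) (mat_adj h0)) (sublattice_form (a, \<beta>) q) =
        bqf_act (mat_adj h0) (bqf_act (1, k, 0, 1) (sublattice_form (a, \<beta>) q))"
        by (simp only: bqf_act_mult)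
      also have "\<dots> = q'"
        unfolding sublattice_form_translate(1)[OF an0 that(1)] bk(1)[symmetric] that(2)[symmetric]
        by (rule Gamma_act_adj[OF h0])
      finally show ?thesis .
    qed
    then show "bqf_act (mat_mult (1, k, 0, 1) (mat_adj h0)) (sublattice_form (a, \<beta>) q1) = q1'"
      "bqf_act (mat_mult (1, k, 0, 1) (mat_adj h0)) (sublattice_form (a, \<beta>) q2) = q2'"
      using d form[OF s1] form[OF s2] by blast+
  qed
qed

lemma bij_betw_sublattices:
  assumes p: "(q1, q2) \<in> pairs" and cop: "coprime (coefA q1) N"
  shows "bij_betw (\<lambda>t. bqf_equiv2 `` {(sublattice_form t q1, sublattice_form t q2)}) (sublattices q1 q2) (pairs // bqf_equiv2)"
proof (rule bij_betw_quotient_transversal[OF equiv_bqf_equiv2])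
  show "(\<lambda>t. (sublattice_form t q1, sublattice_form t q2)) ` sublattices q1 q2 \<subseteq> pairs"
    using sublattice_pair[OF p] by (auto simp: sublattices_def)
next
  fix x assume "x \<in> pairs"
  then obtain q1' q2' where x: "x = (q1', q2')" "(q1', q2') \<in> pairs" by (cases x) auto
  obtain a \<beta> h where "(a, \<beta>) \<in> sublattices q1 q2" "h \<in> Gamma"
    "bqf_act h (sublattice_form (a, \<beta>) q1) = q1'" "bqf_act h (sublattice_form (a, \<beta>) q2) = q2'"
    using sublattice_pair_surjective[OF p cop x(2)] .
  then show "\<exists>t\<in>sublattices q1 q2. ((sublattice_form t q1, sublattice_form t q2), x) \<in> bqf_equiv2"
    unfolding x bqf_equiv2_iff by blast
next
  fix t t' assume t: "t \<in> sublattices q1 q2" "t' \<in> sublattices q1 q2"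
    and "((sublattice_form t q1, sublattice_form t q2), sublattice_form t' q1, sublattice_form t' q2) \<in> bqf_equiv2"
  then obtain h where "h \<in> Gamma" "bqf_act h (sublattice_form t q1) = sublattice_form t' q1"
    "bqf_act h (sublattice_form t q2) = sublattice_form t' q2" unfolding bqf_equiv2_iff by blast
  then show "t = t'" using sublattice_pair_injective[OF p] t by (cases t; cases t') blast
qed

lemma card_sublattices:
  assumes p: "(q1, q2) \<in> pairs"
  shows "finite (sublattices q1 q2)"
    and "card (sublattices q1 q2) = 2 * (\<Sum>m | m dvd nat N. card (common_roots q1 q2 m))"
proof -
  define S where "S = (SIGMA m:{m. m dvd nat N}. common_roots q1 q2 m)"
  have fin: "finite {m. m dvd nat N}" using N_pos by simp
  have m0: "m > 0" if "m dvd nat N" for m using that N_pos by (intro Nat.gr0I) auto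
  have finS: "finite S" unfolding S_def using fin by auto
  define f where "f = (\<lambda>(s::int, m, \<beta>::int). (s * int m, \<beta>))"
  have bij: "bij_betw f ({1, -1} \<times> S) (sublattices q1 q2)"
    unfolding bij_betw_def
  proof
    show "inj_on f ({1, -1} \<times> S)"
    proof (rule inj_onI)
      fix x y assume xy: "x \<in> {1, -1} \<times> S" "y \<in> {1, -1} \<times> S" "f x = f y"
      obtain s m \<beta> s' m' \<beta>' where e: "x = (s, m, \<beta>)" "y = (s', m', \<beta>')" by (cases x; cases y)
      have "m > 0" "m' > 0" using xy m0 by (auto simp: e S_def)
      moreover have "s = 1 \<or> s = -1" "s' = 1 \<or> s' = -1" "s * int m = s' * int m'" "\<beta> = \<beta>'"
        using xy by (auto simp: e f_def)
      ultimately show "x = y" unfolding e by auto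
    qed
    show "f ` ({1, -1} \<times> S) = sublattices q1 q2"
    proof
      show "f ` ({1, -1} \<times> S) \<subseteq> sublattices q1 q2"
        using m0 by (force simp: f_def S_def sublattices_def common_roots_def)
      show "sublattices q1 q2 \<subseteq> f ` ({1, -1} \<times> S)"
      proof
        fix t assume "t \<in> sublattices q1 q2"
        then obtain a \<beta> where t: "t = (a, \<beta>)" "a \<noteq> 0" "0 \<le> \<beta>" "\<beta> < \<bar>a\<bar>" "a dvd bqf_eval q1 \<beta> 1" "a dvd bqf_eval q2 \<beta> 1"
          by (auto simp: sublattices_def)
        have "a dvd N" using common_root_dvd_N[OF p t(5,6)] .
        then have "nat \<bar>a\<bar> dvd nat N" using N_pos by (simp add: nat_abs_dvd_iff)
        then have "(nat \<bar>a\<bar>, \<beta>) \<in> S" using t by (simp add: S_def common_roots_def)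
        then have "(sgn a, nat \<bar>a\<bar>, \<beta>) \<in> {1, -1} \<times> S" using t(2) by (auto simp: sgn_if)
        moreover have "t = f (sgn a, nat \<bar>a\<bar>, \<beta>)" using t(2) by (simp add: f_def t(1) sgn_if)
        ultimately show "t \<in> f ` ({1, -1} \<times> S)" by blast
      qed
    qed
  qed
  show "finite (sublattices q1 q2)" using bij_betw_finite[OF bij] finS by simp
  have "card (sublattices q1 q2) = card ({1, -1 :: int} \<times> S)" using bij_betw_same_card[OF bij] by simp
  also have "\<dots> = 2 * card S" by (simp add: card_cartesian_product)
  also have "card S = (\<Sum>m | m dvd nat N. card (common_roots q1 q2 m))"
    unfolding S_def using fin by (simp add: card_SigmaI)
  finally show "card (sublattices q1 q2) = 2 * (\<Sum>m | m dvd nat N. card (common_roots q1 q2 m))" .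
qed

end

section \<open>Multiplicativity and norms\<close>

lemma sum_divisors_coprime_mult:
  fixes f :: "nat \<Rightarrow> int"
  assumes ab: "coprime a b" "a > 0" "b > 0"
    and f: "\<And>c d. coprime c d \<Longrightarrow> c > 0 \<Longrightarrow> d > 0 \<Longrightarrow> f (c * d) = f c * f d"
  shows "(\<Sum>d | d dvd a * b. f d) = (\<Sum>d | d dvd a. f d) * (\<Sum>d | d dvd b. f d)"
proof -
  have pos: "d > 0" if "d dvd c" "c > 0" for c d :: nat using that by (intro Nat.gr0I) auto
  have "bij_betw (\<lambda>(c, d). c * d) ({c. c dvd a} \<times> {d. d dvd b}) {d. d dvd a * b}"
    unfolding bij_betw_def
  proof
    show "inj_on (\<lambda>(c, d). c * d) ({c. c dvd a} \<times> {d. d dvd b})"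
    proof (rule inj_onI, clarify)
      fix c d c' d' assume cd: "c dvd a" "d dvd b" "c' dvd a" "d' dvd b" and e: "c * d = c' * d'"
      have "coprime c d'" "coprime c' d" using cd ab(1) coprime_divisors by blast+
      then have "c dvd c'" "c' dvd c" using e
        by (metis coprime_dvd_mult_left_iff dvd_triv_left)+
      then have "c = c'" by (rule dvd_antisym)
      moreover have "c > 0" using pos[OF cd(1) ab(2)] .
      ultimately show "c = c' \<and> d = d'" using e by simp
    qed
    show "(\<lambda>(c, d). c * d) ` ({c. c dvd a} \<times> {d. d dvd b}) = {d. d dvd a * b}"
    proof
      show "(\<lambda>(c, d). c * d) ` ({c. c dvd a} \<times> {d. d dvd b}) \<subseteq> {d. d dvd a * b}"
        by (auto intro: mult_dvd_mono)
      show "{d. d dvd a * b} \<subseteq> (\<lambda>(c, d). c * d) ` ({c. c dvd a} \<times> {d. d dvd b})"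
      proof
        fix d assume "d \<in> {d. d dvd a * b}"
        then obtain x y where "d = x * y" "x dvd a" "y dvd b" using division_decomp[of d a b] by auto
        then show "d \<in> (\<lambda>(c, d). c * d) ` ({c. c dvd a} \<times> {d. d dvd b})" by force
      qed
    qed
  qed
  then have "(\<Sum>d | d dvd a * b. f d) = (\<Sum>x\<in>{c. c dvd a} \<times> {d. d dvd b}. f (case x of (c, d) \<Rightarrow> c * d))"
    by (rule sum.reindex_bij_betw[symmetric])
  also have "\<dots> = (\<Sum>x\<in>{c. c dvd a} \<times> {d. d dvd b}. case x of (c, d) \<Rightarrow> f c * f d)"
  proof (rule sum.cong[OF refl])
    fix x assume x: "x \<in> {c. c dvd a} \<times> {d. d dvd b}"
    obtain c d where cd: "x = (c, d)" by (cases x)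
    have "coprime c d" using x ab(1) coprime_divisors unfolding cd by blast
    then show "f (case x of (c, d) \<Rightarrow> c * d) = (case x of (c, d) \<Rightarrow> f c * f d)"
      using x pos[of c a] pos[of d b] ab by (simp add: cd f)
  qed
  also have "\<dots> = (\<Sum>d | d dvd a. f d) * (\<Sum>d | d dvd b. f d)"
    by (simp add: sum_product sum.cartesian_product)
  finally show ?thesis .
qed

lemma sum_divisors_prime_power:
  fixes f :: "nat \<Rightarrow> int" and p :: nat
  assumes "prime p"
  shows "(\<Sum>d | d dvd p ^ k. f d) = (\<Sum>j\<le>k. f (p ^ j))"
proof -
  have "{d. d dvd p ^ k} = (\<lambda>j. p ^ j) ` {..k}"
    using divides_primepow_nat[OF assms] by auto
  moreover have "inj_on (\<lambda>j. p ^ j) {..k}"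
    using prime_gt_1_nat[OF assms] by (auto intro!: inj_onI)
  ultimately show ?thesis by (simp add: sum.reindex)
qed

text \<open>Applied both to the number of common roots and to \<open>eps\<close>, so that the two
  divisor sums can be compared prime by prime.\<close>

lemma sum_divisors_eq_prod:
  fixes f :: "nat \<Rightarrow> int"
  assumes f: "\<And>c d. coprime c d \<Longrightarrow> c > 0 \<Longrightarrow> d > 0 \<Longrightarrow> f (c * d) = f c * f d" "f 1 = 1" and "M > 0"
  shows "(\<Sum>d | d dvd M. f d) = (\<Prod>p\<in>prime_factors M. \<Sum>j\<le>multiplicity p M. f (p ^ j))"
  using assms(3)
proof (induction M rule: less_induct)
  case (less M)
  show ?case
  proof (cases "M = 1")
    case True
    have "{d. d dvd (1::nat)} = {1}" by auto
    then show ?thesis using f(2) True by simp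
  next
    case False
    then obtain p where p: "prime p" "p dvd M" using prime_factor_nat by blast
    define k where "k = multiplicity p M"
    have "\<not> is_unit p" using p(1) by auto
    then obtain M' where M': "M = p ^ k * M'" "\<not> p dvd M'"
      using multiplicity_decompose'[of M p] less.prems unfolding k_def by auto
    have k0: "k > 0" using p less.prems by (simp add: k_def prime_multiplicity_gt_zero_iff)
    have M'0: "M' > 0" using less.prems M' by (cases M') auto
    have p1: "p > 1" using prime_gt_1_nat[OF p(1)] .
    have lt: "M' < M" using M'(1) M'0 one_less_power[OF p1 k0] by simp
    have cop: "coprime (p ^ k) M'" using p(1) M'(2) by (simp add: prime_imp_coprime)
    have pf: "prime_factors M = insert p (prime_factors M')"
      using M'0 p(1) k0 less.prems unfolding M'(1)
      by (simp add: prime_factors_product prime_factorization_prime_power)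
    have pn: "p \<notin> prime_factors M'" using M'(2) by auto
    have mult: "multiplicity r M = multiplicity r M'" if "r \<in> prime_factors M'" for r
    proof -
      have r: "prime r" "r \<noteq> p" using that pn by auto
      then have "multiplicity r (p ^ k) = 0"
        using p(1) by (metis not_dvd_imp_multiplicity_0 prime_dvd_power primes_dvd_imp_eq)
      then show ?thesis
        unfolding M'(1) using r M'0 p1 by (subst prime_elem_multiplicity_mult_distrib) auto
    qed
    have "(\<Sum>d | d dvd M. f d) = (\<Sum>d | d dvd p ^ k. f d) * (\<Sum>d | d dvd M'. f d)"
      unfolding M'(1) using cop p1 M'0 f by (intro sum_divisors_coprime_mult) auto
    also have "\<dots> = (\<Sum>j\<le>k. f (p ^ j)) * (\<Prod>p\<in>prime_factors M'. \<Sum>j\<le>multiplicity p M'. f (p ^ j))"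
      unfolding sum_divisors_prime_power[OF p(1)] less.IH[OF lt M'0] ..
    also have "(\<Prod>p\<in>prime_factors M'. \<Sum>j\<le>multiplicity p M'. f (p ^ j)) = (\<Prod>p\<in>prime_factors M'. \<Sum>j\<le>multiplicity p M. f (p ^ j))"
      by (intro prod.cong refl) (simp add: mult)
    finally show ?thesis unfolding pf using pn by (simp add: k_def)
  qed
qed

lemma eps_mult: "c > 0 \<Longrightarrow> d > 0 \<Longrightarrow> eps D1 D2 (c * d) = eps D1 D2 c * eps D1 D2 d"
  by (simp add: eps_def prime_factorization_mult)

lemma eps_one: "eps D1 D2 1 = 1"
  by (simp add: eps_def)

lemma eps_prime_power: "prime p \<Longrightarrow> eps D1 D2 (p ^ j) = eps_prime D1 D2 p ^ j"
  by (simp add: eps_def prime_factorization_prime_power)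

section \<open>Common roots modulo coprime moduli\<close>

lemma bqf_eval_cong:
  assumes "m dvd \<beta> - \<beta>'"
  shows "m dvd bqf_eval q \<beta> 1 \<longleftrightarrow> m dvd bqf_eval q \<beta>' 1"
proof -
  obtain A B C where q: "q = BQF A B C" by (cases q)
  have "bqf_eval q \<beta> 1 = bqf_eval q \<beta>' 1 + (\<beta> - \<beta>') * (A * (\<beta> + \<beta>') + B)"
    unfolding q by (simp add: power2_eq_square algebra_simps)
  then show ?thesis using assms by (metis dvd_add_left_iff dvd_mult2)
qed

lemma card_common_roots_mult:
  assumes "coprime m n" "m > 0" "n > 0"
  shows "card (common_roots q1 q2 (m * n)) = card (common_roots q1 q2 m) * card (common_roots q1 q2 n)"
proof -
  have cop: "coprime (int m) (int n)" using assms(1) by simp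
  have "bij_betw (\<lambda>\<beta>. (\<beta> mod int m, \<beta> mod int n)) (common_roots q1 q2 (m * n)) (common_roots q1 q2 m \<times> common_roots q1 q2 n)"
    unfolding bij_betw_def
  proof
    show "inj_on (\<lambda>\<beta>. (\<beta> mod int m, \<beta> mod int n)) (common_roots q1 q2 (m * n))"
    proof (rule inj_onI)
      fix \<beta> \<beta>' assume b: "\<beta> \<in> common_roots q1 q2 (m * n)" "\<beta>' \<in> common_roots q1 q2 (m * n)"
        and "(\<beta> mod int m, \<beta> mod int n) = (\<beta>' mod int m, \<beta>' mod int n)"
      then have "int m dvd \<beta> - \<beta>'" "int n dvd \<beta> - \<beta>'" by (simp_all add: mod_eq_dvd_iff)
      then have "int m * int n dvd \<beta> - \<beta>'" using cop by (simp add: divides_mult)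
      then have "\<beta> mod int (m * n) = \<beta>' mod int (m * n)" by (simp add: mod_eq_dvd_iff)
      then show "\<beta> = \<beta>'" using b by (simp add: common_roots_def)
    qed
    show "(\<lambda>\<beta>. (\<beta> mod int m, \<beta> mod int n)) ` common_roots q1 q2 (m * n) = common_roots q1 q2 m \<times> common_roots q1 q2 n"
    proof
      have "\<beta> mod int k \<in> common_roots q1 q2 k" if "\<beta> \<in> common_roots q1 q2 (m * n)" "k = m \<or> k = n" for \<beta> k
      proof -
        have k: "k > 0" "int k dvd int (m * n)" using that(2) assms by auto
        have "int k dvd \<beta> mod int k - \<beta>" by (simp add: mod_eq_dvd_iff[symmetric])
        note c = bqf_eval_cong[OF this]
        have "int (m * n) dvd bqf_eval q1 \<beta> 1" "int (m * n) dvd bqf_eval q2 \<beta> 1" using that by (simp_all add: common_roots_def)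
        then have "int k dvd bqf_eval q1 \<beta> 1" "int k dvd bqf_eval q2 \<beta> 1" using k(2) dvd_trans by blast+
        then show ?thesis using c k by (simp add: common_roots_def)
      qed
      then show "(\<lambda>\<beta>. (\<beta> mod int m, \<beta> mod int n)) ` common_roots q1 q2 (m * n) \<subseteq> common_roots q1 q2 m \<times> common_roots q1 q2 n"
        by blast
      show "common_roots q1 q2 m \<times> common_roots q1 q2 n \<subseteq> (\<lambda>\<beta>. (\<beta> mod int m, \<beta> mod int n)) ` common_roots q1 q2 (m * n)"
      proof clarify
        fix u v assume u: "u \<in> common_roots q1 q2 m" and v: "v \<in> common_roots q1 q2 n"
        obtain x where x: "[x = u] (mod int m)" "[x = v] (mod int n)"
          using binary_chinese_remainder_int[OF cop] by blast
        define y where "y = x mod (int m * int n)"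
        have yx: "int m * int n dvd y - x" unfolding y_def by (simp add: mod_eq_dvd_iff[symmetric])
        have "int m dvd y - u"
        proof -
          have "int m dvd (y - x) + (x - u)" using yx x(1) by (intro dvd_add) (auto simp: cong_iff_dvd_diff dvd_mult_left)
          then show ?thesis by simp
        qed
        moreover have "int n dvd y - v"
        proof -
          have "int n dvd (y - x) + (x - v)" using yx x(2) by (intro dvd_add) (auto simp: cong_iff_dvd_diff dvd_mult_right)
          then show ?thesis by simp
        qed
        ultimately have yu: "int m dvd y - u" "int n dvd y - v" by auto
        have "int m * int n dvd bqf_eval q y 1"
          if "int m dvd bqf_eval q u 1" "int n dvd bqf_eval q v 1" for q
          using that bqf_eval_cong[OF yu(1), of q] bqf_eval_cong[OF yu(2), of q] cop by (simp add: divides_mult)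
        moreover have "0 \<le> y" "y < int m * int n" using assms by (simp_all add: y_def)
        ultimately have "y \<in> common_roots q1 q2 (m * n)" using u v by (simp add: common_roots_def)
        moreover have "y mod int m = u" "y mod int n = v"
          using yu u v by (simp_all add: mod_eq_dvd_iff[symmetric] common_roots_def)
        ultimately show "(u, v) \<in> (\<lambda>\<beta>. (\<beta> mod int m, \<beta> mod int n)) ` common_roots q1 q2 (m * n)"
          by (intro image_eqI[of _ _ y]) auto
      qed
    qed
  qed
  then show ?thesis by (simp add: bij_betw_same_card card_cartesian_product)
qed

lemma card_common_roots_one: "card (common_roots q1 q2 1) = 1"
proof -
  have "common_roots q1 q2 1 = {0}" by (auto simp: common_roots_def)
  then show ?thesis by simp
qed

lemma multiplicity_nat_int:
  assumes "N > 0" "prime p"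
  shows "multiplicity p (nat N) = multiplicity (int p) N"
proof (rule multiplicity_eqI)
  have dv: "m dvd nat N \<longleftrightarrow> int m dvd N" for m
    using assms int_dvd_int_iff[of m "nat N"] by simp
  show "p ^ multiplicity (int p) N dvd nat N" unfolding dv by (simp add: multiplicity_dvd)
  have "\<not> is_unit (int p)" "N \<noteq> 0" using assms by auto
  then have "\<not> int p ^ Suc (multiplicity (int p) N) dvd N" by (subst power_dvd_iff_le_multiplicity) auto
  then show "\<not> p ^ Suc (multiplicity (int p) N) dvd nat N" unfolding dv by simp
qed

lemma sum_prime_power_divides:
  fixes e p :: int
  assumes "e \<noteq> 0" "prime p" "multiplicity p e \<le> k"
  shows "card {j\<in>{1..k}. p ^ j dvd e} = multiplicity p e"
proof -
  have "\<not> is_unit p" using assms(2) not_prime_unit by blast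
  then have dv: "p ^ j dvd e \<longleftrightarrow> j \<le> multiplicity p e" for j
    by (rule power_dvd_iff_le_multiplicity[OF assms(1)])
  have "{j\<in>{1..k}. p ^ j dvd e} = {1..multiplicity p e}"
    unfolding dv using assms(3) by auto
  then show ?thesis by simp
qed

text \<open>A root modulo p makes D the square of 2 A \<beta> + B. At p = 2 this says nothing;
  instead B is odd, a root forces A C to be even, and D = B^2 - 4 A C is 1 modulo 8.\<close>

lemma root_imp_kronecker_one:
  assumes p: "prime p" and nd: "\<not> int p dvd bqf_disc q" and r: "int p dvd bqf_eval q \<beta> 1"
  shows "kronecker_prime (bqf_disc q) p = 1"
proof -
  obtain A B C where q: "q = BQF A B C" by (cases q)
  have id: "bqf_disc q = (2 * A * \<beta> + B)\<^sup>2 - 4 * A * bqf_eval q \<beta> 1"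
    unfolding q bqf_disc_def by (simp add: power2_eq_square algebra_simps)
  show ?thesis
  proof (cases "p = 2")
    case True
    have oD: "odd (bqf_disc q)" using nd True by simp
    have "odd B" using oD unfolding q bqf_disc_def by simp
    have ev: "even (A * \<beta>\<^sup>2 + B * \<beta> + C)" using r True by (simp add: q)
    have "even (A * C)"
    proof (rule ccontr)
      assume "odd (A * C)"
      then have "odd A" "odd C" by auto
      then show False using ev \<open>odd B\<close> by (cases "even \<beta>") auto
    qed
    then obtain k where k: "A * C = 2 * k" by (rule evenE)
    have "B\<^sup>2 mod 8 = 1" using odd_square_mod_8[OF \<open>odd B\<close>] .
    moreover have "bqf_disc q = B\<^sup>2 - 8 * k" using k unfolding q bqf_disc_def by simp
    ultimately have "bqf_disc q mod 8 = 1" by presburger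
    then show ?thesis using True oD by (simp add: kronecker_prime_def)
  next
    case False
    have "int p dvd (2 * A * \<beta> + B)\<^sup>2 - bqf_disc q" unfolding id using r by simp
    then have "QuadRes (int p) (bqf_disc q)" unfolding QuadRes_def cong_iff_dvd_diff by blast
    then show ?thesis using nd False by (simp add: kronecker_prime_def Legendre_def cong_0_iff)
  qed
qed

text \<open>At an inert prime a norm divisible by p has both coordinates divisible by p, so p^2 can
  be split off. The exception is p = 2 with x and u odd, because Z[sqrt D] is not maximal at 2;
  there the exponent is exactly 2.\<close>

lemma norm_multiplicity_even:
  assumes p: "prime p" and D4: "D mod 4 = 0 \<or> D mod 4 = 1" and k: "kronecker_prime D p = -1"
    and W: "x\<^sup>2 - D * u\<^sup>2 \<noteq> 0"
  shows "even (multiplicity (int p) (x\<^sup>2 - D * u\<^sup>2))"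
  using W
proof (induction "nat \<bar>x\<^sup>2 - D * u\<^sup>2\<bar>" arbitrary: x u rule: less_induct)
  case less
  have pp: "prime (int p)" using p by simp
  have p1: "int p > 1" using prime_gt_1_int[OF pp] .
  have desc: ?case if dv: "int p dvd x" "int p dvd u"
  proof -
    obtain x' u' where xu: "x = int p * x'" "u = int p * u'" using dv by (auto elim!: dvdE)
    have W: "x\<^sup>2 - D * u\<^sup>2 = (int p)\<^sup>2 * (x'\<^sup>2 - D * u'\<^sup>2)"
      unfolding xu by (simp add: power2_eq_square algebra_simps)
    have nz: "x'\<^sup>2 - D * u'\<^sup>2 \<noteq> 0" using less.prems W by auto
    have "\<bar>x'\<^sup>2 - D * u'\<^sup>2\<bar> < \<bar>x\<^sup>2 - D * u\<^sup>2\<bar>"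
      unfolding W abs_mult using nz one_less_power[OF p1, of 2] by simp
    then have "even (multiplicity (int p) (x'\<^sup>2 - D * u'\<^sup>2))" using nz by (intro less.hyps) auto
    moreover have "multiplicity (int p) (x\<^sup>2 - D * u\<^sup>2) = 2 + multiplicity (int p) (x'\<^sup>2 - D * u'\<^sup>2)"
      unfolding W using pp nz p1 by (subst prime_elem_multiplicity_mult_distrib) auto
    ultimately show ?thesis by simp
  qed
  show ?case
  proof (cases "int p dvd x\<^sup>2 - D * u\<^sup>2")
    case False
    then show ?thesis by (simp add: not_dvd_imp_multiplicity_0)
  next
    case dvd: True
    show ?thesis
    proof (cases "p = 2")
      case False
      have L: "\<not> QuadRes (int p) D" using k False by (auto simp: kronecker_prime_def Legendre_def split: if_splits)
      have "int p dvd u"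
      proof (rule ccontr)
        assume "\<not> int p dvd u"
        then have "coprime u (int p)" using pp by (metis coprime_commute prime_imp_coprime)
        then obtain z where z: "[u * z = 1] (mod (int p))" using cong_solve_coprime_int by blast
        have "[(x * z)\<^sup>2 = x\<^sup>2 * z\<^sup>2] (mod (int p))" by (simp add: power_mult_distrib)
        also have "[x\<^sup>2 * z\<^sup>2 = D * u\<^sup>2 * z\<^sup>2] (mod (int p))"
          using dvd by (intro cong_scalar_right) (simp add: cong_iff_dvd_diff)
        also have "D * u\<^sup>2 * z\<^sup>2 = D * (u * z)\<^sup>2" by (simp add: power_mult_distrib)
        also have "[D * (u * z)\<^sup>2 = D * 1\<^sup>2] (mod (int p))" by (intro cong_scalar_left cong_pow z)
        finally show False using L unfolding QuadRes_def by auto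
      qed
      moreover have "int p dvd x\<^sup>2"
      proof -
        have "int p dvd u\<^sup>2" using \<open>int p dvd u\<close> by (simp add: power2_eq_square)
        then have "int p dvd (x\<^sup>2 - D * u\<^sup>2) + D * u\<^sup>2" using dvd by (intro dvd_add) auto
        then show ?thesis by simp
      qed
      then have "int p dvd x" using pp prime_dvd_power by blast
      ultimately show ?thesis using desc by blast
    next
      case True
      have "D mod 8 \<noteq> 1" "odd D" using k True by (auto simp: kronecker_prime_def split: if_splits)
      then have D8: "D mod 8 = 5" using D4 by presburger
      have par: "even x \<longleftrightarrow> even u" using dvd True \<open>odd D\<close> by auto
      show ?thesis
      proof (cases "even u")
        case True
        then show ?thesis using par desc \<open>p = 2\<close> by simp
      next
        case False
        have "x\<^sup>2 = 8 * (x\<^sup>2 div 8) + 1" "u\<^sup>2 = 8 * (u\<^sup>2 div 8) + 1" "D = 8 * (D div 8) + 5"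
          using odd_square_mod_8[of x] odd_square_mod_8[of u] par False D8 by presburger+
        then obtain i j l where e: "x\<^sup>2 = 8 * i + 1" "u\<^sup>2 = 8 * j + 1" "D = 8 * l + 5" by blast
        have w: "x\<^sup>2 - D * u\<^sup>2 = 4 * (2 * (i - 8 * l * j - l - 5 * j) - 1)"
          unfolding e by (simp add: algebra_simps)
        have "multiplicity (int p) (x\<^sup>2 - D * u\<^sup>2) = 2"
        proof (rule multiplicity_eqI)
          show "int p ^ 2 dvd x\<^sup>2 - D * u\<^sup>2" unfolding w \<open>p = 2\<close> by simp
          have "\<not> 4 * 2 dvd 4 * (2 * (i - 8 * l * j - l - 5 * j) - 1)"
            unfolding dvd_mult_cancel_left by simp
          then show "\<not> int p ^ Suc 2 dvd x\<^sup>2 - D * u\<^sup>2" unfolding w \<open>p = 2\<close> by simp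
        qed
        then show ?thesis by simp
      qed
    qed
  qed
qed

section \<open>Local counts\<close>

context disc_pair
begin

text \<open>The resultant is A^2 times the product of the values of q2 at the two roots of q1.
  Modulo q1(\<beta>) the second root can be eliminated, and only \<beta> remains.\<close>

lemma pairs_key_identity:
  assumes p: "(q1, q2) \<in> pairs"
  shows "bqf_eval q1 \<beta> 1 dvd N - bqf_eval q2 \<beta> 1 *
    ((coefA q1 * coefB q2 - coefA q2 * coefB q1) * (2 * coefA q1 * \<beta> + coefB q1) - (coefA q1)\<^sup>2 * bqf_eval q2 \<beta> 1)"
proof -
  obtain A B C a b c where q: "q1 = BQF A B C" "q2 = BQF a b c" by (cases q1; cases q2)
  define u where "u = A * b - a * B"
  define e1 e2 where "e1 = bqf_eval q1 \<beta> 1" and "e2 = bqf_eval q2 \<beta> 1"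
  have "N = u * (B * c - b * C) - (A * c - a * C)\<^sup>2"
    using pairs_resultant[OF p] by (simp add: q u_def)
  also have "\<dots> = e2 * (u * (2 * A * \<beta> + B) - A\<^sup>2 * e2) + e1 * (2 * a * A * e2 - u * b - a\<^sup>2 * e1 - 2 * a * u * \<beta>)"
    unfolding u_def e1_def e2_def q by (simp add: power2_eq_square algebra_simps)
  finally have "N - e2 * (u * (2 * A * \<beta> + B) - A\<^sup>2 * e2) = e1 * (2 * a * A * e2 - u * b - a\<^sup>2 * e1 - 2 * a * u * \<beta>)"
    by simp
  then show ?thesis unfolding e1_def e2_def u_def q by simp
qed

text \<open>Modulo a prime dividing its discriminant q has the double root -B / (2 A). At p = 2, A
  is odd and B is even, so q(x, 1) is x + C with root C.\<close>

lemma ramified_unique_root: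
  assumes q: "bqf_disc q = D1" and p: "prime p" "int p dvd D1" and A: "\<not> int p dvd coefA q"
  obtains \<beta> where "0 \<le> \<beta>" "\<beta> < int p" "int p dvd 2 * coefA q * \<beta> + coefB q"
    "\<And>x. int p dvd bqf_eval q x 1 \<longleftrightarrow> int p dvd x - \<beta>"
proof -
  obtain A B C where qc: "q = BQF A B C" by (cases q)
  have D: "D1 = B\<^sup>2 - 4 * A * C" using q by (simp add: qc bqf_disc_def)
  have pp: "prime (int p)" using p by simp
  have nA: "\<not> int p dvd A" using A by (simp add: qc)
  have "\<exists>\<beta>. int p dvd 2 * A * \<beta> + B \<and> (\<forall>x. int p dvd bqf_eval q x 1 \<longleftrightarrow> int p dvd x - \<beta>)"
  proof (cases "p = 2")
    case True
    have "even B" using p(2) True unfolding D by simp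
    then have "even (A * x\<^sup>2 + B * x + C) \<longleftrightarrow> even (x - C)" for x using nA True by auto
    then show ?thesis using True \<open>even B\<close> by (intro exI[of _ C]) (simp add: qc)
  next
    case False
    have "\<not> int p dvd 2" using p(1) False primes_dvd_imp_eq[of p 2] by (metis int_dvd_int_iff of_nat_numeral two_is_prime_nat)
    then have "coprime (2 * A) (int p)" using nA pp by (metis coprime_commute prime_dvd_mult_iff prime_imp_coprime)
    then obtain \<beta> where b: "int p dvd 2 * A * \<beta> - (- B)" using linear_cong_solvable by metis
    have "int p dvd bqf_eval q x 1 \<longleftrightarrow> int p dvd x - \<beta>" for x
    proof -
      have id: "(2 * A * x + B)\<^sup>2 = 4 * A * bqf_eval q x 1 + D1" unfolding qc D by (simp add: power2_eq_square algebra_simps)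
      have "\<not> int p dvd 4 * A"
      proof
        assume "int p dvd 4 * A"
        then have "int p dvd 2 * (2 * A)" by simp
        then show False using \<open>\<not> int p dvd 2\<close> nA pp prime_dvd_mult_iff by blast
      qed
      then have "int p dvd bqf_eval q x 1 \<longleftrightarrow> int p dvd 4 * A * bqf_eval q x 1" using pp prime_dvd_mult_iff by blast
      also have "\<dots> \<longleftrightarrow> int p dvd (2 * A * x + B)\<^sup>2" unfolding id using p(2) dvd_add_left_iff by blast
      also have "\<dots> \<longleftrightarrow> int p dvd 2 * A * x + B" using pp prime_dvd_power_iff by (metis zero_less_numeral)
      also have "2 * A * x + B = 2 * A * (x - \<beta>) + (2 * A * \<beta> - (- B))" by (simp add: algebra_simps)
      also have "int p dvd \<dots> \<longleftrightarrow> int p dvd 2 * A * (x - \<beta>)" using b dvd_add_left_iff by blast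
      also have "\<dots> \<longleftrightarrow> int p dvd x - \<beta>" using \<open>coprime (2 * A) (int p)\<close> by (simp only: coprime_commute coprime_dvd_mult_right_iff)
      finally show ?thesis .
    qed
    then show ?thesis using b by auto
  qed
  then obtain \<beta> where b: "int p dvd 2 * A * \<beta> + B" "\<And>x. int p dvd bqf_eval q x 1 \<longleftrightarrow> int p dvd x - \<beta>" by blast
  define \<beta>' where "\<beta>' = \<beta> mod int p"
  have d: "int p dvd \<beta> - \<beta>'" unfolding \<beta>'_def by (simp add: mod_eq_dvd_iff[symmetric])
  show thesis
  proof (rule that[of \<beta>'])
    show "0 \<le> \<beta>'" "\<beta>' < int p" unfolding \<beta>'_def using prime_gt_0_int[OF pp] by simp_all
    have "int p dvd (2 * A * \<beta> + B) - 2 * A * (\<beta> - \<beta>')" using b(1) d by (intro dvd_diff) auto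
    then show "int p dvd 2 * coefA q * \<beta>' + coefB q" by (simp add: qc algebra_simps)
    fix x
    have "x - \<beta>' = (x - \<beta>) + (\<beta> - \<beta>')" by simp
    then show "int p dvd bqf_eval q x 1 \<longleftrightarrow> int p dvd x - \<beta>'" unfolding b(2) using d dvd_add_left_iff by metis
  qed
qed

context
  fixes q1 q2 p k
  assumes pr: "(q1, q2) \<in> pairs" and cop: "coprime (coefA q1) N"
    and p: "prime p" "int p dvd N" and k: "k = multiplicity (int p) N"
begin

lemma prime_int_p: "prime (int p)" using p by simp

lemma leading_not_dvd: "\<not> int p dvd coefA q1"
  using coprime_common_divisor[OF cop _ p(2)] prime_int_p not_prime_unit by blast

text \<open>Here k = 1. At the double root the slope 2 A \<beta> + B vanishes, so
  \<open>pairs_key_identity\<close> says that N is minus the square of A q2(\<beta>) modulo p, and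
  \<beta> is a root of q2 too. That gives D2 the symbol 1, and both sums are 2.\<close>

lemma local_count_ramified:
  assumes d: "int p dvd D1"
  shows "(\<Sum>j\<le>k. int (card (common_roots q1 q2 (p ^ j)))) = (\<Sum>j\<le>k. eps_prime D1 D2 p ^ j)"
proof -
  have q: "bqf_disc q1 = D1" "bqf_disc q2 = D2" using pr by (simp_all add: pairs_def)
  obtain \<beta> where b: "0 \<le> \<beta>" "\<beta> < int p" "int p dvd 2 * coefA q1 * \<beta> + coefB q1"
    and roots: "\<And>x. int p dvd bqf_eval q1 x 1 \<longleftrightarrow> int p dvd x - \<beta>"
    by (rule ramified_unique_root[OF q(1) p(1) d leading_not_dvd]) (rule that)
  define e where "e = bqf_eval q2 \<beta> 1"
  have "int p dvd bqf_eval q1 \<beta> 1" using roots by simp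
  then have d1: "int p dvd N - e * ((coefA q1 * coefB q2 - coefA q2 * coefB q1) * (2 * coefA q1 * \<beta> + coefB q1) - (coefA q1)\<^sup>2 * e)"
    using pairs_key_identity[OF pr, of \<beta>] dvd_trans unfolding e_def by blast
  have d2: "int p dvd e * ((coefA q1 * coefB q2 - coefA q2 * coefB q1) * (2 * coefA q1 * \<beta> + coefB q1))"
    using b(3) by simp
  have "int p dvd (N - e * ((coefA q1 * coefB q2 - coefA q2 * coefB q1) * (2 * coefA q1 * \<beta> + coefB q1) - (coefA q1)\<^sup>2 * e))
     - N + e * ((coefA q1 * coefB q2 - coefA q2 * coefB q1) * (2 * coefA q1 * \<beta> + coefB q1))"
    by (rule dvd_add[OF dvd_diff[OF d1 p(2)] d2])
  then have "int p dvd (coefA q1 * e)\<^sup>2" by (simp add: power2_eq_square algebra_simps)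
  then have "int p dvd coefA q1 * e" using prime_int_p prime_dvd_power by blast
  then have pe: "int p dvd e" using leading_not_dvd prime_int_p prime_dvd_mult_iff by blast
  have nd: "\<not> int p dvd D2" using not_dvd_both[OF p(1) d] .
  have "eps_prime D1 D2 p = kronecker_prime D2 p"
    using disc_pair.eps_prime_eq[OF swap p nd] eps_prime_swap by simp
  also have "\<dots> = 1" using root_imp_kronecker_one[OF p(1), of q2 \<beta>] pe nd unfolding q e_def by blast
  finally have eps: "eps_prime D1 D2 p = 1" .
  have k1: "k = 1"
    unfolding k using p(2) not_square_dvd_N[OF p(1) d] by (intro multiplicity_eqI) (simp_all add: numeral_2_eq_2)
  have "common_roots q1 q2 p = {\<beta>}"
  proof
    show "{\<beta>} \<subseteq> common_roots q1 q2 p" using b pe roots by (simp add: common_roots_def e_def)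
    show "common_roots q1 q2 p \<subseteq> {\<beta>}"
    proof
      fix x assume x: "x \<in> common_roots q1 q2 p"
      then have "int p dvd x - \<beta>" using roots by (simp add: common_roots_def)
      then have "x mod int p = \<beta> mod int p" by (simp add: mod_eq_dvd_iff)
      then show "x \<in> {\<beta>}" using x b by (simp add: common_roots_def)
    qed
  qed
  then show ?thesis by (simp add: k1 eps card_common_roots_one[simplified])
qed

text \<open>A root of q1 modulo p would make the symbol 1, so only the modulus 1 contributes. That k
  is even follows from -4 N A^2 being a norm from Z[sqrt D1]; the alternating sum on the other side
  is then 1 as well.\<close>

lemma local_count_inert:
  assumes nd: "\<not> int p dvd D1" and inert: "kronecker_prime D1 p = -1"
  shows "(\<Sum>j\<le>k. int (card (common_roots q1 q2 (p ^ j)))) = 1" and "even k"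
proof -
  have q: "bqf_disc q1 = D1" "bqf_disc q2 = D2" using pr by (simp_all add: pairs_def)
  have "common_roots q1 q2 (p ^ j) = {}" if "j > 0" for j
  proof (rule ccontr)
    assume "common_roots q1 q2 (p ^ j) \<noteq> {}"
    then obtain \<beta> where "int (p ^ j) dvd bqf_eval q1 \<beta> 1" by (auto simp: common_roots_def)
    moreover have "int p dvd int (p ^ j)" using that by simp
    ultimately have "int p dvd bqf_eval q1 \<beta> 1" using dvd_trans by blast
    then have "kronecker_prime D1 p = 1" using root_imp_kronecker_one[OF p(1), of q1 \<beta>] nd unfolding q by blast
    then show False using inert by simp
  qed
  then have "(\<Sum>j\<le>k. int (card (common_roots q1 q2 (p ^ j)))) = (\<Sum>j\<in>{0}. int (card (common_roots q1 q2 (p ^ j))))"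
    by (intro sum.mono_neutral_right) auto
  then show "(\<Sum>j\<le>k. int (card (common_roots q1 q2 (p ^ j)))) = 1" by (simp add: card_common_roots_one[simplified])
  obtain A B C a b c where qc: "q1 = BQF A B C" "q2 = BQF a b c" by (cases q1; cases q2)
  have D: "D1 = B\<^sup>2 - 4 * A * C" "D2 = b\<^sup>2 - 4 * a * c" "n = B * b - 2 * A * c - 2 * a * C"
    using pr by (simp_all add: pairs_def qc bqf_disc_def B_Delta_def)
  define x u where "x = D1 * a - n * A" and "u = A * b - a * B"
  have "x\<^sup>2 - D1 * u\<^sup>2 = - (D1 * D2 - n\<^sup>2) * A\<^sup>2"
    unfolding x_def u_def D by (simp add: power2_eq_square algebra_simps)
  then have norm: "x\<^sup>2 - D1 * u\<^sup>2 = (- 4) * (N * A\<^sup>2)" unfolding N by simp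
  have A: "\<not> int p dvd A" using leading_not_dvd by (simp add: qc)
  then have A0: "A \<noteq> 0" by auto
  then have nz: "x\<^sup>2 - D1 * u\<^sup>2 \<noteq> 0" using norm N_pos by simp
  have "even (multiplicity (int p) (x\<^sup>2 - D1 * u\<^sup>2))"
    by (rule norm_multiplicity_even[OF p(1) disc_mod_4(1) inert nz])
  moreover have "multiplicity (int p) (x\<^sup>2 - D1 * u\<^sup>2) = multiplicity (int p) (- 4) + (k + 2 * multiplicity (int p) A)"
  proof -
    have pe: "prime_elem (int p)" using prime_int_p by simp
    have "multiplicity (int p) ((- 4) * (N * A\<^sup>2)) = multiplicity (int p) (- 4) + multiplicity (int p) (N * A\<^sup>2)"
      using N_pos A0 by (intro prime_elem_multiplicity_mult_distrib[OF pe]) auto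
    moreover have "multiplicity (int p) (N * A\<^sup>2) = k + multiplicity (int p) (A\<^sup>2)"
      unfolding k using N_pos A0 by (intro prime_elem_multiplicity_mult_distrib[OF pe]) auto
    moreover have "multiplicity (int p) (A\<^sup>2) = 2 * multiplicity (int p) A"
      using A0 by (intro prime_elem_multiplicity_power_distrib[OF pe])
    ultimately show ?thesis unfolding norm by simp
  qed
  moreover have "even (multiplicity (int p) (- 4))"
  proof (cases "p = 2")
    case True
    have "multiplicity (2::int) (- 4) = 2" by (rule multiplicity_eqI) simp_all
    then show ?thesis using True by simp
  next
    case False
    have "\<not> int p dvd - 4"
    proof
      assume "int p dvd - 4"
      then have "int p dvd int (2 ^ 2)" by simp
      then have "p dvd 2" using p(1) prime_dvd_power unfolding int_dvd_int_iff by blast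
      then show False using False p(1) primes_dvd_imp_eq two_is_prime_nat by blast
    qed
    then show ?thesis by (simp add: not_dvd_imp_multiplicity_0)
  qed
  ultimately show "even k" by simp
qed

text \<open>q1 has two roots r1, r2 modulo powers of p, and N = -A^2 q2(r1) q2(r2) to sufficient
  precision, so the exponents of p in the two values add up to k. A root is common modulo p^j
  exactly as long as p^j divides its value; this gives k, and the modulus 1 adds one.\<close>

lemma local_count_split:
  assumes split: "kronecker_prime D1 p = 1"
  shows "(\<Sum>j\<le>k. int (card (common_roots q1 q2 (p ^ j)))) = int k + 1"
proof -
  have pp: "prime (int p)" by (rule prime_int_p)
  obtain A B C a b c where qc: "q1 = BQF A B C" "q2 = BQF a b c" by (cases q1; cases q2)
  have D: "D1 = B\<^sup>2 - 4 * A * C" using pr by (simp add: pairs_def qc bqf_disc_def)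
  have A: "\<not> int p dvd A" using leading_not_dvd by (simp add: qc)
  \<comment> \<open>One power more than divides N, so that a congruence modulo \<open>P\<close>
    determines the exponent k.\<close>
  define P where "P = int p ^ Suc k"
  have "\<And>r. prime r \<Longrightarrow> r dvd p ^ Suc k \<Longrightarrow> kronecker_prime D1 r = 1"
    using split p(1) by (metis prime_dvd_power primes_dvd_imp_eq)
  then obtain t where "4 * int (p ^ Suc k) dvd t\<^sup>2 - D1"
    using sqrt_cong_exists[of "p ^ Suc k" D1] disc_mod_4 prime_gt_0_nat[OF p(1)] by auto
  then have "4 * P dvd t\<^sup>2 - D1" by (simp only: P_def of_nat_power)
  then obtain w where w: "t\<^sup>2 - D1 = 4 * P * w" by (rule dvdE)
  have nt: "\<not> int p dvd t"
  proof
    assume "int p dvd t"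
    then have "int p dvd t\<^sup>2 - 4 * P * w" by (simp add: P_def power2_eq_square)
    then have "int p dvd D1" using w by (metis diff_diff_eq2 diff_add_cancel add_diff_cancel_left')
    then show False using kronecker_oneD(1)[OF split p(1)] by blast
  qed
  have "even (t\<^sup>2 - B\<^sup>2)"
  proof -
    have "t\<^sup>2 - B\<^sup>2 = 2 * (2 * P * w - 2 * A * C)" using w D by simp
    then show ?thesis by simp
  qed
  then have "even (t - B)" by simp
  then obtain h1 where "t - B = 2 * h1" by (rule evenE)
  then have h1: "t = 2 * h1 + B" by simp
  \<comment> \<open>h1 = (t - B) / 2 and h2 = (- t - B) / 2 are A times the two roots, with t a
    square root of D1 modulo 4 \<open>P\<close>.\<close>
  define h2 where "h2 = - h1 - B"
  have h12: "h1 * h2 = A * C - P * w"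
  proof -
    have "4 * (h1 * h2) = B\<^sup>2 - t\<^sup>2" unfolding h2_def h1 by (simp add: power2_eq_square algebra_simps)
    also have "\<dots> = 4 * (A * C - P * w)" using w D by simp
    finally show ?thesis by simp
  qed
  have copA: "coprime A P" unfolding P_def using A pp by (metis coprime_commute coprime_power_left_iff prime_imp_coprime)
  obtain r1 where r1: "P dvd A * r1 - h1" using linear_cong_solvable[OF copA] .
  obtain r2 where r2: "P dvd A * r2 - h2" using linear_cong_solvable[OF copA] .
  have fact: "A * bqf_eval q1 x 1 = (A * x - h1) * (A * x - h2) + P * w" for x
  proof -
    have "(A * x - h1) * (A * x - h2) = A * x * (A * x) - (h1 + h2) * (A * x) + h1 * h2" by (simp add: algebra_simps)
    then show ?thesis unfolding h12 by (simp add: h2_def qc power2_eq_square algebra_simps)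
  qed
  have roots: "int p ^ j dvd bqf_eval q1 x 1 \<longleftrightarrow> int p ^ j dvd x - r1 \<or> int p ^ j dvd x - r2" if j: "j \<le> Suc k" for j x
  proof -
    have jP: "int p ^ j dvd P" unfolding P_def using j by (rule le_imp_power_dvd)
    have cj: "coprime A (int p ^ j)" using A pp by (metis coprime_commute coprime_power_left_iff prime_imp_coprime)
    have shift: "int p ^ j dvd A * x - h \<longleftrightarrow> int p ^ j dvd x - r" if "P dvd A * r - h" for h r
    proof -
      have "A * x - h = A * (x - r) + (A * r - h)" by (simp add: algebra_simps)
      moreover have "int p ^ j dvd A * r - h" using that jP dvd_trans by blast
      ultimately have "int p ^ j dvd A * x - h \<longleftrightarrow> int p ^ j dvd A * (x - r)" using dvd_add_left_iff by metis
      then show ?thesis using cj by (simp only: coprime_commute coprime_dvd_mult_right_iff)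
    qed
    have "int p ^ j dvd bqf_eval q1 x 1 \<longleftrightarrow> int p ^ j dvd A * bqf_eval q1 x 1"
      using cj by (simp only: coprime_commute coprime_dvd_mult_right_iff)
    also have "\<dots> \<longleftrightarrow> int p ^ j dvd (A * x - h1) * (A * x - h2)"
      unfolding fact using jP dvd_add_left_iff dvd_mult2 by blast
    also have "\<dots> \<longleftrightarrow> int p ^ j dvd A * x - h1 \<or> int p ^ j dvd A * x - h2"
    proof
      assume d: "int p ^ j dvd (A * x - h1) * (A * x - h2)"
      \<comment> \<open>The two factors differ by h1 - h2 = t, a unit at p, so p divides at most one
        of them.\<close>
      have "\<not> (int p dvd A * x - h1 \<and> int p dvd A * x - h2)"
      proof
        assume "int p dvd A * x - h1 \<and> int p dvd A * x - h2"
        then have "int p dvd (A * x - h2) - (A * x - h1)" using dvd_diff by blast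
        then show False using nt unfolding h1 h2_def by (simp add: algebra_simps)
      qed
      then have "coprime (int p ^ j) (A * x - h1) \<or> coprime (int p ^ j) (A * x - h2)"
        using pp prime_imp_coprime coprime_power_left_iff by metis
      then show "int p ^ j dvd A * x - h1 \<or> int p ^ j dvd A * x - h2"
        using d coprime_dvd_mult_right_iff coprime_dvd_mult_left_iff by blast
    qed auto
    finally show ?thesis unfolding shift[OF r1] shift[OF r2] .
  qed
  define e1 e2 where "e1 = bqf_eval q2 r1 1" and "e2 = bqf_eval q2 r2 1"
  define u where "u = A * b - a * B"
  have Pr: "P dvd bqf_eval q1 r1 1" "P dvd bqf_eval q1 r2 1"
    unfolding P_def using roots[of "Suc k"] by auto
  \<comment> \<open>This is \<open>pairs_key_identity\<close> at r1 with the second root r2 put back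
    in.\<close>
  have PN: "P dvd N + A\<^sup>2 * (e1 * e2)"
  proof -
    obtain y1 where "A * r1 - h1 = P * y1" using r1 by (rule dvdE)
    moreover obtain y2 where "A * r2 - h2 = P * y2" using r2 by (rule dvdE)
    ultimately have y: "A * r1 = h1 + P * y1" "A * r2 = h2 + P * y2" by simp_all
    obtain z1 where z1: "bqf_eval q1 r1 1 = P * z1" using Pr(1) by (rule dvdE)
    obtain z2 where z2: "bqf_eval q1 r2 1 = P * z2" using Pr(2) by (rule dvdE)
    note z = z1 z2
    have "P dvd N - e1 * (u * (2 * A * r1 + B) - A\<^sup>2 * e1)"
      using pairs_key_identity[OF pr, of r1] Pr(1) dvd_trans unfolding qc e1_def u_def bqf.sel by blast
    moreover have "A\<^sup>2 * (e1 - e2) = A * a * (bqf_eval q1 r1 1 - bqf_eval q1 r2 1) + u * (A * r1 - A * r2)"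
      unfolding e1_def e2_def u_def qc by (simp add: power2_eq_square algebra_simps)
    then have "A\<^sup>2 * (e1 - e2) = u * t + P * (A * a * (z1 - z2) + u * (y1 - y2))"
      unfolding y z h1 h2_def by (simp add: algebra_simps)
    then have "e1 * (u * (2 * A * r1 + B) - A\<^sup>2 * e1) + A\<^sup>2 * (e1 * e2) = P * (e1 * (2 * u * y1 - (A * a * (z1 - z2) + u * (y1 - y2))))"
    proof -
      have "e1 * (u * (2 * A * r1 + B) - A\<^sup>2 * e1) + A\<^sup>2 * (e1 * e2) = e1 * (u * (2 * (A * r1) + B) - A\<^sup>2 * (e1 - e2))"
        by (simp add: algebra_simps)
      then show ?thesis unfolding \<open>A\<^sup>2 * (e1 - e2) = u * t + _\<close> y h1 by (simp add: algebra_simps)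
    qed
    then have "P dvd e1 * (u * (2 * A * r1 + B) - A\<^sup>2 * e1) + A\<^sup>2 * (e1 * e2)" by simp
    ultimately have "P dvd (N - e1 * (u * (2 * A * r1 + B) - A\<^sup>2 * e1)) + (e1 * (u * (2 * A * r1 + B) - A\<^sup>2 * e1) + A\<^sup>2 * (e1 * e2))"
      by (rule dvd_add)
    then show ?thesis by simp
  qed
  have Nk: "int p ^ k dvd N" "\<not> P dvd N"
  proof -
    show "int p ^ k dvd N" unfolding k by (rule multiplicity_dvd)
    have "N \<noteq> 0" "\<not> is_unit (int p)" using N_pos pp not_prime_unit by auto
    then show "\<not> P dvd N" unfolding P_def k by (subst power_dvd_iff_le_multiplicity) auto
  qed
  have cA2: "coprime (A\<^sup>2) (int p ^ k)" using A pp by (metis coprime_commute coprime_power_left_iff coprime_power_right_iff prime_imp_coprime)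
  have nd: "\<not> int p ^ Suc k dvd e1 * e2"
  proof
    assume "int p ^ Suc k dvd e1 * e2"
    then have "P dvd A\<^sup>2 * (e1 * e2)" unfolding P_def by (rule dvd_mult)
    then show False using PN Nk(2) dvd_add_left_iff by blast
  qed
  have v: "multiplicity (int p) (e1 * e2) = k"
  proof (rule multiplicity_eqI)
    have "int p ^ k dvd N + A\<^sup>2 * (e1 * e2)" using PN unfolding P_def by (metis dvd_mult_right power_Suc)
    then have "int p ^ k dvd A\<^sup>2 * (e1 * e2)" using Nk(1) dvd_add_right_iff by blast
    then show "int p ^ k dvd e1 * e2" using cA2 by (simp only: coprime_commute coprime_dvd_mult_right_iff)
    show "\<not> int p ^ Suc k dvd e1 * e2" by (rule nd)
  qed
  have e0: "e1 \<noteq> 0" "e2 \<noteq> 0" using nd by auto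
  have vs: "multiplicity (int p) e1 + multiplicity (int p) e2 = k"
    using v pp e0 by (simp add: prime_elem_multiplicity_mult_distrib)
  have cnt: "card (common_roots q1 q2 (p ^ j)) = (if int p ^ j dvd e1 then 1 else 0) + (if int p ^ j dvd e2 then 1 else 0)"
    if j: "j \<in> {1..k}" for j
  proof -
    have pj: "int p ^ j > 0" using prime_gt_0_int[OF pp] by simp
    define s1 s2 where "s1 = r1 mod int p ^ j" and "s2 = r2 mod int p ^ j"
    have ds: "int p ^ j dvd r1 - s1" "int p ^ j dvd r2 - s2"
      unfolding s1_def s2_def by (simp_all add: mod_eq_dvd_iff[symmetric])
    have "s1 \<noteq> s2"
    proof
      assume "s1 = s2"
      then have "int p ^ j dvd r1 - r2" unfolding s1_def s2_def by (simp add: mod_eq_dvd_iff)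
      moreover have "int p dvd int p ^ j" using j by simp
      ultimately have "int p dvd r1 - r2" using dvd_trans by blast
      then have d: "int p dvd A * (r1 - r2)" by simp
      have d12: "int p dvd A * r1 - h1" "int p dvd A * r2 - h2"
        using r1 r2 unfolding P_def by (metis dvd_mult_left power_Suc)+
      have "int p dvd A * (r1 - r2) - (A * r1 - h1) + (A * r2 - h2)"
        by (rule dvd_add[OF dvd_diff[OF d d12(1)] d12(2)])
      then show False using nt unfolding h1 h2_def by (simp add: algebra_simps)
    qed
    have mem: "x \<in> common_roots q1 q2 (p ^ j) \<longleftrightarrow> (x = s1 \<and> int p ^ j dvd e1) \<or> (x = s2 \<and> int p ^ j dvd e2)" for x
    proof -
      have range: "0 \<le> x \<and> x < int p ^ j \<and> int p ^ j dvd x - r \<longleftrightarrow> x = r mod int p ^ j" for r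
      proof
        assume h: "0 \<le> x \<and> x < int p ^ j \<and> int p ^ j dvd x - r"
        then have "x mod int p ^ j = r mod int p ^ j" unfolding mod_eq_dvd_iff by (elim conjE)
        moreover have "x mod int p ^ j = x" using h by (intro mod_pos_pos_trivial) auto
        ultimately show "x = r mod int p ^ j" by simp
      next
        assume "x = r mod int p ^ j"
        then show "0 \<le> x \<and> x < int p ^ j \<and> int p ^ j dvd x - r"
          using pj by (simp add: mod_eq_dvd_iff[symmetric])
      qed
      have "x \<in> common_roots q1 q2 (p ^ j) \<longleftrightarrow>
        0 \<le> x \<and> x < int p ^ j \<and> (int p ^ j dvd x - r1 \<or> int p ^ j dvd x - r2) \<and> int p ^ j dvd bqf_eval q2 x 1"
        using roots[of j x] j by (simp add: common_roots_def)
      also have "\<dots> \<longleftrightarrow> (x = s1 \<or> x = s2) \<and> int p ^ j dvd bqf_eval q2 x 1"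
        unfolding s1_def s2_def using range[of r1] range[of r2] by blast
      also have "\<dots> \<longleftrightarrow> (x = s1 \<and> int p ^ j dvd e1) \<or> (x = s2 \<and> int p ^ j dvd e2)"
        unfolding e1_def e2_def using bqf_eval_cong[OF ds(1), of q2] bqf_eval_cong[OF ds(2), of q2] by blast
      finally show ?thesis .
    qed
    have "common_roots q1 q2 (p ^ j) = (if int p ^ j dvd e1 then {s1} else {}) \<union> (if int p ^ j dvd e2 then {s2} else {})"
      using mem by auto
    then show ?thesis using \<open>s1 \<noteq> s2\<close> by simp
  qed
  have "{..k} = insert 0 {1..k}" by auto
  then have "(\<Sum>j\<le>k. int (card (common_roots q1 q2 (p ^ j)))) = 1 + (\<Sum>j\<in>{1..k}. int (card (common_roots q1 q2 (p ^ j))))"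
    by (simp add: card_common_roots_one[simplified])
  also have "(\<Sum>j\<in>{1..k}. int (card (common_roots q1 q2 (p ^ j))))
    = (\<Sum>j\<in>{1..k}. (if int p ^ j dvd e1 then 1 else 0)) + (\<Sum>j\<in>{1..k}. (if int p ^ j dvd e2 then 1 else 0))"
    unfolding sum.distrib[symmetric] by (rule sum.cong[OF refl], subst cnt, assumption, simp)
  also have "\<dots> = int (card {j\<in>{1..k}. int p ^ j dvd e1}) + int (card {j\<in>{1..k}. int p ^ j dvd e2})"
  proof -
    have "(\<Sum>j\<in>S. (if Q j then 1 else 0)) = int (card {j\<in>S. Q j})" if "finite S" for S :: "nat set" and Q
      using that by (simp add: sum.If_cases Int_def)
    then show ?thesis by simp
  qed
  also have "\<dots> = int k"
    using sum_prime_power_divides[OF e0(1) pp, of k] sum_prime_power_divides[OF e0(2) pp, of k] vs by simp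
  finally show ?thesis by simp
qed

lemma local_count:
  "(\<Sum>j\<le>k. int (card (common_roots q1 q2 (p ^ j)))) = (\<Sum>j\<le>k. eps_prime D1 D2 p ^ j)"
proof (cases "int p dvd D1")
  case True
  then show ?thesis by (rule local_count_ramified)
next
  case False
  have e: "eps_prime D1 D2 p = kronecker_prime D1 p" by (rule eps_prime_eq[OF p False])
  have "kronecker_prime D1 p \<noteq> 0" using kronecker_zero_iff[OF p(1)] False by simp
  then consider "kronecker_prime D1 p = 1" | "kronecker_prime D1 p = -1" using kronecker_range[of D1 p] by auto
  then show ?thesis
  proof cases
    case 1
    then show ?thesis using local_count_split e by simp
  next
    case 2
    have "(\<Sum>j\<le>k. (-1::int) ^ j) = (if even k then 1 else 0)" for k by (induction k) auto
    then show ?thesis using local_count_inert[OF False 2] e 2 by simp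
  qed
qed

end

lemma sum_common_roots_eq:
  assumes pr: "(q1, q2) \<in> pairs" and cop: "coprime (coefA q1) N"
  shows "(\<Sum>m | m dvd nat N. int (card (common_roots q1 q2 m))) = (\<Sum>d | d dvd nat N. eps D1 D2 d)"
proof -
  have N0: "nat N > 0" using N_pos by simp
  have "(\<Sum>m | m dvd nat N. int (card (common_roots q1 q2 m))) =
    (\<Prod>p\<in>prime_factors (nat N). \<Sum>j\<le>multiplicity p (nat N). int (card (common_roots q1 q2 (p ^ j))))"
    by (rule sum_divisors_eq_prod[OF _ _ N0]) (simp_all add: card_common_roots_mult card_common_roots_one[simplified])
  also have "\<dots> = (\<Prod>p\<in>prime_factors (nat N). \<Sum>j\<le>multiplicity p (nat N). eps D1 D2 (p ^ j))"
  proof (rule prod.cong[OF refl])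
    fix p assume "p \<in> prime_factors (nat N)"
    then have p: "prime p" "p dvd nat N" by auto
    then have pN: "int p dvd N" using N_pos int_dvd_int_iff[of p "nat N"] by simp
    show "(\<Sum>j\<le>multiplicity p (nat N). int (card (common_roots q1 q2 (p ^ j)))) = (\<Sum>j\<le>multiplicity p (nat N). eps D1 D2 (p ^ j))"
      unfolding multiplicity_nat_int[OF N_pos p(1)] eps_prime_power[OF p(1)]
      by (rule local_count[OF pr cop p(1) pN refl])
  qed
  also have "\<dots> = (\<Sum>d | d dvd nat N. eps D1 D2 d)"
    by (rule sum_divisors_eq_prod[OF _ _ N0, symmetric]) (simp_all add: eps_mult eps_one[simplified])
  finally show ?thesis .
qed

lemma eps_prime_sign: "prime p \<Longrightarrow> int p dvd N \<Longrightarrow> eps_prime D1 D2 p = 1 \<or> eps_prime D1 D2 p = -1"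
proof -
  assume p: "prime p" "int p dvd N"
  show ?thesis
  proof (cases "int p dvd D1")
    case False
    then have "kronecker_prime D1 p \<noteq> 0" using kronecker_zero_iff[OF p(1)] by simp
    then show ?thesis using eps_prime_eq[OF p False] kronecker_range[of D1 p] by auto
  next
    case True
    then have nd: "\<not> int p dvd D2" using not_dvd_both[OF p(1)] by blast
    then have "kronecker_prime D2 p \<noteq> 0" using kronecker_zero_iff[OF p(1)] by simp
    then show ?thesis
      using disc_pair.eps_prime_eq[OF swap p nd] eps_prime_swap kronecker_range[of D2 p] by auto
  qed
qed

text \<open>Without a pair some prime with \<open>eps_prime\<close> -1 has odd exponent, and its
  local factor 1 - 1 + ... - 1 is zero.\<close>

lemma sum_eps_zero:
  assumes "pairs = {}"
  shows "(\<Sum>d | d dvd nat N. eps D1 D2 d) = 0"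
proof -
  have N0: "nat N > 0" using N_pos by simp
  obtain p where p: "prime p" "int p dvd N" "eps_prime D1 D2 p \<noteq> 1" "odd (multiplicity p (nat N))"
    using pair_exists assms unfolding pairs_def by blast
  then have e: "eps_prime D1 D2 p = -1" using eps_prime_sign by blast
  have "(\<Sum>j\<le>k. (-1::int) ^ j) = (if even k then 1 else 0)" for k by (induction k) auto
  then have "(\<Sum>j\<le>multiplicity p (nat N). eps D1 D2 (p ^ j)) = 0"
    using p(4) by (simp add: eps_prime_power[OF p(1)] e)
  moreover have "p dvd nat N" using p(2) N_pos int_dvd_int_iff[of p "nat N"] by simp
  then have "p \<in> prime_factors (nat N)" using p(1) N0 by (simp add: in_prime_factors_iff)
  ultimately have "(\<Prod>p\<in>prime_factors (nat N). \<Sum>j\<le>multiplicity p (nat N). eps D1 D2 (p ^ j)) = 0"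
    by (intro prod_zero) auto
  moreover have "(\<Sum>d | d dvd nat N. eps D1 D2 d) = (\<Prod>p\<in>prime_factors (nat N). \<Sum>j\<le>multiplicity p (nat N). eps D1 D2 (p ^ j))"
    by (rule sum_divisors_eq_prod[OF _ _ N0]) (simp_all add: eps_mult eps_one[simplified])
  ultimately show ?thesis by simp
qed

end

section \<open>Counting pairs\<close>

text \<open>x collects the primes of M that divide A but not C, and y those not dividing A. Modulo a
  prime of M the value reduces to A x^2, to C y^2 or, if the prime divides both A and C, to B x y, a
  unit in each case.\<close>

lemma primitive_represents_coprime:
  fixes M :: nat
  assumes prim: "\<And>p. prime p \<Longrightarrow> p dvd coefA q \<Longrightarrow> p dvd coefB q \<Longrightarrow> \<not> p dvd coefC q" and M: "M > 0"
  obtains x y where "coprime x y" "coprime (bqf_eval q x y) (int M)"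
proof -
  obtain A B C where q: "q = BQF A B C" by (cases q)
  define X Y where "X = {p \<in> prime_factors M. int p dvd A \<and> \<not> int p dvd C}"
    and "Y = {p \<in> prime_factors M. \<not> int p dvd A}"
  define x y where "x = (\<Prod>p\<in>X. int p)" and "y = (\<Prod>p\<in>Y. int p)"
  have fin: "finite X" "finite Y" unfolding X_def Y_def by simp_all
  have pr: "prime p" if "p \<in> X \<union> Y" for p using that by (auto simp: X_def Y_def)
  have dvx: "int p dvd x \<longleftrightarrow> p \<in> X" if "prime p" for p
  proof
    assume "int p dvd x"
    then have "\<exists>r\<in>X. int p dvd int r"
      unfolding x_def using fin(1) prime_dvd_prod_iff[of X "int p" int] that by simp
    then obtain r where r: "r \<in> X" "int p dvd int r" by blast
    then have "p = r" using that pr[of r] primes_dvd_imp_eq by simp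
    then show "p \<in> X" using r by simp
  next
    assume "p \<in> X" then show "int p dvd x" unfolding x_def using fin(1) by (intro dvd_prodI) auto
  qed
  have dvy: "int p dvd y \<longleftrightarrow> p \<in> Y" if "prime p" for p
  proof
    assume "int p dvd y"
    then have "\<exists>r\<in>Y. int p dvd int r"
      unfolding y_def using fin(2) prime_dvd_prod_iff[of Y "int p" int] that by simp
    then obtain r where r: "r \<in> Y" "int p dvd int r" by blast
    then have "p = r" using that pr[of r] primes_dvd_imp_eq by simp
    then show "p \<in> Y" using r by simp
  next
    assume "p \<in> Y" then show "int p dvd y" unfolding y_def using fin(2) by (intro dvd_prodI) auto
  qed
  have "0 \<notin> Y" using pr[of 0] by auto
  then have y0: "y \<noteq> 0" unfolding y_def using fin(2) by simp
  have intp: "\<exists>r. prime r \<and> p = int r" if "prime p" for p :: int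
    using that by (metis prime_int_nat_transfer prime_ge_0_int int_nat_eq)
  have "coprime x y"
  proof (rule coprime_int_primeI[OF _ y0])
    fix p :: int assume p: "prime p" "p dvd x" "p dvd y"
    obtain r where r: "prime r" "p = int r" using intp[OF p(1)] by blast
    then have "r \<in> X" "r \<in> Y" using dvx dvy p by auto
    then show False by (auto simp: X_def Y_def)
  qed
  moreover have "coprime (bqf_eval q x y) (int M)"
  proof (rule coprime_int_primeI)
    show "int M \<noteq> 0" using M by simp
    fix p :: int assume p: "prime p" "p dvd bqf_eval q x y" "p dvd int M"
    obtain r where r: "prime r" "p = int r" using intp[OF p(1)] by blast
    have rM: "r \<in> prime_factors M" using r p(3) M by (simp add: in_prime_factors_iff)
    have d: "p dvd A * x\<^sup>2 + B * x * y + C * y\<^sup>2" using p(2) by (simp add: q)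
    have pm: "p dvd a * b \<longleftrightarrow> p dvd a \<or> p dvd b" for a b using p(1) by (rule prime_dvd_mult_iff)
    consider "r \<in> Y" | "r \<in> X" | "r \<notin> X" "r \<notin> Y" by blast
    then show False
    proof cases
      case 1
      then have "p dvd y" "\<not> p dvd x" "\<not> p dvd A" using dvx[OF r(1)] dvy[OF r(1)] r(2) by (auto simp: X_def Y_def)
      then have "p dvd B * x * y + C * y\<^sup>2" by (simp add: power2_eq_square)
      then have "p dvd A * x\<^sup>2" using d by (metis add.assoc dvd_add_left_iff)
      then show False using \<open>\<not> p dvd x\<close> \<open>\<not> p dvd A\<close> by (simp add: power2_eq_square pm)
    next
      case 2
      then have "p dvd x" "\<not> p dvd y" "\<not> p dvd C" using dvx[OF r(1)] dvy[OF r(1)] r(2) by (auto simp: X_def Y_def)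
      then have "p dvd A * x\<^sup>2 + B * x * y" by (simp add: power2_eq_square)
      then have "p dvd C * y\<^sup>2" using d dvd_add_right_iff by blast
      then show False using \<open>\<not> p dvd y\<close> \<open>\<not> p dvd C\<close> by (simp add: power2_eq_square pm)
    next
      case 3
      then have c: "\<not> p dvd x" "\<not> p dvd y" "p dvd A" "p dvd C"
        using dvx[OF r(1)] dvy[OF r(1)] r(2) rM by (auto simp: X_def Y_def)
      then have AC: "p dvd A * x\<^sup>2" "p dvd C * y\<^sup>2" by simp_all
      then have "p dvd A * x\<^sup>2 + B * x * y" using d dvd_add_left_iff by blast
      then have "p dvd B * x * y" using AC(1) dvd_add_right_iff by blast
      then have "p dvd B" using c by (simp add: pm)
      then show False using prim[OF p(1)] c by (simp add: q)
    qed
  qed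
  ultimately show thesis by (rule that)
qed

text \<open>Dividing the form by p would leave a form whose discriminant is D / p^2. Hence the pairs
  in \<open>pair_count\<close>, on which no primitivity is imposed, consist of primitive
  forms.\<close>

lemma fund_disc_primitive:
  assumes "fund_disc (bqf_disc q)" "prime p" "p dvd coefA q" "p dvd coefB q"
  shows "\<not> p dvd coefC q"
proof
  assume "p dvd coefC q"
  obtain A where A: "coefA q = p * A" using assms(3) by (rule dvdE)
  obtain B where B: "coefB q = p * B" using assms(4) by (rule dvdE)
  obtain C where C: "coefC q = p * C" using \<open>p dvd coefC q\<close> by (rule dvdE)
  have e: "bqf_disc q = p\<^sup>2 * (B\<^sup>2 - 4 * A * C)"
    unfolding bqf_disc_def A B C by (simp add: power2_eq_square algebra_simps)
  have all: "\<forall>p D'. prime p \<and> bqf_disc q = p\<^sup>2 * D' \<longrightarrow> \<not> (D' mod 4 = 0 \<or> D' mod 4 = 1)"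
    using assms(1) unfolding fund_disc_def by (elim conjE)
  have n: "\<not> ((B\<^sup>2 - 4 * A * C) mod 4 = 0 \<or> (B\<^sup>2 - 4 * A * C) mod 4 = 1)"
    by (rule mp[OF spec[OF spec[OF all]] conjI[OF assms(2) e]])
  have "(B\<^sup>2 - 4 * A * C) mod 4 = B\<^sup>2 mod 4"
    unfolding mod_eq_dvd_iff by simp
  then show False using n by (simp add: square_mod_4 split: if_splits)
qed

lemma fund_disc_bqf_primitive:
  assumes "fund_disc (bqf_disc q)"
  shows "bqf_primitive q"
proof (rule ccontr)
  assume "\<not> bqf_primitive q"
  moreover define g where "g = gcd (coefA q) (gcd (coefB q) (coefC q))"
  ultimately have "g \<noteq> 1" "g \<ge> 0" by (simp_all add: bqf_primitive_def)
  have "g \<noteq> 0"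
  proof
    assume "g = 0"
    then have "bqf_disc q = 0" by (simp add: g_def bqf_disc_def)
    then show False using assms by (simp add: fund_disc_def)
  qed
  then have "\<not> is_unit g" using \<open>g \<noteq> 1\<close> \<open>g \<ge> 0\<close> by simp
  then obtain p where p: "p dvd g" "prime p" using \<open>g \<noteq> 0\<close> prime_divisor_exists by metis
  then have "p dvd coefA q" "p dvd coefB q" "p dvd coefC q" by (auto simp: g_def)
  then show False using fund_disc_primitive[OF assms p(2)] by blast
qed

context disc_pair
begin

text \<open>A value of q1 prime to N, taken at coprime arguments, becomes the leading coefficient
  after a change of basis in \<open>Gamma\<close>.\<close>

lemma base_pair_exists:
  assumes "pairs \<noteq> {}"
  obtains q1 q2 where "(q1, q2) \<in> pairs" "coprime (coefA q1) N"
proof -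
  obtain q1 q2 where q: "(q1, q2) \<in> pairs" using assms by auto
  have "fund_disc (bqf_disc q1)" using q fund by (simp add: pairs_def)
  then obtain x y where xy: "coprime x y" "coprime (bqf_eval q1 x y) (int (nat N))"
    using primitive_represents_coprime[of q1 "nat N"] fund_disc_primitive N_pos by auto
  obtain u v where uv: "u * x + v * y = 1" using xy(1) bezout_int[of x y] by auto
  have g: "(x, - v, y, u) \<in> Gamma" using uv by (simp add: Gamma_def algebra_simps)
  have "coefA (bqf_act (x, - v, y, u) q1) = bqf_eval q1 x y" by (cases q1) (simp add: algebra_simps)
  then have "coprime (coefA (bqf_act (x, - v, y, u) q1)) N" using xy(2) N_pos by simp
  then show thesis using that pairs_act[OF g q] by blast
qed

theorem card_pair_classes:
  "finite (pairs // bqf_equiv2)"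
  "int (card (pairs // bqf_equiv2)) = 2 * (\<Sum>d | d dvd nat N. eps D1 D2 d)"
proof -
  have "finite (pairs // bqf_equiv2) \<and> int (card (pairs // bqf_equiv2)) = 2 * (\<Sum>d | d dvd nat N. eps D1 D2 d)"
  proof (cases "pairs = {}")
    case True
    then show ?thesis using sum_eps_zero by simp
  next
    case False
    then obtain q1 q2 where q: "(q1, q2) \<in> pairs" "coprime (coefA q1) N" using base_pair_exists by blast
    note bij = bij_betw_sublattices[OF q]
    have "finite (pairs // bqf_equiv2)" using bij_betw_finite[OF bij] card_sublattices(1)[OF q(1)] by simp
    moreover have "int (card (pairs // bqf_equiv2)) = 2 * (\<Sum>m | m dvd nat N. int (card (common_roots q1 q2 m)))"
    proof -
      have e: "card (pairs // bqf_equiv2) = 2 * (\<Sum>m | m dvd nat N. card (common_roots q1 q2 m))"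
        using bij_betw_same_card[OF bij] card_sublattices(2)[OF q(1)] by simp
      show ?thesis unfolding e by simp
    qed
    ultimately show ?thesis using sum_common_roots_eq[OF q] by simp
  qed
  then show "finite (pairs // bqf_equiv2)"
    "int (card (pairs // bqf_equiv2)) = 2 * (\<Sum>d | d dvd nat N. eps D1 D2 d)" by simp_all
qed

end

lemma S_set_iff:
  assumes "D1 * D2 > 0"
  shows "n \<in> S_set D1 D2 \<longleftrightarrow> n\<^sup>2 < D1 * D2 \<and> (even n \<longleftrightarrow> even (D1 * D2))"
proof -
  have "real_of_int \<bar>n\<bar> < sqrt (of_int (D1 * D2)) \<longleftrightarrow> n\<^sup>2 < D1 * D2"
  proof -
    have "real_of_int \<bar>n\<bar> < sqrt (of_int (D1 * D2)) \<longleftrightarrow> sqrt (of_int (n\<^sup>2)) < sqrt (of_int (D1 * D2))"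
      by simp
    also have "\<dots> \<longleftrightarrow> real_of_int (n\<^sup>2) < of_int (D1 * D2)" by (rule real_sqrt_less_iff)
    finally show ?thesis by (simp only: of_int_less_iff)
  qed
  moreover have "[n = D1 * D2] (mod 2) \<longleftrightarrow> (even n \<longleftrightarrow> even (D1 * D2))"
  proof -
    have "x mod 2 = y mod 2 \<longleftrightarrow> (even x \<longleftrightarrow> even y)" for x y :: int by presburger
    then show ?thesis unfolding cong_def .
  qed
  ultimately show ?thesis by (simp add: S_set_def)
qed

lemma disc_pairI:
  assumes "fund_disc D1" "fund_disc D2" "coprime D1 D2" "n \<in> S_set D1 D2"
  shows "disc_pair D1 D2 n ((D1 * D2 - n\<^sup>2) div 4)"
proof
  show "fund_disc D1" "fund_disc D2" "coprime D1 D2" by fact+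
  have pos: "D1 * D2 > 0" using assms by (simp add: fund_disc_def)
  have n: "n\<^sup>2 < D1 * D2" "even n \<longleftrightarrow> even (D1 * D2)" using assms(4) S_set_iff[OF pos] by simp_all
  have m: "D1 mod 4 = 0 \<or> D1 mod 4 = 1" "D2 mod 4 = 0 \<or> D2 mod 4 = 1"
    using assms by (simp_all add: fund_disc_def)
  have "(x * y) mod 4 = 0 \<or> (x * y) mod 4 = 1"
    if "x mod 4 = 0 \<or> x mod 4 = 1" "y mod 4 = 0 \<or> y mod 4 = 1" for x y :: int
    using that mod_mult_eq[of x 4 y] by auto
  from this[OF m] have "(D1 * D2) mod 4 = 0 \<or> (D1 * D2) mod 4 = 1" .
  then have "4 dvd n\<^sup>2 - D1 * D2" using n(2) by (rule four_dvd_square_diff)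
  then have d: "4 dvd D1 * D2 - n\<^sup>2" by (simp add: dvd_diff_commute)
  then show "D1 * D2 - n\<^sup>2 = 4 * ((D1 * D2 - n\<^sup>2) div 4)" by simp
  have "4 * ((D1 * D2 - n\<^sup>2) div 4) > 0" using d n(1) by simp
  then show "(D1 * D2 - n\<^sup>2) div 4 > 0" by simp
qed

lemma pair_count_formula:
  assumes "fund_disc D1" "fund_disc D2" "coprime D1 D2" "n \<in> S_set D1 D2"
  shows "int (pair_count D1 D2 n) = 2 * (\<Sum>d | d > 0 \<and> int d dvd (D1 * D2 - n\<^sup>2) div 4. eps D1 D2 d)"
    and "finite ({(q1, q2). bqf_disc q1 = D1 \<and> bqf_disc q2 = D2 \<and> B_Delta q1 q2 = n} // bqf_equiv2)"
proof -
  define N where "N = (D1 * D2 - n\<^sup>2) div 4"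
  interpret disc_pair D1 D2 n N unfolding N_def by (rule disc_pairI[OF assms])
  have "d > 0 \<and> int d dvd N \<longleftrightarrow> d dvd nat N" for d
  proof -
    have "int d dvd N \<longleftrightarrow> d dvd nat N" using N_pos int_dvd_int_iff[of d "nat N"] by simp
    moreover have "d dvd nat N \<Longrightarrow> d > 0" using N_pos by (intro Nat.gr0I) auto
    ultimately show ?thesis by blast
  qed
  then have "{d. d > 0 \<and> int d dvd N} = {d. d dvd nat N}" by blast
  then show "int (pair_count D1 D2 n) = 2 * (\<Sum>d | d > 0 \<and> int d dvd (D1 * D2 - n\<^sup>2) div 4. eps D1 D2 d)"
    using card_pair_classes(2) unfolding pair_count_def pairs_def N_def[symmetric] by simp
  show "finite ({(q1, q2). bqf_disc q1 = D1 \<and> bqf_disc q2 = D2 \<and> B_Delta q1 q2 = n} // bqf_equiv2)"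
    using card_pair_classes(1) unfolding pairs_def .
qed

section \<open>The Pell equation and class finiteness\<close>

text \<open>Dirichlet approximation: among finitely many solutions |k sqrt D - h| would have a
  positive minimum, which a finer approximation undercuts.\<close>

lemma infinite_small_norms:
  assumes D: "D > 0" and irr: "sqrt (of_int D) \<notin> \<rat>"
  shows "infinite {(h, k). k > 0 \<and> \<bar>real_of_int (h\<^sup>2 - D * k\<^sup>2)\<bar> < 2 * sqrt (of_int D) + 1}" (is "infinite ?S")
proof
  assume fin: "finite ?S"
  define \<theta> where "\<theta> = sqrt (real_of_int D)"
  have \<theta>: "\<theta> > 0" "\<theta>\<^sup>2 = of_int D" using D by (simp_all add: \<theta>_def)
  define d where "d = (\<lambda>(h, k). \<bar>real_of_int k * \<theta> - of_int h\<bar>)"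
  have dpos: "d s > 0" if s: "s \<in> ?S" for s
  proof -
    obtain h k where hk: "s = (h, k)" "k > 0" using s by auto
    have "real_of_int k * \<theta> \<noteq> of_int h"
    proof
      assume "real_of_int k * \<theta> = of_int h"
      then have "\<theta> = of_int h / of_int k" using hk by (simp add: field_simps)
      then show False using irr by (simp add: \<theta>_def)
    qed
    then show ?thesis by (simp add: d_def hk)
  qed
  have in_S: "\<exists>s\<in>?S. d s < 1 / of_nat M" if M: "M > 0" for M :: nat
  proof -
    obtain h k where hk: "0 < k" "k \<le> int M" "\<bar>of_int k * \<theta> - of_int h\<bar> < 1 / real M"
      using Dirichlet_approx[OF M] by metis
    define e where "e = of_int k * \<theta> - of_int h"
    have k1: "real_of_int k \<ge> 1" using hk by simp
    have "1 / real M \<le> 1 / of_int k" using hk by (simp add: frac_le)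
    then have e: "\<bar>e\<bar> < 1 / of_int k" using hk(3) by (simp add: e_def)
    also have "1 / of_int k \<le> (1::real)" using k1 by simp
    finally have e1: "\<bar>e\<bar> < 1" .
    have "real_of_int (h\<^sup>2 - D * k\<^sup>2) = e * (e - 2 * of_int k * \<theta>)"
      using \<theta>(2) unfolding e_def by (simp add: power2_eq_square algebra_simps)
    then have "\<bar>real_of_int (h\<^sup>2 - D * k\<^sup>2)\<bar> = \<bar>e\<bar> * \<bar>e - 2 * of_int k * \<theta>\<bar>" by (simp add: abs_mult)
    also have "\<dots> \<le> \<bar>e\<bar> * (1 + 2 * of_int k * \<theta>)"
    proof (rule mult_left_mono)
      have "\<bar>e - 2 * of_int k * \<theta>\<bar> \<le> \<bar>e\<bar> + \<bar>2 * of_int k * \<theta>\<bar>" by (rule abs_triangle_ineq4)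
      then show "\<bar>e - 2 * of_int k * \<theta>\<bar> \<le> 1 + 2 * of_int k * \<theta>" using e1 k1 \<theta>(1) by (simp add: abs_mult)
    qed simp
    also have "\<dots> < 1 / of_int k * (1 + 2 * of_int k * \<theta>)"
      using e k1 \<theta>(1) by (intro mult_strict_right_mono) (auto intro: add_pos_nonneg)
    also have "\<dots> = 1 / of_int k + 2 * \<theta>" using k1 by (simp add: field_simps)
    also have "\<dots> \<le> 2 * \<theta> + 1" using k1 by simp
    finally have "(h, k) \<in> ?S" using hk(1) by (simp add: \<theta>_def)
    moreover have "d (h, k) < 1 / real M" using hk(3) by (simp add: d_def)
    ultimately show ?thesis by blast
  qed
  define \<mu> where "\<mu> = Min (d ` ?S)"
  have ne: "?S \<noteq> {}" using in_S[of 1] by auto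
  have "\<mu> \<in> d ` ?S" unfolding \<mu>_def using fin ne by (intro Min_in) auto
  then have "\<mu> > 0" using dpos by auto
  then obtain M where M: "M > 0" "1 / real M < \<mu>" using reals_Archimedean[of \<mu>]
    by (metis inverse_eq_divide of_nat_Suc zero_less_Suc)
  obtain s where s: "s \<in> ?S" "d s < 1 / real M" using in_S[OF M(1)] by blast
  have "\<mu> \<le> d s" unfolding \<mu>_def using fin s(1) by (intro Min_le) auto
  then show False using s M by linarith
qed

text \<open>By the pigeonhole principle two elements of small norm have the same norm M and agree
  modulo M. Their quotient is then integral of norm 1, and doubling it gives a solution with
  right-hand side 4.\<close>

lemma pell_solutions_nonempty:
  assumes D: "D > 0" and irr: "sqrt (of_int D) \<notin> \<rat>"
  shows "pell_solutions D \<noteq> {}"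
proof -
  define S where "S = {(h, k). k > 0 \<and> \<bar>real_of_int (h\<^sup>2 - D * k\<^sup>2)\<bar> < 2 * sqrt (of_int D) + 1}"
  have inf: "infinite S" unfolding S_def by (rule infinite_small_norms[OF assms])
  define b where "b = \<lceil>2 * sqrt (real_of_int D) + 1\<rceil>"
  define m where "m = (\<lambda>(h, k). h\<^sup>2 - D * k\<^sup>2)"
  define f where "f s = (m s, fst s mod m s, snd s mod m s)" for s
  have m0: "m s \<noteq> 0" if "s \<in> S" for s
  proof
    assume "m s = 0"
    obtain h k where s: "s = (h, k)" by (cases s)
    then have hk: "s = (h, k)" "k > 0" using that by (simp_all add: S_def)
    then have "h\<^sup>2 = D * k\<^sup>2" using \<open>m s = 0\<close> by (simp add: m_def)
    then have "(of_int h / of_int k :: real)\<^sup>2 = of_int D"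
      using hk(2) by (simp add: power_divide field_simps flip: of_int_power of_int_mult)
    then have "sqrt (of_int D) = \<bar>of_int h / of_int k\<bar>" by (metis real_sqrt_abs)
    then show False using irr by (metis Rats_abs_iff Rats_divide Rats_of_int)
  qed
  have mb: "\<bar>m s\<bar> \<le> b" if "s \<in> S" for s
  proof -
    obtain h k where hk: "s = (h, k)" by (cases s)
    have "real_of_int \<bar>m s\<bar> < 2 * sqrt (of_int D) + 1" using that by (simp add: S_def m_def hk)
    then show ?thesis unfolding b_def by linarith
  qed
  have "f ` S \<subseteq> {- b..b} \<times> {- b..b} \<times> {- b..b}"
  proof
    fix y assume "y \<in> f ` S"
    then obtain s where s: "s \<in> S" "y = f s" by auto
    have r: "\<bar>x mod m s\<bar> \<le> b" for x
      using mb[OF s(1)] abs_mod_less[OF m0[OF s(1)], of x] by linarith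
    show "y \<in> {- b..b} \<times> {- b..b} \<times> {- b..b}"
      using mb[OF s(1)] r[of "fst s"] r[of "snd s"] unfolding s(2) f_def by (auto simp: abs_le_iff)
  qed
  then have "finite (f ` S)" by (rule finite_subset) auto
  then obtain s0 where s0: "s0 \<in> S" "infinite {s \<in> S. f s = f s0}"
    using pigeonhole_infinite[OF inf] by blast
  then obtain s where s: "s \<in> S" "f s = f s0" "s \<noteq> s0"
    by (metis (mono_tags, lifting) finite.emptyI finite_insert mem_Collect_eq finite_subset insertI1 subsetI)
  obtain h1 k1 h2 k2 where hk: "s = (h1, k1)" "s0 = (h2, k2)" by (cases s; cases s0)
  define M where "M = m s0"
  have M0: "M \<noteq> 0" using m0[OF s0(1)] M_def by simp
  have k: "k1 > 0" "k2 > 0" using s s0 by (simp_all add: S_def hk)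
  have e: "m s = m s0" "fst s mod m s = fst s0 mod m s0" "snd s mod m s = snd s0 mod m s0"
    using s(2) unfolding f_def prod.inject by blast+
  have eqs: "h1\<^sup>2 - D * k1\<^sup>2 = M" "h2\<^sup>2 - D * k2\<^sup>2 = M"
    using e(1) unfolding M_def hk by (simp_all add: m_def)
  have "fst s mod M = fst s0 mod M" "snd s mod M = snd s0 mod M"
    using e(2,3) unfolding e(1) M_def[symmetric] by blast+
  then have eqs': "h1 mod M = h2 mod M" "k1 mod M = k2 mod M" unfolding hk fst_conv snd_conv .
  have d: "M dvd h1 - h2" "M dvd k1 - k2" using eqs' by (simp_all only: mod_eq_dvd_iff)
  obtain x where x: "h1 - h2 = M * x" using d(1) by (rule dvdE)
  obtain y where y: "k1 - k2 = M * y" using d(2) by (rule dvdE)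
  have h1: "h1 = h2 + M * x" and k1: "k1 = k2 + M * y" using x y by simp_all
  \<comment> \<open>X - Y sqrt D is the quotient of h1 + k1 sqrt D by h2 + k2 sqrt D.\<close>
  define X Y where "X = 1 + x * h2 - D * y * k2" and "Y = x * k2 - h2 * y"
  have MX: "M * X = h1 * h2 - D * k1 * k2"
    unfolding X_def h1 k1 using eqs(2) by (simp add: power2_eq_square algebra_simps)
  have MY: "M * Y = h1 * k2 - h2 * k1"
    unfolding Y_def h1 k1 by (simp add: algebra_simps)
  have "M\<^sup>2 * (X\<^sup>2 - D * Y\<^sup>2) = (M * X)\<^sup>2 - D * (M * Y)\<^sup>2" by (simp add: power2_eq_square algebra_simps)
  also have "\<dots> = (h1\<^sup>2 - D * k1\<^sup>2) * (h2\<^sup>2 - D * k2\<^sup>2)"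
    unfolding MX MY by (simp add: power2_eq_square algebra_simps)
  also have "\<dots> = M\<^sup>2 * 1" unfolding eqs by (simp add: power2_eq_square)
  finally have XY: "X\<^sup>2 - D * Y\<^sup>2 = 1" using M0 by (simp only: mult_cancel_left) simp
  have Y0: "Y \<noteq> 0"
  proof
    assume "Y = 0"
    then have e: "h1 * k2 = h2 * k1" using MY by simp
    have "M * k2\<^sup>2 = (h1 * k2)\<^sup>2 - D * k1\<^sup>2 * k2\<^sup>2" unfolding eqs(1)[symmetric] by (simp add: power2_eq_square algebra_simps)
    also have "\<dots> = M * k1\<^sup>2" unfolding e eqs(2)[symmetric] by (simp add: power2_eq_square algebra_simps)
    finally have "k2\<^sup>2 = k1\<^sup>2" using M0 by simp
    then have "k2 = k1" using k by (simp add: power2_eq_iff)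
    then have "h1 = h2" using e k by simp
    then show False using s(3) hk \<open>k2 = k1\<close> by simp
  qed
  have X0: "X \<noteq> 0"
  proof
    assume "X = 0"
    then have "D * Y\<^sup>2 = -1" using XY by simp
    moreover have "D * Y\<^sup>2 \<ge> 0" using D by simp
    ultimately show False by simp
  qed
  have "(2 * \<bar>X\<bar>, 2 * \<bar>Y\<bar>) \<in> pell_solutions D"
    using XY X0 Y0 by (simp add: pell_solutions_def power_mult_distrib)
  then show ?thesis by blast
qed

text \<open>t grows with u along t^2 = 4 + D u^2, so the solution with least u is least in both
  coordinates, and the description in \<open>pell_min\<close> is unique.\<close>

lemma pell_min_spec:
  assumes D: "D > 0" and irr: "sqrt (of_int D) \<notin> \<rat>"
  shows "pell_min D \<in> pell_solutions D"
    and "\<And>s. s \<in> pell_solutions D \<Longrightarrow> fst (pell_min D) \<le> fst s \<and> snd (pell_min D) \<le> snd s"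
proof -
  obtain s0 where s0: "s0 \<in> pell_solutions D" using pell_solutions_nonempty[OF assms] by blast
  define s where "s = (ARG_MIN (\<lambda>s. nat (snd s)) s. s \<in> pell_solutions D)"
  have s: "s \<in> pell_solutions D" unfolding s_def by (rule arg_min_natI[where P = "\<lambda>s. s \<in> pell_solutions D", OF s0])
  have le: "nat (snd s) \<le> nat (snd s')" if "s' \<in> pell_solutions D" for s'
    unfolding s_def by (rule arg_min_nat_le[where P = "\<lambda>s. s \<in> pell_solutions D", OF that])
  have min: "fst s \<le> fst s' \<and> snd s \<le> snd s'" if s': "s' \<in> pell_solutions D" for s'
  proof -
    obtain t u t' u' where c: "s = (t, u)" "s' = (t', u')" by (cases s; cases s')
    have p: "t > 0" "u > 0" "t\<^sup>2 - D * u\<^sup>2 = 4" "t' > 0" "u' > 0" "t'\<^sup>2 - D * u'\<^sup>2 = 4"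
      using s s' by (auto simp: pell_solutions_def c)
    have u: "u \<le> u'" using le[OF s'] p by (simp add: c)
    then have "u\<^sup>2 \<le> u'\<^sup>2" using p by (intro power_mono) auto
    then have "D * u\<^sup>2 \<le> D * u'\<^sup>2" using D by simp
    then have "t\<^sup>2 \<le> t'\<^sup>2" using p by linarith
    then have "t \<le> t'" by (rule power2_le_imp_le) (use p(4) in simp)
    then show ?thesis using u c by simp
  qed
  have "pell_min D = s"
    unfolding pell_min_def
  proof (rule the_equality)
    show "s \<in> pell_solutions D \<and> (\<forall>s'\<in>pell_solutions D. fst s \<le> fst s' \<and> snd s \<le> snd s')" using s min by blast
    fix r assume r: "r \<in> pell_solutions D \<and> (\<forall>s'\<in>pell_solutions D. fst r \<le> fst s' \<and> snd r \<le> snd s')"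
    then have "fst r = fst s" "snd r = snd s" using s min[of r] by (auto intro: antisym)
    then show "r = s" by (simp add: prod_eq_iff)
  qed
  then show "pell_min D \<in> pell_solutions D"
    "\<And>s. s \<in> pell_solutions D \<Longrightarrow> fst (pell_min D) \<le> fst s \<and> snd (pell_min D) \<le> snd s"
    using s min by auto
qed

text \<open>Take |A| minimal in the class and reduce B modulo 2 A; exchanging the variables shows
  |A| <= |C|. Then B^2 <= |A C|, so D > 0 forces A C < 0, and 4 |A C| <= D bounds
  everything.\<close>

lemma reduced_form_exists:
  assumes D: "fund_disc D" and q: "bqf_disc q = D"
  obtains q' where "(q, q') \<in> bqf_equiv" "\<bar>coefA q'\<bar> \<le> D" "\<bar>coefB q'\<bar> \<le> D" "\<bar>coefC q'\<bar> \<le> D"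
proof -
  define P where "P q' \<longleftrightarrow> (q, q') \<in> bqf_equiv" for q'
  have refl: "P q" using equiv_bqf_equiv unfolding P_def equiv_def refl_on_def by blast
  have trans: "P q2" if "P q1" "g \<in> Gamma" "q2 = bqf_act g q1" for q1 q2 g
  proof -
    have "(q1, q2) \<in> bqf_equiv" using that by (auto simp: bqf_equiv_def)
    then show ?thesis using that(1) equiv_bqf_equiv unfolding P_def equiv_def by (meson transD)
  qed
  have disc: "bqf_disc q' = D" if "P q'" for q'
    using that q by (auto simp: P_def bqf_equiv_def bqf_disc_act Gamma_iff)
  define q0 where "q0 = (ARG_MIN (\<lambda>q'. nat \<bar>coefA q'\<bar>) q'. P q')"
  have P0: "P q0" unfolding q0_def by (rule arg_min_natI[of P, OF refl])
  have min: "nat \<bar>coefA q0\<bar> \<le> nat \<bar>coefA q'\<bar>" if "P q'" for q'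
    unfolding q0_def by (rule arg_min_nat_le[of P, OF that])
  have nz: "coefA q' \<noteq> 0" if "bqf_disc q' = D" for q'
    using that fund_disc_not_square[OF D, of 1 "coefB q'"] by (auto simp: bqf_disc_def)
  obtain A B0 C0 where q0: "q0 = BQF A B0 C0" by (cases q0)
  have A0: "A \<noteq> 0" using nz[OF disc[OF P0]] q0 by simp
  obtain k where k: "\<bar>B0 + 2 * A * k\<bar> \<le> \<bar>A\<bar>" using exists_small_shift[OF A0] .
  define B C where "B = B0 + 2 * A * k" and "C = A * k\<^sup>2 + B0 * k + C0"
  have act: "bqf_act (1, k, 0, 1) q0 = BQF A B C" by (simp add: q0 B_def C_def)
  have P1: "P (BQF A B C)" by (rule trans[OF P0 _ act[symmetric]]) (simp add: Gamma_def)
  have P2: "P (BQF C (- B) A)" by (rule trans[OF P1, of "(0, -1, 1, 0)"]) (simp_all add: Gamma_def)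
  have AC: "\<bar>A\<bar> \<le> \<bar>C\<bar>" using min[OF P2] q0 by simp
  have D4: "D = B\<^sup>2 - 4 * A * C" using disc[OF P1] by (simp add: bqf_disc_def)
  have C0: "C \<noteq> 0" using nz[OF disc[OF P2]] by simp
  have "B\<^sup>2 \<le> A\<^sup>2" using k unfolding B_def by (rule square_le_abs)
  also have "A\<^sup>2 \<le> \<bar>A * C\<bar>" using AC by (rule square_le_abs_mult)
  finally have BAC: "B\<^sup>2 \<le> \<bar>A * C\<bar>" .
  have Dpos: "D > 0" using D by (simp add: fund_disc_def)
  have neg: "A * C < 0"
  proof (rule ccontr)
    assume "\<not> A * C < 0"
    then have "B\<^sup>2 \<le> A * C" "A * C \<ge> 0" using BAC by simp_all
    then show False using D4 Dpos by simp
  qed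
  then have "4 * \<bar>A * C\<bar> \<le> D" using D4 by simp
  moreover have "\<bar>A\<bar> * 1 \<le> \<bar>A\<bar> * \<bar>C\<bar>" "1 * \<bar>C\<bar> \<le> \<bar>A\<bar> * \<bar>C\<bar>"
    using A0 C0 by (intro mult_left_mono mult_right_mono; simp)+
  ultimately have "\<bar>A\<bar> \<le> D" "\<bar>C\<bar> \<le> D" by (simp_all add: abs_mult)
  moreover have "\<bar>B\<bar> \<le> D" using k \<open>\<bar>A\<bar> \<le> D\<close> unfolding B_def by simp
  ultimately show thesis using that[of "BQF A B C"] P1 by (simp add: P_def)
qed

text \<open>Over an infinite set of classes the sums in \<open>total_int_num\<close> would be 0 by
  convention.\<close>

lemma finite_Cl_plus:
  assumes "fund_disc D"
  shows "finite (Cl_plus D)"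
proof -
  define R where "R = (\<lambda>(a, b, c). BQF a b c) ` ({- D..D} \<times> {- D..D} \<times> {- D..D})"
  have "Cl_plus D \<subseteq> (\<lambda>q. bqf_equiv `` {q}) ` R"
  proof
    fix K assume "K \<in> Cl_plus D"
    then obtain q where q: "bqf_disc q = D" "K = bqf_equiv `` {q}" unfolding Cl_plus_def by (auto elim!: quotientE)
    obtain q' where q': "(q, q') \<in> bqf_equiv" "\<bar>coefA q'\<bar> \<le> D" "\<bar>coefB q'\<bar> \<le> D" "\<bar>coefC q'\<bar> \<le> D"
      using reduced_form_exists[OF assms q(1)] .
    have "K = bqf_equiv `` {q'}" unfolding q(2) by (rule equiv_class_eq[OF equiv_bqf_equiv q'(1)])
    moreover have "q' \<in> R" using q'(2-4) unfolding R_def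
      by (intro image_eqI[of _ _ "(coefA q', coefB q', coefC q')"]) (auto simp: abs_le_iff)
    ultimately show "K \<in> (\<lambda>q. bqf_equiv `` {q}) ` R" by blast
  qed
  then show ?thesis by (rule finite_subset) (simp add: R_def)
qed

section \<open>Geodesics\<close>

locale fund_form =
  fixes q :: bqf
  assumes fund: "fund_disc (bqf_disc q)"
begin

abbreviation "A \<equiv> real_of_int (coefA q)"
abbreviation "B \<equiv> real_of_int (coefB q)"
abbreviation "C \<equiv> real_of_int (coefC q)"
abbreviation "\<delta> \<equiv> sqrt (of_int (bqf_disc q))"
abbreviation "f \<equiv> first_root q"
abbreviation "s \<equiv> second_root q"

lemma disc_pos: "bqf_disc q > 0" and delta_irrational: "\<delta> \<notin> \<rat>"
  using fund by (simp_all add: fund_disc_def)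

lemma delta_pos: "\<delta> > 0"
  using disc_pos by simp

lemma delta_square: "\<delta>\<^sup>2 = B\<^sup>2 - 4 * A * C"
proof -
  have "\<delta>\<^sup>2 = of_int (bqf_disc q)" using disc_pos by simp
  then show ?thesis by (simp add: bqf_disc_def)
qed

lemma leading_nonzero: "A \<noteq> 0"
  using fund_disc_not_square[OF fund, of 1 "coefB q"] by (auto simp: bqf_disc_def)

lemma first_root_eq: "2 * A * f = \<delta> - B" and second_root_eq: "2 * A * s = - \<delta> - B"
  using leading_nonzero by (simp_all add: first_root_def second_root_def)

lemma roots_diff: "A * (f - s) = \<delta>" and roots_sum: "A * (f + s) = - B"
  using first_root_eq second_root_eq by (simp_all add: algebra_simps)

lemma roots_prod: "A * (f * s) = C"
proof -
  have "4 * A * (A * (f * s)) = (2 * A * f) * (2 * A * s)" by simp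
  also have "\<dots> = 4 * A * C"
    unfolding first_root_eq second_root_eq using delta_square by (simp add: power2_eq_square algebra_simps)
  finally show ?thesis using leading_nonzero by simp
qed

lemma roots_distinct: "f \<noteq> s"
  using roots_diff delta_pos by auto

lemma root_conditions: "A * f\<^sup>2 + B * f + C = 0" "A * s\<^sup>2 + B * s + C = 0"
proof -
  have B: "B = - A * (f + s)" and C: "C = A * (f * s)" using roots_sum roots_prod by simp_all
  show "A * f\<^sup>2 + B * f + C = 0" "A * s\<^sup>2 + B * s + C = 0"
    unfolding B C by (simp_all add: power2_eq_square algebra_simps)
qed

lemma irrational_root: "f \<notin> \<rat>" "s \<notin> \<rat>"
proof -
  show "f \<notin> \<rat>"
  proof
    assume "f \<in> \<rat>"
    then have "2 * A * f + B \<in> \<rat>" by (intro Rats_add Rats_mult) auto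
    then show False using first_root_eq delta_irrational by simp
  qed
  show "s \<notin> \<rat>"
  proof
    assume "s \<in> \<rat>"
    then have "- (2 * A * s + B) \<in> \<rat>" by (intro Rats_minus_iff[THEN iffD2] Rats_add Rats_mult) auto
    then show False using second_root_eq delta_irrational by simp
  qed
qed

lemma geod_points_iff:
  "z \<in> geod_points (root_geod q) \<longleftrightarrow> Im z > 0 \<and> (Im z)\<^sup>2 = (Re z - s) * (f - Re z)"
proof -
  have "dist z (geod_center (s, f)) = \<bar>f - s\<bar> / 2 \<longleftrightarrow> (dist z (geod_center (s, f)))\<^sup>2 = (\<bar>f - s\<bar> / 2)\<^sup>2"
    by (simp add: power2_eq_iff_nonneg)
  also have "(dist z (geod_center (s, f)))\<^sup>2 = (Re z - (s + f) / 2)\<^sup>2 + (Im z)\<^sup>2"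
    by (simp add: dist_norm cmod_power2)
  also have "(\<bar>f - s\<bar> / 2)\<^sup>2 = ((f - s) / 2)\<^sup>2" by (simp add: power_divide)
  also have "(Re z - (s + f) / 2)\<^sup>2 + (Im z)\<^sup>2 = ((f - s) / 2)\<^sup>2 \<longleftrightarrow> (Im z)\<^sup>2 = (Re z - s) * (f - Re z)"
  proof -
    have "(Re z - (s + f) / 2)\<^sup>2 - ((f - s) / 2)\<^sup>2 = - ((Re z - s) * (f - Re z))"
      by (simp add: power2_eq_square field_simps)
    then show ?thesis by linarith
  qed
  finally show ?thesis by (simp add: root_geod_def)
qed

text \<open>This equation of the semicircle is symmetric in the two roots and transforms under
  \<open>Gamma\<close> like the form itself.\<close>

lemma geod_points_form_iff:
  "z \<in> geod_points (root_geod q) \<longleftrightarrow> Im z > 0 \<and> A * ((Re z)\<^sup>2 + (Im z)\<^sup>2) + B * Re z + C = 0"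
proof -
  have "A * ((Re z)\<^sup>2 + (Im z)\<^sup>2) + B * Re z + C = A * ((Im z)\<^sup>2 - (Re z - s) * (f - Re z))"
  proof -
    have B: "B = - A * (f + s)" and C: "C = A * (f * s)" using roots_sum roots_prod by simp_all
    show ?thesis unfolding B C by (simp add: power2_eq_square algebra_simps)
  qed
  then show ?thesis using leading_nonzero unfolding geod_points_iff by simp
qed

lemma geod_points_nonempty: "geod_points (root_geod q) \<noteq> {}"
proof -
  have "Complex ((s + f) / 2) (\<bar>f - s\<bar> / 2) \<in> geod_points (root_geod q)"
    unfolding geod_points_iff using roots_distinct by (simp add: power2_eq_square field_simps)
  then show ?thesis by blast
qed

text \<open>A coordinate on the geodesic that increases from \<open>0\<close> at \<open>s\<close> to infinity at \<open>f\<close>.\<close>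

definition height :: "complex \<Rightarrow> real" where
  "height z = (Re z - s) / (f - Re z)"

lemma height_facts:
  assumes "z \<in> geod_points (root_geod q)"
  shows "(Re z - s) * (f - Re z) > 0" "height z > 0"
proof -
  show "(Re z - s) * (f - Re z) > 0" using assms unfolding geod_points_iff by (metis zero_less_power)
  then show "height z > 0" unfolding height_def by (simp add: zero_less_mult_iff zero_less_divide_iff)
qed

text \<open>The factor f - s treats both orientations at once: along the geodesic the real part runs
  from s to f.\<close>

lemma height_less_iff:
  assumes z: "z \<in> geod_points (root_geod q)" and w: "w \<in> geod_points (root_geod q)"
  shows "height z < height w \<longleftrightarrow> (f - s) * (Re z - Re w) < 0"
proof -
  have pz: "(Re z - s) * (f - Re z) > 0" and pw: "(Re w - s) * (f - Re w) > 0"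
    using height_facts z w by blast+
  have same: "(f - Re z) * (f - Re w) > 0"
  proof -
    have "(f - Re z > 0 \<and> Re z - s > 0) \<or> (f - Re z < 0 \<and> Re z - s < 0)"
      "(f - Re w > 0 \<and> Re w - s > 0) \<or> (f - Re w < 0 \<and> Re w - s < 0)"
      using pz pw by (auto simp: zero_less_mult_iff)
    then show ?thesis by (auto simp: zero_less_mult_iff)
  qed
  have nz: "f - Re z \<noteq> 0" "f - Re w \<noteq> 0" using same by auto
  have "height z - height w = (f - s) * (Re z - Re w) / ((f - Re z) * (f - Re w))"
    unfolding height_def using nz by (simp add: field_simps)
  then have "height z - height w < 0 \<longleftrightarrow> (f - s) * (Re z - Re w) < 0"
    using same by (simp add: divide_less_0_iff)
  then show ?thesis by simp
qed

lemma height_eq_iff: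
  assumes z: "z \<in> geod_points (root_geod q)" and w: "w \<in> geod_points (root_geod q)"
  shows "height z = height w \<longleftrightarrow> z = w"
proof
  assume h: "height z = height w"
  have "\<not> (f - s) * (Re z - Re w) < 0" "\<not> (f - s) * (Re w - Re z) < 0"
    using h height_less_iff[OF z w] height_less_iff[OF w z] by simp_all
  then have "(f - s) * (Re z - Re w) = 0" by (simp add: algebra_simps)
  then have re: "Re z = Re w" using roots_distinct by simp
  then have "(Im z)\<^sup>2 = (Im w)\<^sup>2" "Im z > 0" "Im w > 0" using z w unfolding geod_points_iff by simp_all
  then have "Im z = Im w" by (simp add: power2_eq_iff)
  then show "z = w" using re by (simp add: complex_eq_iff)
qed simp

lemma geod_segment_iff:
  assumes z: "z \<in> geod_points (root_geod q)" and w: "w \<in> geod_points (root_geod q)" and lt: "height z < height w"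
  shows "P \<in> geod_segment (root_geod q) z w \<longleftrightarrow> P \<in> geod_points (root_geod q) \<and> height z \<le> height P \<and> height P < height w"
proof (cases "P \<in> geod_points (root_geod q)")
  case True
  have "Re P \<in> closed_segment (Re z) (Re w) \<longleftrightarrow> height z \<le> height P \<and> height P \<le> height w"
  proof (cases "f > s")
    case True
    then have "(f - s) * (a - b) < 0 \<longleftrightarrow> a < b" for a b by (simp add: mult_less_0_iff)
    then have "Re z < Re w" "height P < height z \<longleftrightarrow> Re P < Re z" "height w < height P \<longleftrightarrow> Re w < Re P"
      using lt z w \<open>P \<in> _\<close> by (simp_all add: height_less_iff)
    then show ?thesis by (auto simp: closed_segment_eq_real_ivl not_less[symmetric])
  next
    case False
    then have "f - s < 0" using roots_distinct by simp
    then have "(f - s) * (a - b) < 0 \<longleftrightarrow> b < a" for a b by (simp add: mult_less_0_iff)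
    then have "Re w < Re z" "height P < height z \<longleftrightarrow> Re z < Re P" "height w < height P \<longleftrightarrow> Re P < Re w"
      using lt z w \<open>P \<in> _\<close> by (simp_all add: height_less_iff)
    then show ?thesis by (auto simp: closed_segment_eq_real_ivl not_less[symmetric])
  qed
  then show ?thesis using True height_eq_iff[OF True w] by (auto simp: geod_segment_def)
next
  case False
  then show ?thesis by (auto simp: geod_segment_def)
qed

end

section \<open>Moebius transformations of points, geodesics and roots\<close>

lemma moebius_denominator:
  fixes c d :: int
  assumes "Im z > 0" "(c, d) \<noteq> (0, 0)"
  shows "of_int c * z + of_int d \<noteq> 0"
proof
  assume e: "of_int c * z + of_int d = 0"
  then have "Im (of_int c * z + of_int d) = 0" by simp
  then have "c = 0" using assms(1) by simp
  then show False using e assms(2) by simp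
qed

lemma moebius_coordinates:
  assumes z: "Im z > 0" and g: "(a, b, c, d) \<in> Gamma"
  defines "M \<equiv> (of_int c * Re z + of_int d)\<^sup>2 + (of_int c * Im z)\<^sup>2"
  shows "M > 0"
    and "Re (moebius (a, b, c, d) z) = ((of_int a * Re z + of_int b) * (of_int c * Re z + of_int d) + of_int a * of_int c * (Im z)\<^sup>2) / M"
    and "Im (moebius (a, b, c, d) z) = Im z / M"
    and "(Re (moebius (a, b, c, d) z))\<^sup>2 + (Im (moebius (a, b, c, d) z))\<^sup>2 = ((of_int a * Re z + of_int b)\<^sup>2 + (of_int a * Im z)\<^sup>2) / M"
proof -
  have ne: "(c, d) \<noteq> (0, 0)" using g by (auto simp: Gamma_def)
  define w where "w = of_int c * z + of_int d"
  have w0: "w \<noteq> 0" unfolding w_def by (rule moebius_denominator[OF z ne])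
  have M: "M = (Re w)\<^sup>2 + (Im w)\<^sup>2" by (simp add: M_def w_def)
  show M0: "M > 0" unfolding M using w0 by (simp add: complex_eq_iff sum_power2_gt_zero_iff)
  have det: "real_of_int a * of_int d - of_int b * of_int c = 1"
  proof -
    have "a * d - b * c = 1" using g by (simp add: Gamma_def)
    then have "real_of_int (a * d - b * c) = 1" by simp
    then show ?thesis by simp
  qed
  show "Re (moebius (a, b, c, d) z) = ((of_int a * Re z + of_int b) * (of_int c * Re z + of_int d) + of_int a * of_int c * (Im z)\<^sup>2) / M"
    by (simp add: Re_divide M_def power2_eq_square algebra_simps)
  have "Im (moebius (a, b, c, d) z) = ((of_int a * of_int d - of_int b * of_int c) * Im z) / M"
    by (simp add: Im_divide M_def power2_eq_square algebra_simps)
  then show "Im (moebius (a, b, c, d) z) = Im z / M" unfolding det by simp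
  have "(Re (moebius (a, b, c, d) z))\<^sup>2 + (Im (moebius (a, b, c, d) z))\<^sup>2 = (cmod (moebius (a, b, c, d) z))\<^sup>2"
    by (simp add: cmod_power2)
  also have "\<dots> = (cmod (of_int a * z + of_int b))\<^sup>2 / (cmod w)\<^sup>2"
    by (simp add: w_def norm_divide power_divide)
  finally show "(Re (moebius (a, b, c, d) z))\<^sup>2 + (Im (moebius (a, b, c, d) z))\<^sup>2 = ((of_int a * Re z + of_int b)\<^sup>2 + (of_int a * Im z)\<^sup>2) / M"
    unfolding cmod_power2 M by simp
qed

lemma moebius_adj:
  assumes z: "Im z > 0" and g: "g \<in> Gamma"
  shows "moebius g (moebius (mat_adj g) z) = z"
proof -
  obtain a b c d where gc: "g = (a, b, c, d)" by (cases g)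
  have det: "a * d - b * c = 1" using g by (simp add: gc Gamma_def)
  have detc: "of_int a * of_int d - of_int b * of_int c = (1::complex)"
    using arg_cong[OF det, of "of_int :: int \<Rightarrow> complex"] by simp
  have ne: "(- c, a) \<noteq> (0, 0)" using det by auto
  define w where "w = of_int (- c) * z + of_int a"
  have w0: "w \<noteq> 0" unfolding w_def by (rule moebius_denominator[OF z ne])
  have num: "of_int a * (of_int d * z - of_int b) + of_int b * w = z"
  proof -
    have "of_int a * (of_int d * z - of_int b) + of_int b * w = (of_int a * of_int d - of_int b * of_int c) * z"
      by (simp add: w_def algebra_simps)
    then show ?thesis unfolding detc by simp
  qed
  have den: "of_int c * (of_int d * z - of_int b) + of_int d * w = 1"
  proof -
    have "of_int c * (of_int d * z - of_int b) + of_int d * w = of_int a * of_int d - of_int b * of_int c"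
      by (simp add: w_def algebra_simps)
    then show ?thesis unfolding detc .
  qed
  have m: "moebius (mat_adj g) z = (of_int d * z - of_int b) / w" by (simp add: gc w_def)
  have "of_int a * ((of_int d * z - of_int b) / w) + of_int b = z / w"
    using w0 num by (simp add: field_simps)
  moreover have "of_int c * ((of_int d * z - of_int b) / w) + of_int d = 1 / w"
    using w0 den by (simp add: field_simps)
  moreover have "moebius g (moebius (mat_adj g) z) =
    (of_int a * ((of_int d * z - of_int b) / w) + of_int b) / (of_int c * ((of_int d * z - of_int b) / w) + of_int d)"
    unfolding m by (simp add: gc)
  ultimately show ?thesis using w0 by simp
qed

lemma fund_form_act: "fund_form q \<Longrightarrow> g \<in> Gamma \<Longrightarrow> fund_form (bqf_act g q)"
  by (simp add: fund_form_def bqf_disc_act Gamma_iff)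

lemma moebius_Im_pos: "Im z > 0 \<Longrightarrow> g \<in> Gamma \<Longrightarrow> Im (moebius g z) > 0"
  using moebius_coordinates(1,3)[of z] by (cases g) (simp del: moebius.simps)

text \<open>As forms are acted on from the right, g carries the geodesic of
  \<open>bqf_act g q\<close> to that of q, and not the other way round.\<close>

lemma moebius_geod_points:
  assumes q: "fund_form q" and g: "g \<in> Gamma" and z: "Im z > 0"
  shows "moebius g z \<in> geod_points (root_geod q) \<longleftrightarrow> z \<in> geod_points (root_geod (bqf_act g q))"
proof -
  obtain A B C where qc: "q = BQF A B C" by (cases q)
  obtain a b c d where gc: "g = (a, b, c, d)" by (cases g)
  define x y where "x = Re z" and "y = Im z"
  define M where "M = (of_int c * x + of_int d)\<^sup>2 + (of_int c * y)\<^sup>2"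
  define w where "w = moebius g z"
  note co = moebius_coordinates[OF z g[unfolded gc], folded gc, folded w_def, folded x_def y_def, folded M_def]
  have wIm: "Im w > 0" unfolding w_def by (rule moebius_Im_pos[OF z g])
  define k r where "k = (of_int a * x + of_int b) * (of_int c * x + of_int d) + of_int a * of_int c * y\<^sup>2"
    and "r = (of_int a * x + of_int b)\<^sup>2 + (of_int a * y)\<^sup>2"
  have 1: "Re w = k / M" unfolding k_def by (rule co)
  have 2: "(Re w)\<^sup>2 + (Im w)\<^sup>2 = r / M" unfolding r_def by (rule co)
  have "of_int A * ((Re w)\<^sup>2 + (Im w)\<^sup>2) + of_int B * Re w + of_int C = of_int A * (r / M) + of_int B * (k / M) + of_int C"
    by (subst 2, subst 1, rule refl)
  also have "\<dots> = (of_int A * r + of_int B * k + of_int C * M) / M" using co(1) by (simp add: field_simps)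
  also have "\<dots> = (of_int (coefA (bqf_act g q)) * (x\<^sup>2 + y\<^sup>2) + of_int (coefB (bqf_act g q)) * x + of_int (coefC (bqf_act g q))) / M"
    unfolding qc gc k_def r_def by (simp add: M_def power2_eq_square algebra_simps)
  finally have "of_int A * ((Re w)\<^sup>2 + (Im w)\<^sup>2) + of_int B * Re w + of_int C = 0 \<longleftrightarrow>
    of_int (coefA (bqf_act g q)) * (x\<^sup>2 + y\<^sup>2) + of_int (coefB (bqf_act g q)) * x + of_int (coefC (bqf_act g q)) = 0"
    using co(1) by simp
  then show ?thesis
    unfolding fund_form.geod_points_form_iff[OF q] fund_form.geod_points_form_iff[OF fund_form_act[OF q g]]
    using wIm z by (simp add: w_def x_def y_def qc del: moebius.simps)
qed

text \<open>The slope 2 A x + B is sqrt D at the first root and - sqrt D at the second. It obeys the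
  chain rule under g, so first roots go to first roots and the orientation is preserved.\<close>

lemma moebius_roots:
  assumes q: "fund_form q" and g: "g \<in> Gamma"
  shows "moebius g (first_root (bqf_act g q)) = first_root q"
    and "moebius g (second_root (bqf_act g q)) = second_root q"
proof -
  obtain A B C where qc: "q = BQF A B C" by (cases q)
  obtain a b c d where gc: "g = (a, b, c, d)" by (cases g)
  interpret q: fund_form q by (rule q)
  interpret q': fund_form "bqf_act g q" by (rule fund_form_act[OF q g])
  have det: "a * d - b * c = 1" using g by (simp add: gc Gamma_def)
  have det': "real_of_int a * of_int d - of_int b * of_int c = 1"
    using arg_cong[OF det, of real_of_int] by simp
  have disc: "bqf_disc (bqf_act g q) = bqf_disc q" using g by (simp add: bqf_disc_act Gamma_iff)
  have key: "moebius g x = y"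
    if x: "q'.A * x\<^sup>2 + q'.B * x + q'.C = 0" "2 * q'.A * x + q'.B = e" "x \<notin> \<rat>" and y: "2 * q.A * y + q.B = e" for x y e
  proof -
    have den: "of_int c * x + of_int d \<noteq> 0"
    proof
      assume e: "of_int c * x + of_int d = 0"
      show False
      proof (cases "c = 0")
        case True
        then show False using e det by simp
      next
        case False
        then have "x = of_int (- d) / of_int c" using e by (simp add: field_simps eq_neg_iff_add_eq_0)
        then show False using x(3) by (metis Rats_divide Rats_of_int)
      qed
    qed
    have "(2 * q'.A * x + q'.B) * (of_int c * x + of_int d) - 2 * of_int c * (q'.A * x\<^sup>2 + q'.B * x + q'.C)
      = (of_int a * of_int d - of_int b * of_int c) * (2 * q.A * (of_int a * x + of_int b) + q.B * (of_int c * x + of_int d))"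
      unfolding qc gc by (simp add: power2_eq_square algebra_simps)
    then have "e * (of_int c * x + of_int d) = 2 * q.A * (of_int a * x + of_int b) + q.B * (of_int c * x + of_int d)"
      unfolding x(1,2) det' by simp
    then have "2 * q.A * ((of_int a * x + of_int b) / (of_int c * x + of_int d)) = e - q.B"
      using den by (simp add: field_simps)
    also have "e - q.B = 2 * q.A * y" using y by simp
    finally have "(of_int a * x + of_int b) / (of_int c * x + of_int d) = y"
      using q.leading_nonzero by (metis mult_eq_0_iff mult_left_cancel zero_neq_numeral)
    then show ?thesis by (simp add: gc)
  qed
  show "moebius g (first_root (bqf_act g q)) = first_root q"
    by (rule key[where e = q.\<delta>])
       (use q'.root_conditions q'.first_root_eq q.first_root_eq q'.irrational_root disc in simp_all)
  show "moebius g (second_root (bqf_act g q)) = second_root q"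
    by (rule key[where e = "- q.\<delta>"])
       (use q'.root_conditions q'.second_root_eq q.second_root_eq q'.irrational_root disc in simp_all)
qed

lemma geod_act_root_geod:
  assumes "fund_form q" "g \<in> Gamma"
  shows "geod_act g (root_geod (bqf_act g q)) = root_geod q"
  using moebius_roots[OF assms] by (simp add: root_geod_def)

text \<open>Together with \<open>root_geod_inject\<close> this turns oriented geodesics into forms;
  q and -q share a semicircle but have opposite orientations.\<close>

lemma translates_root_geod:
  assumes q: "fund_form q"
  shows "(\<lambda>g. geod_act g (root_geod q)) ` Gamma = root_geod ` (bqf_equiv `` {q})"
proof
  show "(\<lambda>g. geod_act g (root_geod q)) ` Gamma \<subseteq> root_geod ` (bqf_equiv `` {q})"
  proof
    fix l assume "l \<in> (\<lambda>g. geod_act g (root_geod q)) ` Gamma"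
    then obtain g where g: "g \<in> Gamma" "l = geod_act g (root_geod q)" by blast
    define q' where "q' = bqf_act (mat_adj g) q"
    have "bqf_act g q' = q" unfolding q'_def using g(1) by (simp add: bqf_act_adj' Gamma_iff)
    then have "l = root_geod q'"
      using geod_act_root_geod[OF fund_form_act[OF q Gamma_adj[OF g(1)]] g(1)] g(2) unfolding q'_def by simp
    moreover have "(q, q') \<in> bqf_equiv" unfolding bqf_equiv_def q'_def using Gamma_adj[OF g(1)] by blast
    ultimately show "l \<in> root_geod ` (bqf_equiv `` {q})" by blast
  qed
  show "root_geod ` (bqf_equiv `` {q}) \<subseteq> (\<lambda>g. geod_act g (root_geod q)) ` Gamma"
  proof
    fix l assume "l \<in> root_geod ` (bqf_equiv `` {q})"
    then obtain g where g: "g \<in> Gamma" "l = root_geod (bqf_act g q)" by (auto simp: bqf_equiv_def)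
    have "geod_act (mat_adj g) (root_geod (bqf_act (mat_adj g) (bqf_act g q))) = root_geod (bqf_act g q)"
      by (rule geod_act_root_geod[OF fund_form_act[OF q g(1)] Gamma_adj[OF g(1)]])
    then have "l = geod_act (mat_adj g) (root_geod q)" using g by (simp add: Gamma_act_adj)
    then show "l \<in> (\<lambda>g. geod_act g (root_geod q)) ` Gamma" using Gamma_adj[OF g(1)] by blast
  qed
qed

lemma root_geod_inject:
  assumes "fund_form q" "fund_form q'" "bqf_disc q = bqf_disc q'" "root_geod q = root_geod q'"
  shows "q = q'"
proof -
  interpret q: fund_form q by fact
  interpret q': fund_form q' by fact
  have e: "first_root q' = q.f" "second_root q' = q.s" using assms(4) by (simp_all add: root_geod_def)
  have "q.A * (q.f - q.s) = q'.A * (q.f - q.s)" using q.roots_diff q'.roots_diff assms(3) unfolding e by simp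
  then have A: "q.A = q'.A" using q.roots_distinct by simp
  have "q.B = q'.B" "q.C = q'.C"
    using q.roots_sum q'.roots_sum q.roots_prod q'.roots_prod unfolding e A by simp_all
  then show ?thesis using A by (cases q; cases q') simp
qed

text \<open>At a common point P both tangent vectors have real part - Im P, so they are parallel
  only if equal, that is, if the semicircles are concentric.\<close>

lemma transverse_at_iff:
  assumes "fund_form q1" "fund_form q2"
  shows "transverse_at (root_geod q1) (root_geod q2) P \<longleftrightarrow>
    P \<in> geod_points (root_geod q1) \<and> P \<in> geod_points (root_geod q2) \<and>
    coefA q1 * coefB q2 - coefA q2 * coefB q1 \<noteq> 0"
proof (cases "P \<in> geod_points (root_geod q1) \<and> P \<in> geod_points (root_geod q2)")
  case True
  interpret q1: fund_form q1 by fact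
  interpret q2: fund_form q2 by fact
  define c1 c2 where "c1 = (q1.s + q1.f) / 2" and "c2 = (q2.s + q2.f) / 2"
  have y: "Im P > 0" using True q1.geod_points_iff by simp
  define t1 t2 where "t1 = geod_tangent (root_geod q1) P" and "t2 = geod_tangent (root_geod q2) P"
  have t: "t1 = Complex (- Im P) (Re P - c1)" "t2 = Complex (- Im P) (Re P - c2)"
    unfolding t1_def t2_def geod_tangent_def root_geod_def c1_def c2_def by (simp_all add: complex_eq_iff)
  have nz: "t1 \<noteq> 0" "t2 \<noteq> 0" using y by (simp_all add: t complex_eq_iff)
  have "collinear {0, t1, t2} \<longleftrightarrow> (\<exists>c. t2 = c *\<^sub>R t1)" using nz by (simp add: collinear_lemma)
  also have "\<dots> \<longleftrightarrow> c1 = c2"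
  proof
    assume "\<exists>c. t2 = c *\<^sub>R t1"
    then obtain c where "t2 = c *\<^sub>R t1" by blast
    then have c: "Im P = c * Im P" "Re P - c2 = c * (Re P - c1)" by (simp_all add: t complex_eq_iff)
    then have "c = 1" using y by simp
    then show "c1 = c2" using c(2) by simp
  next
    assume "c1 = c2"
    then have "t2 = 1 *\<^sub>R t1" by (simp add: t)
    then show "\<exists>c. t2 = c *\<^sub>R t1" by blast
  qed
  also have "\<dots> \<longleftrightarrow> coefA q1 * coefB q2 - coefA q2 * coefB q1 = 0"
  proof -
    have B: "q1.B = - 2 * q1.A * c1" "q2.B = - 2 * q2.A * c2"
      using q1.roots_sum q2.roots_sum unfolding c1_def c2_def by (simp_all add: algebra_simps)
    have "real_of_int (coefA q1 * coefB q2 - coefA q2 * coefB q1) = 2 * q1.A * q2.A * (c1 - c2)"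
      using B by (simp add: algebra_simps)
    then have "coefA q1 * coefB q2 - coefA q2 * coefB q1 = 0 \<longleftrightarrow> 2 * q1.A * q2.A * (c1 - c2) = 0"
      by (metis of_int_eq_0_iff)
    then show ?thesis using q1.leading_nonzero q2.leading_nonzero by simp
  qed
  finally show ?thesis using True unfolding transverse_at_def t1_def t2_def by simp
next
  case False
  then show ?thesis by (auto simp: transverse_at_def)
qed

text \<open>The equations of the two semicircles are linear in Re z and |z|^2 with determinant
  u.\<close>

lemma transverse_at_unique:
  assumes q: "fund_form q1" "fund_form q2"
    and P: "transverse_at (root_geod q1) (root_geod q2) P" "transverse_at (root_geod q1) (root_geod q2) P'"
  shows "P = P'"
proof -
  interpret q1: fund_form q1 by fact
  interpret q2: fund_form q2 by fact
  define u where "u = q1.A * q2.B - q2.A * q1.B"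
  have ui: "u = real_of_int (coefA q1 * coefB q2 - coefA q2 * coefB q1)" by (simp add: u_def)
  have "coefA q1 * coefB q2 - coefA q2 * coefB q1 \<noteq> 0" using P(1) unfolding transverse_at_iff[OF q] by blast
  then have u: "u \<noteq> 0" unfolding ui of_int_eq_0_iff .
  have x: "Re z * u = - (q1.A * q2.C - q2.A * q1.C)" "((Re z)\<^sup>2 + (Im z)\<^sup>2) * u = q1.B * q2.C - q2.B * q1.C" "Im z > 0"
    if "transverse_at (root_geod q1) (root_geod q2) z" for z
  proof -
    have e: "q1.A * ((Re z)\<^sup>2 + (Im z)\<^sup>2) + q1.B * Re z + q1.C = 0" "q2.A * ((Re z)\<^sup>2 + (Im z)\<^sup>2) + q2.B * Re z + q2.C = 0"
      and "Im z > 0"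
      using that unfolding transverse_at_iff[OF q] q1.geod_points_form_iff q2.geod_points_form_iff by simp_all
    then show "Im z > 0" by simp
    have "Re z * u + (q1.A * q2.C - q2.A * q1.C) = q1.A * (q2.A * ((Re z)\<^sup>2 + (Im z)\<^sup>2) + q2.B * Re z + q2.C) - q2.A * (q1.A * ((Re z)\<^sup>2 + (Im z)\<^sup>2) + q1.B * Re z + q1.C)"
      unfolding u_def by (simp add: algebra_simps)
    then show "Re z * u = - (q1.A * q2.C - q2.A * q1.C)" unfolding e by simp
    have "((Re z)\<^sup>2 + (Im z)\<^sup>2) * u - (q1.B * q2.C - q2.B * q1.C) = q2.B * (q1.A * ((Re z)\<^sup>2 + (Im z)\<^sup>2) + q1.B * Re z + q1.C) - q1.B * (q2.A * ((Re z)\<^sup>2 + (Im z)\<^sup>2) + q2.B * Re z + q2.C)"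
      unfolding u_def by (simp add: algebra_simps)
    then show "((Re z)\<^sup>2 + (Im z)\<^sup>2) * u = q1.B * q2.C - q2.B * q1.C" unfolding e by simp
  qed
  have "Re P * u = Re P' * u" using x(1)[OF P(1)] x(1)[OF P(2)] by simp
  then have re: "Re P = Re P'" using u by simp
  have "((Re P)\<^sup>2 + (Im P)\<^sup>2) * u = ((Re P')\<^sup>2 + (Im P')\<^sup>2) * u" using x(2)[OF P(1)] x(2)[OF P(2)] by simp
  then have "(Im P)\<^sup>2 = (Im P')\<^sup>2" using u re by simp
  then have "Im P = Im P'" using x(3)[OF P(1)] x(3)[OF P(2)] by (simp add: power2_eq_iff)
  then show ?thesis using re by (simp add: complex_eq_iff)
qed

text \<open>Cramer's rule gives Re P = - v / u and |P|^2 = w / u. This is a point of the upper half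
  plane exactly if u w - v^2 > 0, and u w - v^2 is the negative of the resultant.\<close>

lemma transverse_at_exists_iff:
  assumes q: "fund_form q1" "fund_form q2"
  shows "(\<exists>P. transverse_at (root_geod q1) (root_geod q2) P) \<longleftrightarrow> (B_Delta q1 q2)\<^sup>2 < bqf_disc q1 * bqf_disc q2"
proof -
  interpret q1: fund_form q1 by fact
  interpret q2: fund_form q2 by fact
  define u v w where "u = q1.A * q2.B - q2.A * q1.B" and "v = q1.A * q2.C - q2.A * q1.C" and "w = q1.B * q2.C - q2.B * q1.C"
  have ui: "u = real_of_int (coefA q1 * coefB q2 - coefA q2 * coefB q1)" by (simp add: u_def)
  have "real_of_int (4 * ((coefA q1 * coefC q2 - coefA q2 * coefC q1)\<^sup>2 -
     (coefA q1 * coefB q2 - coefA q2 * coefB q1) * (coefB q1 * coefC q2 - coefB q2 * coefC q1))) =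
    real_of_int ((B_Delta q1 q2)\<^sup>2 - bqf_disc q1 * bqf_disc q2)" unfolding bqf_resultant ..
  then have res: "4 * (u * w - v\<^sup>2) = real_of_int (bqf_disc q1 * bqf_disc q2 - (B_Delta q1 q2)\<^sup>2)"
    unfolding u_def v_def w_def by (simp add: algebra_simps)
  have iff: "(B_Delta q1 q2)\<^sup>2 < bqf_disc q1 * bqf_disc q2 \<longleftrightarrow> u * w - v\<^sup>2 > 0"
  proof -
    have "(B_Delta q1 q2)\<^sup>2 < bqf_disc q1 * bqf_disc q2 \<longleftrightarrow> real_of_int (bqf_disc q1 * bqf_disc q2 - (B_Delta q1 q2)\<^sup>2) > 0"
      by (simp only: of_int_0_less_iff diff_gt_0_iff_gt)
    then show ?thesis unfolding res[symmetric] by simp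
  qed
  show ?thesis
    unfolding iff
  proof
    assume "\<exists>P. transverse_at (root_geod q1) (root_geod q2) P"
    then obtain P where P: "transverse_at (root_geod q1) (root_geod q2) P" by blast
    define x r where "x = Re P" and "r = (Re P)\<^sup>2 + (Im P)\<^sup>2"
    have e: "q1.A * r + q1.B * x + q1.C = 0" "q2.A * r + q2.B * x + q2.C = 0" and y: "Im P > 0" and u: "u \<noteq> 0"
      using P unfolding transverse_at_iff[OF q] q1.geod_points_form_iff q2.geod_points_form_iff x_def r_def ui
      by (simp_all only: of_int_eq_0_iff) auto
    have C: "q1.C = - (q1.A * r + q1.B * x)" "q2.C = - (q2.A * r + q2.B * x)" using e by simp_all
    have "u * w - v\<^sup>2 = u\<^sup>2 * (r - x\<^sup>2)"
      unfolding u_def v_def w_def C by (simp add: power2_eq_square algebra_simps)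
    also have "r - x\<^sup>2 = (Im P)\<^sup>2" by (simp add: r_def x_def)
    finally show "u * w - v\<^sup>2 > 0" using u y by simp
  next
    assume pos: "u * w - v\<^sup>2 > 0"
    then have u: "u \<noteq> 0" by auto
    define P where "P = Complex (- v / u) (sqrt ((u * w - v\<^sup>2) / u\<^sup>2))"
    have Im2: "(Im P)\<^sup>2 = (u * w - v\<^sup>2) / u\<^sup>2" using pos by (simp add: P_def)
    have r: "(Re P)\<^sup>2 + (Im P)\<^sup>2 = w / u"
      unfolding Im2 using u by (simp add: P_def field_simps power2_eq_square)
    have y: "Im P > 0" using pos u by (simp add: P_def)
    have "q1.A * w - q1.B * v + q1.C * u = 0" "q2.A * w - q2.B * v + q2.C * u = 0"
      unfolding u_def v_def w_def by (simp_all add: algebra_simps)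
    then have "q1.A * ((Re P)\<^sup>2 + (Im P)\<^sup>2) + q1.B * Re P + q1.C = 0" "q2.A * ((Re P)\<^sup>2 + (Im P)\<^sup>2) + q2.B * Re P + q2.C = 0"
      unfolding r using u by (simp_all add: P_def field_simps)
    moreover have "coefA q1 * coefB q2 - coefA q2 * coefB q1 \<noteq> 0" using u unfolding ui by (simp only: of_int_eq_0_iff) simp
    ultimately have "transverse_at (root_geod q1) (root_geod q2) P"
      unfolding transverse_at_iff[OF q] q1.geod_points_form_iff q2.geod_points_form_iff using y by simp
    then show "\<exists>P. transverse_at (root_geod q1) (root_geod q2) P" by blast
  qed
qed

section \<open>Automorphs and crossings\<close>

definition stabilizer :: "bqf \<Rightarrow> mat2 set" where
  "stabilizer q = {g \<in> Gamma. bqf_act g q = q}"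

text \<open>The automorphy factor; at a fixed point x it is the eigenvalue of the matrix on the
  vector (x, 1).\<close>

fun cocycle :: "mat2 \<Rightarrow> real \<Rightarrow> real" where
  "cocycle (a, b, c, d) x = of_int c * x + of_int d"

lemma mat_adj_adj [simp]: "mat_adj (mat_adj g) = g"
  by (cases g) simp

lemma stabilizer_adj: "g \<in> stabilizer q \<Longrightarrow> mat_adj g \<in> stabilizer q"
  using Gamma_adj[of g] Gamma_act_adj[of g q] by (simp add: stabilizer_def)

lemma stabilizer_mult: "g \<in> stabilizer q \<Longrightarrow> h \<in> stabilizer q \<Longrightarrow> mat_mult g h \<in> stabilizer q"
  by (simp add: stabilizer_def Gamma_mult flip: bqf_act_mult)

text \<open>The interval from h0 (included) to E h0 (excluded) is a fundamental domain for scaling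
  by E; the second alternative stands for the negative exponents.\<close>

lemma exists_power_shift:
  fixes E h h0 :: real
  assumes E: "E > 1" and h: "h > 0" "h0 > 0"
  shows "\<exists>n. (h0 \<le> E ^ n * h \<and> E ^ n * h < E * h0) \<or> (h0 \<le> h / E ^ n \<and> h / E ^ n < E * h0)"
proof (cases "h < h0")
  case True
  have ex: "\<exists>n. h0 \<le> E ^ n * h"
  proof -
    obtain n where "h0 / h < E ^ n" using real_arch_pow[OF E] by blast
    then show ?thesis using h by (intro exI[of _ n]) (simp add: field_simps)
  qed
  define n where "n = (LEAST n. h0 \<le> E ^ n * h)"
  have n: "h0 \<le> E ^ n * h" unfolding n_def by (rule LeastI_ex[OF ex])
  have "n \<noteq> 0" using n True by (intro notI) simp
  then obtain m where m: "n = Suc m" by (cases n) auto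
  have "\<not> h0 \<le> E ^ m * h" using not_less_Least[of m "\<lambda>n. h0 \<le> E ^ n * h"] m unfolding n_def by simp
  then have "E ^ n * h < E * h0" using E unfolding m by simp
  then show ?thesis using n by blast
next
  case False
  have ex: "\<exists>n. h < E ^ n * h0"
  proof -
    obtain n where "h / h0 < E ^ n" using real_arch_pow[OF E] by blast
    then show ?thesis using h by (intro exI[of _ n]) (simp add: field_simps)
  qed
  define n where "n = (LEAST n. h < E ^ n * h0)"
  have n: "h < E ^ n * h0" unfolding n_def by (rule LeastI_ex[OF ex])
  have "n \<noteq> 0" using n False by (intro notI) simp
  then obtain m where m: "n = Suc m" by (cases n) auto
  have "\<not> h < E ^ m * h0" using not_less_Least[of m "\<lambda>n. h < E ^ n * h0"] m unfolding n_def by simp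
  then have "h0 \<le> h / E ^ m" using E by (simp add: field_simps)
  moreover have "h / E ^ m < E * h0" using n E unfolding m by (simp add: field_simps)
  ultimately show ?thesis by blast
qed

context fund_form
begin

lemma stabilizer_fixes_roots:
  assumes g: "(a, b, c, d) \<in> stabilizer q"
  shows "of_int a * f + of_int b = f * (of_int c * f + of_int d)"
    and "of_int a * s + of_int b = s * (of_int c * s + of_int d)"
proof -
  have G: "(a, b, c, d) \<in> Gamma" and act: "bqf_act (a, b, c, d) q = q" using g by (simp_all add: stabilizer_def)
  have m: "(of_int a * f + of_int b) / (of_int c * f + of_int d) = f"
    "(of_int a * s + of_int b) / (of_int c * s + of_int d) = s"
    using moebius_roots[OF fund_form_axioms G] unfolding act by simp_all
  have "f \<noteq> 0" "s \<noteq> 0" using irrational_root by auto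
  then have "of_int c * f + of_int d \<noteq> 0" "of_int c * s + of_int d \<noteq> 0" using m by auto
  then show "of_int a * f + of_int b = f * (of_int c * f + of_int d)"
    "of_int a * s + of_int b = s * (of_int c * s + of_int d)"
    using m by (simp_all add: field_simps)
qed

text \<open>g fixes both f and s, so c and d determine it; the factors in the last relation are its
  two eigenvalues, with product det g.\<close>

lemma stabilizer_relations:
  assumes g: "(a, b, c, d) \<in> stabilizer q"
  shows "of_int a - of_int d = of_int c * (f + s)" and "of_int b = - (of_int c * (f * s))"
    and "(of_int c * f + of_int d) * (of_int c * s + of_int d) = 1"
proof -
  note fixed = stabilizer_fixes_roots[OF g]
  have "(f - s) * (of_int c * (f + s) - (of_int a - of_int d)) = 0"
    using fixed by (simp add: algebra_simps)
  then show 1: "of_int a - of_int d = of_int c * (f + s)" using roots_distinct by simp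
  have "of_int b = f * (of_int c * f - (of_int a - of_int d))" using fixed by (simp add: algebra_simps)
  then show 2: "of_int b = - (of_int c * (f * s))" unfolding 1 by (simp add: algebra_simps)
  have "a * d - b * c = 1" using g by (simp add: stabilizer_def Gamma_def)
  then have "real_of_int (a * d - b * c) = 1" by simp
  then have det: "of_int a * of_int d - of_int b * of_int c = (1::real)" by simp
  have a: "of_int a = of_int d + of_int c * (f + s)" using 1 by simp
  show "(of_int c * f + of_int d) * (of_int c * s + of_int d) = 1"
    using det unfolding 2 a by (simp add: algebra_simps)
qed

lemma cocycle_mult:
  assumes "h \<in> stabilizer q"
  shows "cocycle (mat_mult g h) f = cocycle g f * cocycle h f"
proof -
  obtain a b c d where h: "h = (a, b, c, d)" by (cases h)
  obtain a' b' c' d' where g: "g = (a', b', c', d')" by (cases g)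
  have "cocycle (mat_mult g h) f = of_int c' * (of_int a * f + of_int b) + of_int d' * (of_int c * f + of_int d)"
    by (simp add: g h algebra_simps)
  also have "\<dots> = cocycle g f * cocycle h f"
    unfolding stabilizer_fixes_roots(1)[OF assms[unfolded h]] by (simp add: g h algebra_simps)
  finally show ?thesis .
qed

lemma cocycle_adj:
  assumes "g \<in> stabilizer q"
  shows "cocycle (mat_adj g) f * cocycle g f = 1"
proof -
  obtain a b c d where g: "g = (a, b, c, d)" by (cases g)
  note r = stabilizer_relations[OF assms[unfolded g]]
  have "of_int a = of_int d + of_int c * (f + s)" using r(1) by simp
  then have "cocycle (mat_adj g) f = of_int c * s + of_int d" by (simp add: g algebra_simps)
  then show ?thesis using r(3) by (simp add: g mult.commute)
qed

text \<open>On the geodesic \<open>height z\<close> is |(z - s) / (f - z)|^2. The quotient inside is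
  multiplied by the ratio of the eigenvalues at f and s, which is the square of the one at f; hence
  the fourth power.\<close>

lemma height_moebius:
  assumes g: "g \<in> stabilizer q" and z: "z \<in> geod_points (root_geod q)"
  shows "moebius g z \<in> geod_points (root_geod q)" and "height (moebius g z) = cocycle g f ^ 4 * height z"
proof -
  have G: "g \<in> Gamma" and act: "bqf_act g q = q" using g by (simp_all add: stabilizer_def)
  have Im: "Im z > 0" using z geod_points_iff by blast
  show w: "moebius g z \<in> geod_points (root_geod q)"
    using moebius_geod_points[OF fund_form_axioms G Im] z unfolding act by blast
  obtain a b c d where gc: "g = (a, b, c, d)" by (cases g)
  note r = stabilizer_relations[OF g[unfolded gc]]
  define x y M where "x = Re z" and "y = Im z" and "M = (of_int c * Re z + of_int d)\<^sup>2 + (of_int c * Im z)\<^sup>2"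
  note co = moebius_coordinates[OF Im G[unfolded gc], folded gc M_def]
  have y2: "y\<^sup>2 = (x - s) * (f - x)" using z unfolding geod_points_iff x_def y_def by blast
  define j i where "j = of_int c * f + of_int d" and "i = of_int c * s + of_int d"
  have ji: "j * i = 1" using r(3) by (simp add: j_def i_def)
  define x' where "x' = Re (moebius g z)"
  have a: "of_int a = of_int d + of_int c * (f + s)" using r(1) by simp
  have Mx: "M * x' = (of_int a * x + of_int b) * (of_int c * x + of_int d) + of_int a * of_int c * y\<^sup>2"
    unfolding x'_def co(2) x_def y_def using co(1) by simp
  have M: "M = (of_int c * x + of_int d)\<^sup>2 + (of_int c)\<^sup>2 * y\<^sup>2" by (simp add: M_def x_def y_def power_mult_distrib)
  have "M * (x' - s) = j\<^sup>2 * (x - s)"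
    unfolding right_diff_distrib Mx unfolding M y2 a r(2) j_def by (simp add: power2_eq_square algebra_simps)
  moreover have "M * (f - x') = i\<^sup>2 * (f - x)"
    unfolding right_diff_distrib Mx unfolding M y2 a r(2) i_def by (simp add: power2_eq_square algebra_simps)
  moreover have "height (moebius g z) = (M * (x' - s)) / (M * (f - x'))"
    unfolding height_def x'_def using co(1) by simp
  ultimately have h: "height (moebius g z) = (j\<^sup>2 * (x - s)) / (i\<^sup>2 * (f - x))" by simp
  have "j \<noteq> 0" using ji by auto
  then have i: "i = 1 / j" "j \<noteq> 0" using ji by (simp_all add: eq_divide_eq mult.commute)
  have "height (moebius g z) = j ^ 4 * ((x - s) / (f - x))"
    unfolding h i(1) using i(2) by (simp add: field_simps power2_eq_square power4_eq_xxxx)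
  then show "height (moebius g z) = cocycle g f ^ 4 * height z" by (simp add: gc j_def height_def x_def)
qed

text \<open>The unit of norm 1 belonging to the least Pell solution; the automorph multiplies
  heights by its fourth power.\<close>

definition unit :: real where
  "unit = (of_int (fst (pell_min (bqf_disc q))) + of_int (snd (pell_min (bqf_disc q))) * \<delta>) / 2"

lemma unit_gt_one: "unit > 1"
proof -
  obtain T U where TU: "pell_min (bqf_disc q) = (T, U)" by (cases "pell_min (bqf_disc q)")
  have "(T, U) \<in> pell_solutions (bqf_disc q)" using pell_min_spec(1)[OF disc_pos delta_irrational] TU by simp
  then have p: "T > 0" "U > 0" "T\<^sup>2 - bqf_disc q * U\<^sup>2 = 4" by (auto simp: pell_solutions_def)
  have "bqf_disc q * U\<^sup>2 > 0" using disc_pos p by simp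
  then have "2\<^sup>2 < T\<^sup>2" using p by simp
  then have "2 < T" by (rule power2_less_imp_less) (use p in simp)
  then have "real_of_int T > 2" by simp
  moreover have "of_int U * \<delta> > 0" using p delta_pos by simp
  ultimately show ?thesis unfolding unit_def TU by simp
qed

lemma automorph_stabilizer: "automorph q \<in> stabilizer q" and cocycle_automorph: "cocycle (automorph q) f = unit"
proof -
  obtain T U where TU: "pell_min (bqf_disc q) = (T, U)" by (cases "pell_min (bqf_disc q)")
  obtain A B C where qc: "q = BQF A B C" by (cases q)
  have "(T, U) \<in> pell_solutions (bqf_disc q)" using pell_min_spec(1)[OF disc_pos delta_irrational] TU by simp
  then have p: "T\<^sup>2 - (B\<^sup>2 - 4 * A * C) * U\<^sup>2 = 4" by (simp add: pell_solutions_def qc bqf_disc_def)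
  have "even (T\<^sup>2 - (B\<^sup>2 - 4 * A * C) * U\<^sup>2)" unfolding p by simp
  then have par: "even T \<longleftrightarrow> even (B * U)" by auto
  then have "even (T - B * U)" "even (T + B * U)" by simp_all
  then obtain \<alpha> \<beta> where ab: "T - B * U = 2 * \<alpha>" "T + B * U = 2 * \<beta>" by (meson evenE)
  have aut: "automorph q = (\<alpha>, - C * U, A * U, \<beta>)"
    unfolding automorph_def TU by (simp add: qc ab)
  have b: "\<beta> = \<alpha> + B * U" using ab by simp
  have "4 * (\<alpha> * \<beta> + A * C * U\<^sup>2) = (2 * \<alpha>) * (2 * \<beta>) + 4 * A * C * U\<^sup>2" by simp
  also have "\<dots> = 4" unfolding ab[symmetric] using p by (simp add: power2_eq_square algebra_simps)
  finally have det: "\<alpha> * \<beta> + A * C * U\<^sup>2 = 1" by simp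
  have G: "automorph q \<in> Gamma" unfolding aut using det by (simp add: Gamma_def power2_eq_square algebra_simps)
  have "bqf_act (automorph q) q = bqf_scale (\<alpha> * \<beta> + A * C * U\<^sup>2) q"
    unfolding aut unfolding qc b by (simp add: power2_eq_square algebra_simps)
  then have "bqf_act (automorph q) q = q" unfolding det by simp
  then show "automorph q \<in> stabilizer q" using G by (simp add: stabilizer_def)
  have "2 * cocycle (automorph q) f = of_int U * (2 * of_int A * f) + 2 * of_int \<beta>" by (simp add: aut algebra_simps)
  also have "2 * real_of_int \<beta> = of_int (T + B * U)" unfolding ab by simp
  also have "2 * of_int A * f = \<delta> - of_int B" using first_root_eq by (simp add: qc)
  finally have "2 * cocycle (automorph q) f = of_int T + of_int U * \<delta>" by (simp add: algebra_simps)
  then show "cocycle (automorph q) f = unit" unfolding unit_def TU by simp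
qed

lemma stabilizer_power: "\<exists>g\<in>stabilizer q. cocycle g f = unit ^ n"
proof (induction n)
  case 0
  have "(1, 0, 0, 1) \<in> stabilizer q" by (simp add: stabilizer_def Gamma_def Gamma_act_one)
  then show ?case by (intro bexI[of _ "(1, 0, 0, 1)"]) simp
next
  case (Suc n)
  then obtain g where g: "g \<in> stabilizer q" "cocycle g f = unit ^ n" by blast
  have "cocycle (mat_mult (automorph q) g) f = unit ^ Suc n"
    unfolding cocycle_mult[OF g(1)] cocycle_automorph g(2) by simp
  then show ?case using stabilizer_mult[OF automorph_stabilizer g(1)] by blast
qed

text \<open>Elements of the stabiliser correspond to solutions of t^2 - D u^2 = 4, and the modulus
  of the cocycle is m or 1 / m for m = (|t| + |u| sqrt D) / 2. By minimality m >=
  \<open>unit\<close> unless u = 0, so only 1 and -1 remain, and both act trivially on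
  forms.\<close>

lemma stabilizer_trivial:
  assumes g: "g \<in> stabilizer q" and lt: "\<bar>cocycle g f\<bar> < unit" and gt: "unit * \<bar>cocycle g f\<bar> > 1"
  shows "bqf_act g q' = q'"
proof -
  obtain a b c d where gc: "g = (a, b, c, d)" by (cases g)
  note r = stabilizer_relations[OF g[unfolded gc]]
  have "A * (of_int c * (f + s)) = of_int c * (A * (f + s))" "A * (of_int c * (f * s)) = of_int c * (A * (f * s))"
    by simp_all
  then have "A * (of_int c * (f + s)) = - B * of_int c" "A * (of_int c * (f * s)) = C * of_int c"
    unfolding roots_sum roots_prod by simp_all
  then have "real_of_int (coefA q * (a - d)) = of_int (- coefB q * c)" "real_of_int (coefA q * b) = of_int (- coefC q * c)"
    using r(1,2) by simp_all
  then have e: "coefA q * (a - d) = - coefB q * c" "coefA q * b = - coefC q * c"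
    by (simp_all only: of_int_eq_iff)
  \<comment> \<open>Primitivity of q makes c a multiple of the leading coefficient, so that u is an
    integer.\<close>
  have prim: "gcd (coefA q) (gcd (coefB q) (coefC q)) = 1"
    using fund_disc_bqf_primitive[OF fund] by (simp add: bqf_primitive_def)
  have "c * coefB q = coefA q * (d - a)" "c * coefC q = coefA q * (- b)" using e by (simp_all add: algebra_simps)
  then have "coefA q dvd gcd (c * coefB q) (c * coefC q)" by simp
  also have "gcd (c * coefB q) (c * coefC q) = \<bar>c * gcd (coefB q) (coefC q)\<bar>" by (simp add: gcd_mult_left abs_mult)
  finally have "coefA q dvd c * gcd (coefB q) (coefC q)" by (simp only: dvd_abs_iff)
  moreover have "coprime (coefA q) (gcd (coefB q) (coefC q))" using prim by (simp only: coprime_iff_gcd_eq_1)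
  ultimately have "coefA q dvd c" by (simp only: coprime_dvd_mult_left_iff)
  then obtain u where u: "c = coefA q * u" by (rule dvdE)
  have A0: "coefA q \<noteq> 0" using leading_nonzero by simp
  have "coefA q * (a - d) = coefA q * (- coefB q * u)" "coefA q * b = coefA q * (- coefC q * u)"
    using e unfolding u by (simp_all only: mult_ac)
  then have ad: "a - d = - coefB q * u" and b: "b = - coefC q * u" using A0 by (simp_all only: mult_cancel_left) simp_all
  define t where "t = a + d"
  have det: "a * d - b * c = 1" using g by (simp add: gc stabilizer_def Gamma_def)
  have norm: "t\<^sup>2 - bqf_disc q * u\<^sup>2 = 4"
  proof -
    have "t\<^sup>2 = (a - d)\<^sup>2 + 4 * (a * d)" by (simp add: t_def power2_eq_square algebra_simps)
    also have "a * d = 1 + b * c" using det by simp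
    finally show ?thesis unfolding ad b u bqf_disc_def by (simp add: power2_eq_square algebra_simps)
  qed
  have j: "2 * cocycle g f = of_int t + of_int u * \<delta>"
  proof -
    have "2 * cocycle g f = of_int u * (2 * A * f) + of_int (2 * d)" by (simp add: gc u algebra_simps)
    also have "2 * d = t + coefB q * u" using ad t_def by simp
    finally show ?thesis unfolding first_root_eq by (simp add: algebra_simps)
  qed
  show ?thesis
  proof (cases "u = 0")
    case True
    then have "c = 0" "b = 0" "a = d" using u b ad by simp_all
    moreover have "d = 1 \<or> d = -1" using det calculation by (auto simp: zmult_eq_1_iff)
    ultimately show ?thesis by (cases q') (auto simp: gc)
  next
    case False
    have "bqf_disc q * u\<^sup>2 > 0" using disc_pos False by simp
    then have t0: "t \<noteq> 0" using norm by (auto simp: power2_eq_square)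
    have sol: "(\<bar>t\<bar>, \<bar>u\<bar>) \<in> pell_solutions (bqf_disc q)" using norm t0 False by (simp add: pell_solutions_def)
    have le: "fst (pell_min (bqf_disc q)) \<le> \<bar>t\<bar>" "snd (pell_min (bqf_disc q)) \<le> \<bar>u\<bar>"
      using pell_min_spec(2)[OF disc_pos delta_irrational sol] by simp_all
    define m where "m = (of_int \<bar>t\<bar> + of_int \<bar>u\<bar> * \<delta>) / 2"
    have um: "unit \<le> m"
    proof -
      have "real_of_int (snd (pell_min (bqf_disc q))) * \<delta> \<le> of_int \<bar>u\<bar> * \<delta>"
        by (rule mult_right_mono) (use le(2) delta_pos in \<open>simp_all only: of_int_le_iff less_imp_le\<close>)
      moreover have "real_of_int (fst (pell_min (bqf_disc q))) \<le> of_int \<bar>t\<bar>"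
        using le(1) by (simp only: of_int_le_iff)
      ultimately show ?thesis unfolding unit_def m_def by (intro divide_right_mono add_mono) simp_all
    qed
    define m' where "m' = (of_int \<bar>t\<bar> - of_int \<bar>u\<bar> * \<delta>) / 2"
    have mm: "m * m' = 1"
    proof -
      have ab: "((x + y) / 2) * ((x - y) / 2) = (x\<^sup>2 - y\<^sup>2) / 4" for x y :: real
        by (simp add: power2_eq_square field_simps)
      have "(of_int \<bar>t\<bar>)\<^sup>2 = real_of_int (t\<^sup>2)" by simp
      moreover have "(of_int \<bar>u\<bar> * \<delta>)\<^sup>2 = real_of_int (bqf_disc q * u\<^sup>2)"
        using disc_pos by (simp add: power_mult_distrib)
      ultimately have "m * m' = of_int (t\<^sup>2 - bqf_disc q * u\<^sup>2) / 4"
        unfolding m_def m'_def ab by simp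
      then show ?thesis unfolding norm by simp
    qed
    have m0: "m > 0" using um unit_gt_one by simp
    have m': "m' = 1 / m" using mm m0 by (simp add: field_simps)
    have "\<bar>cocycle g f\<bar> = m \<or> \<bar>cocycle g f\<bar> = m'"
    proof -
      have c: "cocycle g f = (of_int t + of_int u * \<delta>) / 2" using j by simp
      have mp: "m' > 0" unfolding m' using m0 by simp
      consider "t > 0" "u > 0" | "t > 0" "u < 0" | "t < 0" "u > 0" | "t < 0" "u < 0"
        using t0 False by linarith
      then show ?thesis
      proof cases
        case 1
        then have "cocycle g f = m" unfolding c m_def by simp
        then show ?thesis using m0 by simp
      next
        case 2
        then have "cocycle g f = m'" unfolding c m'_def by simp
        then show ?thesis using mp by simp
      next
        case 3
        then have "cocycle g f = - m'" unfolding c m'_def by (simp add: field_simps)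
        then show ?thesis using mp by simp
      next
        case 4
        then have "cocycle g f = - m" unfolding c m_def by (simp add: field_simps)
        then show ?thesis using m0 by simp
      qed
    qed
    then show ?thesis
    proof
      assume "\<bar>cocycle g f\<bar> = m"
      then show ?thesis using lt um by simp
    next
      assume "\<bar>cocycle g f\<bar> = m'"
      then have "1 < unit / m" using gt m' by simp
      then show ?thesis using um m0 by (simp add: field_simps)
    qed
  qed
qed

section \<open>Crossings within one period of a geodesic\<close>

definition crossing_forms :: "complex \<Rightarrow> int \<Rightarrow> bqf set" where
  "crossing_forms z D = {q'. bqf_disc q' = D \<and> (\<exists>P. transverse_at (root_geod q') (root_geod q) P \<and>
     height z \<le> height P \<and> height P < unit ^ 4 * height z)}"

text \<open>Two geodesics cross transversally at most once, so P is determined by l, and l is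
  determined by its form; pairs (l, P) become forms.\<close>

lemma int_num_at_eq:
  assumes q1: "fund_form q1" and z: "z \<in> geod_points (root_geod q)"
  shows "int_num_at z q1 q = card (bqf_equiv `` {q1} \<inter> crossing_forms z (bqf_disc q1))"
proof -
  define w where "w = moebius (automorph q) z"
  note hw = height_moebius[OF automorph_stabilizer z, unfolded cocycle_automorph, folded w_def]
  have lt: "height z < height w"
    unfolding hw(2) using height_facts(2)[OF z] unit_gt_one one_less_power[of unit 4] by simp
  define T where "T = bqf_equiv `` {q1} \<inter> crossing_forms z (bqf_disc q1)"
  define S where "S = {(l, P). l \<in> (\<lambda>g. geod_act g (root_geod q1)) ` Gamma \<and>
                   P \<in> geod_segment (root_geod q) z w \<and> transverse_at l (root_geod q) P}"
  define F where "F q' = (root_geod q', THE P. transverse_at (root_geod q') (root_geod q) P)" for q'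
  have cls: "fund_form q' \<and> bqf_disc q' = bqf_disc q1" if "(q1, q') \<in> bqf_equiv" for q'
    using that fund_form_act[OF q1] by (auto simp: bqf_equiv_def bqf_disc_act Gamma_iff)
  have F_eq: "F q' = (root_geod q', P)" if "fund_form q'" "transverse_at (root_geod q') (root_geod q) P" for q' P
  proof -
    have "(THE P. transverse_at (root_geod q') (root_geod q) P) = P"
    proof (rule the_equality)
      show "transverse_at (root_geod q') (root_geod q) P" by (fact that(2))
      fix P' assume "transverse_at (root_geod q') (root_geod q) P'"
      then show "P' = P" using that(2) by (rule transverse_at_unique[OF that(1) fund_form_axioms])
    qed
    then show ?thesis by (simp only: F_def)
  qed
  have seg: "P \<in> geod_segment (root_geod q) z w \<longleftrightarrow> height z \<le> height P \<and> height P < unit ^ 4 * height z"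
    if "transverse_at l (root_geod q) P" for l P
    unfolding geod_segment_iff[OF z hw(1) lt] hw(2) using that by (simp add: transverse_at_def)
  have "bij_betw F T S"
    unfolding bij_betw_def
  proof
    show "inj_on F T"
    proof (rule inj_onI)
      fix x y assume xy: "x \<in> T" "y \<in> T" "F x = F y"
      then have "(q1, x) \<in> bqf_equiv" "(q1, y) \<in> bqf_equiv" by (simp_all add: T_def)
      then have "fund_form x" "fund_form y" "bqf_disc x = bqf_disc y" using cls by simp_all
      moreover have "root_geod x = root_geod y" using xy(3) by (simp add: F_def)
      ultimately show "x = y" by (rule root_geod_inject)
    qed
    show "F ` T = S"
    proof
      show "F ` T \<subseteq> S"
      proof
        fix y assume "y \<in> F ` T"
        then obtain q' where q': "q' \<in> T" "y = F q'" by blast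
        then obtain P where P: "transverse_at (root_geod q') (root_geod q) P" "height z \<le> height P" "height P < unit ^ 4 * height z"
          and e: "(q1, q') \<in> bqf_equiv" by (auto simp: T_def crossing_forms_def)
        have "y = (root_geod q', P)" using F_eq[OF _ P(1)] cls[OF e] q'(2) by simp
        moreover have "root_geod q' \<in> (\<lambda>g. geod_act g (root_geod q1)) ` Gamma"
          unfolding translates_root_geod[OF q1] using e by blast
        ultimately show "y \<in> S" unfolding S_def using P seg[OF P(1)] by simp
      qed
      show "S \<subseteq> F ` T"
      proof
        fix y assume "y \<in> S"
        then obtain l P where y: "y = (l, P)" and l: "l \<in> (\<lambda>g. geod_act g (root_geod q1)) ` Gamma"
          and P: "P \<in> geod_segment (root_geod q) z w" "transverse_at l (root_geod q) P"
          by (auto simp: S_def)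
        obtain q' where q': "(q1, q') \<in> bqf_equiv" "l = root_geod q'"
          using l unfolding translates_root_geod[OF q1] by blast
        have "q' \<in> T" unfolding T_def crossing_forms_def
          using q'(1) cls[OF q'(1)] P(2) seg[OF P(2)] P(1) unfolding q'(2) by blast
        moreover have "y = F q'" using F_eq[of q' P] cls[OF q'(1)] P(2) unfolding y q'(2) by simp
        ultimately show "y \<in> F ` T" by blast
      qed
    qed
  qed
  then have "card T = card S" by (rule bij_betw_same_card)
  then show ?thesis unfolding int_num_at_def S_def T_def w_def by simp
qed

lemma shift_into_segment:
  assumes z: "z \<in> geod_points (root_geod q)" and P: "P \<in> geod_points (root_geod q)"
  obtains g where "g \<in> stabilizer q" "height z \<le> height (moebius g P)" "height (moebius g P) < unit ^ 4 * height z"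
proof -
  have E: "unit ^ 4 > 1" using unit_gt_one by (intro one_less_power) auto
  obtain n where n: "(height z \<le> (unit ^ 4) ^ n * height P \<and> (unit ^ 4) ^ n * height P < unit ^ 4 * height z) \<or>
      (height z \<le> height P / (unit ^ 4) ^ n \<and> height P / (unit ^ 4) ^ n < unit ^ 4 * height z)"
    using exists_power_shift[OF E height_facts(2)[OF P] height_facts(2)[OF z]] by blast
  obtain g where g: "g \<in> stabilizer q" "cocycle g f = unit ^ n" using stabilizer_power by blast
  have h: "height (moebius g P) = (unit ^ 4) ^ n * height P"
    unfolding height_moebius(2)[OF g(1) P] g(2) by (simp add: power_mult[symmetric] mult.commute)
  have "cocycle (mat_adj g) f = 1 / unit ^ n"
    using cocycle_adj[OF g(1)] unit_gt_one unfolding g(2) by (simp add: field_simps)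
  then have h': "height (moebius (mat_adj g) P) = height P / (unit ^ 4) ^ n"
    unfolding height_moebius(2)[OF stabilizer_adj[OF g(1)] P] by (simp add: power_divide power_mult[symmetric] mult.commute)
  show thesis using n that[OF g(1)] that[OF stabilizer_adj[OF g(1)]] unfolding h h' by blast
qed

text \<open>The stabiliser element that moves the crossing point into the segment acts on the form
  through its adjugate, because points and forms are moved in opposite directions.\<close>

lemma crossing_forms_representative:
  assumes z: "z \<in> geod_points (root_geod q)" and q': "fund_form q'" and b: "(B_Delta q' q)\<^sup>2 < bqf_disc q' * bqf_disc q"
  obtains g where "g \<in> stabilizer q" "bqf_act g q' \<in> crossing_forms z (bqf_disc q')"
proof -
  obtain P where P: "transverse_at (root_geod q') (root_geod q) P"
    using transverse_at_exists_iff[OF q' fund_form_axioms] b by blast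
  then have Pq: "P \<in> geod_points (root_geod q')" "P \<in> geod_points (root_geod q)" by (simp_all add: transverse_at_def)
  obtain h where h: "h \<in> stabilizer q" "height z \<le> height (moebius h P)" "height (moebius h P) < unit ^ 4 * height z"
    using shift_into_segment[OF z Pq(2)] .
  define g where "g = mat_adj h"
  have g: "g \<in> stabilizer q" unfolding g_def by (rule stabilizer_adj[OF h(1)])
  have G: "g \<in> Gamma" "h \<in> Gamma" "bqf_act g q = q" using g h(1) by (simp_all add: stabilizer_def)
  have Im: "Im P > 0" using Pq(2) geod_points_iff by blast
  define P' where "P' = moebius h P"
  have P'q: "P' \<in> geod_points (root_geod q)" unfolding P'_def by (rule height_moebius(1)[OF h(1) Pq(2)])
  then have Im': "Im P' > 0" using geod_points_iff by blast
  have "moebius g P' = P" unfolding P'_def g_def using moebius_adj[OF Im Gamma_adj[OF G(2)]] by simp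
  then have P'g: "P' \<in> geod_points (root_geod (bqf_act g q'))"
    using moebius_geod_points[OF q' G(1) Im'] Pq(1) by simp
  have qg: "fund_form (bqf_act g q')" by (rule fund_form_act[OF q' G(1)])
  have d: "bqf_disc (bqf_act g q') = bqf_disc q'" using G(1) by (simp add: bqf_disc_act Gamma_iff)
  have "B_Delta (bqf_act g q') (bqf_act g q) = B_Delta q' q" using G(1) by (simp only: B_Delta_act Gamma_iff) simp
  then have "(B_Delta (bqf_act g q') q)\<^sup>2 < bqf_disc (bqf_act g q') * bqf_disc q" using b d unfolding G(3) by simp
  then have "coefA (bqf_act g q') * coefB q - coefA q * coefB (bqf_act g q') \<noteq> 0"
    using transverse_at_exists_iff[OF qg fund_form_axioms] transverse_at_iff[OF qg fund_form_axioms] by blast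
  then have "transverse_at (root_geod (bqf_act g q')) (root_geod q) P'"
    unfolding transverse_at_iff[OF qg fund_form_axioms] using P'g P'q by blast
  then have "bqf_act g q' \<in> crossing_forms z (bqf_disc q')"
    unfolding crossing_forms_def using h(2,3) d unfolding P'_def by blast
  then show thesis using that g by blast
qed

text \<open>The two crossing points lie in the same half-open period and g maps one to the other, so
  the modulus of its cocycle lies strictly between 1 / \<open>unit\<close> and \<open>unit\<close>;
  \<open>stabilizer_trivial\<close> applies.\<close>

lemma crossing_forms_unique:
  assumes z: "z \<in> geod_points (root_geod q)" and D: "fund_disc D"
    and q': "q' \<in> crossing_forms z D" and g: "g \<in> stabilizer q" and q'': "bqf_act g q' \<in> crossing_forms z D"
  shows "bqf_act g q' = q'"
proof -
  have G: "g \<in> Gamma" "bqf_act g q = q" using g by (simp_all add: stabilizer_def)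
  have fq: "fund_form q'" using q' D by (simp add: crossing_forms_def fund_form_def)
  obtain P where P: "transverse_at (root_geod q') (root_geod q) P" "height z \<le> height P" "height P < unit ^ 4 * height z"
    using q' by (auto simp: crossing_forms_def)
  obtain Q where Q: "transverse_at (root_geod (bqf_act g q')) (root_geod q) Q" "height z \<le> height Q" "height Q < unit ^ 4 * height z"
    using q'' by (auto simp: crossing_forms_def)
  have Qq: "Q \<in> geod_points (root_geod (bqf_act g q'))" "Q \<in> geod_points (root_geod q)" using Q(1) by (simp_all add: transverse_at_def)
  have Im: "Im Q > 0" using Qq(2) geod_points_iff by blast
  have "moebius g Q \<in> geod_points (root_geod q')" using moebius_geod_points[OF fq G(1) Im] Qq(1) by blast
  moreover have "moebius g Q \<in> geod_points (root_geod q)" by (rule height_moebius(1)[OF g Qq(2)])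
  ultimately have "transverse_at (root_geod q') (root_geod q) (moebius g Q)"
    using P(1) unfolding transverse_at_iff[OF fq fund_form_axioms] by blast
  then have "moebius g Q = P" using transverse_at_unique[OF fq fund_form_axioms _ P(1)] by blast
  then have h: "height P = cocycle g f ^ 4 * height Q" using height_moebius(2)[OF g Qq(2)] by simp
  define j where "j = \<bar>cocycle g f\<bar>"
  have j4: "cocycle g f ^ 4 = j ^ 4" by (simp add: j_def)
  have z0: "height z > 0" "height Q > 0" using height_facts z Qq by blast+
  have u0: "unit > 0" using unit_gt_one by simp
  have "j < unit"
  proof (rule ccontr)
    assume "\<not> j < unit"
    then have "unit ^ 4 \<le> j ^ 4" using u0 by (intro power_mono) auto
    then have "unit ^ 4 * height z \<le> j ^ 4 * height Q" using Q(2) z0 u0 by (intro mult_mono) auto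
    then show False using P(3) unfolding h j4 by simp
  qed
  moreover have "unit * j > 1"
  proof (rule ccontr)
    assume "\<not> unit * j > 1"
    then have "(unit * j) ^ 4 \<le> 1" using u0 by (intro power_le_one) (auto simp: j_def)
    then have "(unit * j) ^ 4 * height Q \<le> height Q" using z0 by (simp add: mult_left_le_one_le)
    moreover have "(unit * j) ^ 4 * height Q = unit ^ 4 * height P" unfolding h j4 by (simp add: power_mult_distrib)
    moreover have "unit ^ 4 * height z \<le> unit ^ 4 * height P" using P(2) u0 by (intro mult_left_mono) auto
    ultimately show False using Q(3) by simp
  qed
  ultimately show ?thesis using stabilizer_trivial[OF g] unfolding j_def by blast
qed

end

section \<open>The total intersection number\<close>

lemma class_representative:
  assumes "fund_disc D" "K \<in> Cl_plus D"
  defines "r \<equiv> SOME q. q \<in> K"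
  shows "r \<in> K" "fund_form r" "bqf_disc r = D" "K = bqf_equiv `` {r}"
proof -
  obtain q where q: "bqf_disc q = D" "K = bqf_equiv `` {q}"
    using assms(2) unfolding Cl_plus_def by (auto elim!: quotientE)
  have "q \<in> K" unfolding q(2) using equiv_class_self[OF equiv_bqf_equiv] by blast
  then show r: "r \<in> K" unfolding r_def by (rule someI)
  then have qr: "(q, r) \<in> bqf_equiv" unfolding q(2) by simp
  then show d: "bqf_disc r = D" using q(1) by (auto simp: bqf_equiv_def bqf_disc_act Gamma_iff)
  then show "fund_form r" using assms(1) by (simp add: fund_form_def)
  show "K = bqf_equiv `` {r}" unfolding q(2) by (rule equiv_class_eq[OF equiv_bqf_equiv qr])
qed

lemma class_in_Cl_plus:
  assumes "fund_disc (bqf_disc q)"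
  shows "bqf_equiv `` {q} \<in> Cl_plus (bqf_disc q)"
  unfolding Cl_plus_def using fund_disc_bqf_primitive[OF assms] by (intro quotientI) simp

lemma disjoint_Cl_plus:
  assumes "K \<in> Cl_plus D" "K' \<in> Cl_plus D" "K \<noteq> K'"
  shows "K \<inter> K' = {}"
proof -
  have "K \<in> UNIV // bqf_equiv" "K' \<in> UNIV // bqf_equiv" using assms(1,2) unfolding Cl_plus_def quotient_def by blast+
  then show ?thesis using quotient_disj[OF equiv_bqf_equiv] assms(3) by blast
qed

definition crossing_pairs :: "int \<Rightarrow> int \<Rightarrow> (bqf \<times> bqf) set" where
  "crossing_pairs D1 D2 = {(q1, q2). bqf_disc q1 = D1 \<and> bqf_disc q2 = D2 \<and> (B_Delta q1 q2)\<^sup>2 < D1 * D2}"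

lemma B_Delta_even_iff:
  "even (B_Delta q1 q2) \<longleftrightarrow> even (bqf_disc q1 * bqf_disc q2)"
  by (simp add: B_Delta_def bqf_disc_def)

lemma equiv2_invariants:
  assumes "((q1, q2), (q1', q2')) \<in> bqf_equiv2"
  shows "bqf_disc q1' = bqf_disc q1" "bqf_disc q2' = bqf_disc q2" "B_Delta q1' q2' = B_Delta q1 q2"
  using assms by (auto simp: bqf_equiv2_iff bqf_disc_act B_Delta_act Gamma_iff)

text \<open>The invariant n separates classes, and the parity condition in \<open>S_set\<close>
  holds for every pair by \<open>B_Delta_even_iff\<close>.\<close>

lemma card_crossing_pairs:
  assumes D: "fund_disc D1" "fund_disc D2" "coprime D1 D2"
  shows "finite (crossing_pairs D1 D2 // bqf_equiv2)"
    and "card (crossing_pairs D1 D2 // bqf_equiv2) = (\<Sum>n\<in>S_set D1 D2. pair_count D1 D2 n)"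
proof -
  have pos: "D1 * D2 > 0" using D by (simp add: fund_disc_def)
  define X where "X n = {(q1, q2). bqf_disc q1 = D1 \<and> bqf_disc q2 = D2 \<and> B_Delta q1 q2 = n}" for n
  have "crossing_pairs D1 D2 = (\<Union>n\<in>S_set D1 D2. X n)"
    unfolding crossing_pairs_def X_def using S_set_iff[OF pos] B_Delta_even_iff by auto
  then have un: "crossing_pairs D1 D2 // bqf_equiv2 = (\<Union>n\<in>S_set D1 D2. X n // bqf_equiv2)"
    by (auto simp: quotient_def)
  have finS: "finite (S_set D1 D2)"
  proof (rule finite_subset)
    show "S_set D1 D2 \<subseteq> {- (D1 * D2)..D1 * D2}"
    proof
      fix n assume "n \<in> S_set D1 D2"
      then have "n\<^sup>2 < D1 * D2" using S_set_iff[OF pos] by simp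
      moreover have "\<bar>n\<bar> \<le> n\<^sup>2"
      proof (cases "n = 0")
        case False
        then show ?thesis using square_le_abs_mult[of 1 n] mult_left_mono[of 1 "\<bar>n\<bar>" "\<bar>n\<bar>"] by (simp add: power2_eq_square)
      qed simp
      ultimately show "n \<in> {- (D1 * D2)..D1 * D2}" by auto
    qed
  qed simp
  have fin: "finite (X n // bqf_equiv2)" if "n \<in> S_set D1 D2" for n
    unfolding X_def by (rule pair_count_formula(2)[OF D that])
  show "finite (crossing_pairs D1 D2 // bqf_equiv2)" unfolding un using finS fin by blast
  have "card (\<Union>n\<in>S_set D1 D2. X n // bqf_equiv2) = (\<Sum>n\<in>S_set D1 D2. card (X n // bqf_equiv2))"
  proof (rule card_UN_disjoint[OF finS])
    show "\<forall>n\<in>S_set D1 D2. finite (X n // bqf_equiv2)" using fin by blast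
    have "m = n" if K: "K \<in> X m // bqf_equiv2" "K \<in> X n // bqf_equiv2" for m n K
    proof -
      obtain x where x: "x \<in> X m" "K = bqf_equiv2 `` {x}" using K(1) by (rule quotientE)
      obtain y where y: "y \<in> X n" "K = bqf_equiv2 `` {y}" using K(2) by (rule quotientE)
      have "bqf_equiv2 `` {x} = bqf_equiv2 `` {y}" using x(2) y(2) by (rule subst)
      then have "(x, y) \<in> bqf_equiv2" by (rule eq_equiv_class[OF _ equiv_bqf_equiv2 UNIV_I])
      then show "m = n" using x(1) y(1) equiv2_invariants(3) by (cases x; cases y) (auto simp: X_def)
    qed
    then show "\<forall>i\<in>S_set D1 D2. \<forall>j\<in>S_set D1 D2. i \<noteq> j \<longrightarrow> X i // bqf_equiv2 \<inter> X j // bqf_equiv2 = {}" by blast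
  qed
  then show "card (crossing_pairs D1 D2 // bqf_equiv2) = (\<Sum>n\<in>S_set D1 D2. pair_count D1 D2 n)"
    unfolding un pair_count_def X_def .
qed

text \<open>The second form of a crossing pair is moved to the chosen representative of its class.
  What freedom remains is the stabiliser of that representative, and the forms crossing one period
  of its geodesic meet every orbit exactly once.\<close>

lemma total_int_num_eq:
  assumes D: "fund_disc D1" "fund_disc D2" and fin: "finite (crossing_pairs D1 D2 // bqf_equiv2)"
  shows "total_int_num D1 D2 = card (crossing_pairs D1 D2 // bqf_equiv2)"
proof -
  define rep where "rep K = (SOME q :: bqf. q \<in> K)" for K
  define base where "base q = (SOME z. z \<in> geod_points (root_geod q))" for q
  define T where "T K = fund_form.crossing_forms (rep K) (base (rep K)) D1" for K
  note R1 = class_representative[OF D(1), folded rep_def] and R2 = class_representative[OF D(2), folded rep_def]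
  have base: "base q \<in> geod_points (root_geod q)" if "fund_form q" for q
    unfolding base_def using fund_form.geod_points_nonempty[OF that] by (simp add: some_in_eq)
  have T_disc: "bqf_disc q' = D1 \<and> fund_form q'" if "K \<in> Cl_plus D2" "q' \<in> T K" for K q'
    using that D(1) unfolding T_def fund_form.crossing_forms_def[OF R2(2)[OF that(1)]] by (simp add: fund_form_def)
  have bij: "bij_betw (\<lambda>t. bqf_equiv2 `` {(snd t, rep (fst t))}) (SIGMA K:Cl_plus D2. T K) (crossing_pairs D1 D2 // bqf_equiv2)"
  proof (rule bij_betw_quotient_transversal[OF equiv_bqf_equiv2])
    show "(\<lambda>t. (snd t, rep (fst t))) ` (SIGMA K:Cl_plus D2. T K) \<subseteq> crossing_pairs D1 D2"
    proof clarify
      fix K q' assume K: "K \<in> Cl_plus D2" and q': "q' \<in> T K"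
      have f: "fund_form q'" "bqf_disc q' = D1" using T_disc[OF K q'] by simp_all
      have "\<exists>P. transverse_at (root_geod q') (root_geod (rep K)) P"
        using q' unfolding T_def fund_form.crossing_forms_def[OF R2(2)[OF K]] by blast
      then have "(B_Delta q' (rep K))\<^sup>2 < bqf_disc q' * bqf_disc (rep K)"
        unfolding transverse_at_exists_iff[OF f(1) R2(2)[OF K]] .
      then show "(snd (K, q'), rep (fst (K, q'))) \<in> crossing_pairs D1 D2"
        using f(2) R2(3)[OF K] by (simp add: crossing_pairs_def)
    qed
  next
    fix x assume "x \<in> crossing_pairs D1 D2"
    then obtain q1 q2 where x: "x = (q1, q2)" "bqf_disc q1 = D1" "bqf_disc q2 = D2" "(B_Delta q1 q2)\<^sup>2 < D1 * D2"
      by (auto simp: crossing_pairs_def)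
    define K where "K = bqf_equiv `` {q2}"
    have K: "K \<in> Cl_plus D2" using class_in_Cl_plus[of q2] D(2) x(3) unfolding K_def by simp
    have "(q2, rep K) \<in> bqf_equiv" using R2(1)[OF K] unfolding K_def by simp
    then obtain g where g: "g \<in> Gamma" "rep K = bqf_act g q2" by (auto simp: bqf_equiv_def)
    have e1: "((q1, q2), (bqf_act g q1, rep K)) \<in> bqf_equiv2" unfolding bqf_equiv2_iff g(2) by (intro bexI[OF _ g(1)] conjI refl)
    note inv = equiv2_invariants[OF e1]
    have f: "fund_form (bqf_act g q1)" using inv(1) D(1) x(2) by (simp add: fund_form_def)
    have b: "(B_Delta (bqf_act g q1) (rep K))\<^sup>2 < bqf_disc (bqf_act g q1) * bqf_disc (rep K)"
      using x unfolding inv by simp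
    obtain h where h: "h \<in> stabilizer (rep K)" "bqf_act h (bqf_act g q1) \<in> T K"
      using fund_form.crossing_forms_representative[OF R2(2)[OF K] base[OF R2(2)[OF K]] f b] x(2) unfolding inv(1) T_def by metis
    have e2: "((bqf_act g q1, rep K), (bqf_act h (bqf_act g q1), rep K)) \<in> bqf_equiv2"
      unfolding bqf_equiv2_iff using h(1) by (auto simp: stabilizer_def)
    have "((bqf_act h (bqf_act g q1), rep K), x) \<in> bqf_equiv2"
      using e1 e2 equiv_bqf_equiv2 unfolding x(1) equiv_def by (meson symD transD)
    then show "\<exists>t\<in>SIGMA K:Cl_plus D2. T K. ((snd t, rep (fst t)), x) \<in> bqf_equiv2"
      using K h(2) by (intro bexI[of _ "(K, bqf_act h (bqf_act g q1))"]) simp_all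
  next
    fix t t' assume t: "t \<in> (SIGMA K:Cl_plus D2. T K)" "t' \<in> (SIGMA K:Cl_plus D2. T K)"
      and e: "((snd t, rep (fst t)), (snd t', rep (fst t'))) \<in> bqf_equiv2"
    obtain K q where tc: "t = (K, q)" by (cases t)
    obtain K' q' where tc': "t' = (K', q')" by (cases t')
    have K: "K \<in> Cl_plus D2" "K' \<in> Cl_plus D2" "q \<in> T K" "q' \<in> T K'" using t by (simp_all add: tc tc')
    obtain g where g: "g \<in> Gamma" "bqf_act g q = q'" "bqf_act g (rep K) = rep K'"
      using e by (auto simp: tc tc' bqf_equiv2_iff)
    have "(rep K, rep K') \<in> bqf_equiv"
      unfolding bqf_equiv_def g(3)[symmetric] using g(1) by blast
    then have "K = K'" using R2(4)[OF K(1)] R2(4)[OF K(2)] equiv_class_eq[OF equiv_bqf_equiv] by metis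
    then have "g \<in> stabilizer (rep K)" using g by (simp add: stabilizer_def)
    then have "q' = q"
      using fund_form.crossing_forms_unique[OF R2(2)[OF K(1)] base[OF R2(2)[OF K(1)]] D(1), of q g]
        K(3,4) g(2) \<open>K = K'\<close> unfolding T_def by simp
    then show "t = t'" using \<open>K = K'\<close> by (simp add: tc tc')
  qed
  \<comment> \<open>Finiteness of the crossings comes from the arithmetic count of pair classes; it
    is what allows the cardinalities over the classes of D1 to be added.\<close>
  have finSig: "finite (SIGMA K:Cl_plus D2. T K)" using bij_betw_finite[OF bij] fin by simp
  have finT: "finite (T K)" if "K \<in> Cl_plus D2" for K
  proof (rule finite_subset)
    show "T K \<subseteq> snd ` (SIGMA K:Cl_plus D2. T K)" using that by force
    show "finite (snd ` (SIGMA K:Cl_plus D2. T K))" using finSig by (rule finite_imageI)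
  qed
  have inner: "(\<Sum>K1\<in>Cl_plus D1. int_num (rep K1) (rep K)) = card (T K)" if K: "K \<in> Cl_plus D2" for K
  proof -
    have "int_num (rep K1) (rep K) = card (K1 \<inter> T K)" if K1: "K1 \<in> Cl_plus D1" for K1
    proof -
      have "int_num (rep K1) (rep K) = card (bqf_equiv `` {rep K1} \<inter> fund_form.crossing_forms (rep K) (base (rep K)) (bqf_disc (rep K1)))"
        unfolding int_num_def base_def[symmetric]
        by (rule fund_form.int_num_at_eq[OF R2(2)[OF K] R1(2)[OF K1] base[OF R2(2)[OF K]]])
      then show ?thesis unfolding R1(3)[OF K1] R1(4)[OF K1, symmetric] T_def .
    qed
    then have "(\<Sum>K1\<in>Cl_plus D1. int_num (rep K1) (rep K)) = (\<Sum>K1\<in>Cl_plus D1. card (K1 \<inter> T K))" by simp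
    also have "\<dots> = card (\<Union>K1\<in>Cl_plus D1. K1 \<inter> T K)"
    proof (rule card_UN_disjoint[symmetric, OF finite_Cl_plus[OF D(1)]])
      show "\<forall>K1\<in>Cl_plus D1. finite (K1 \<inter> T K)" using finT[OF K] by blast
      show "\<forall>i\<in>Cl_plus D1. \<forall>j\<in>Cl_plus D1. i \<noteq> j \<longrightarrow> i \<inter> T K \<inter> (j \<inter> T K) = {}"
        using disjoint_Cl_plus by blast
    qed
    also have "(\<Union>K1\<in>Cl_plus D1. K1 \<inter> T K) = T K"
    proof
      show "T K \<subseteq> (\<Union>K1\<in>Cl_plus D1. K1 \<inter> T K)"
      proof
        fix q' assume q': "q' \<in> T K"
        then have "bqf_disc q' = D1" using T_disc[OF K] by blast
        then have "bqf_equiv `` {q'} \<in> Cl_plus D1" using class_in_Cl_plus[of q'] D(1) by simp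
        moreover have "q' \<in> bqf_equiv `` {q'}" using equiv_class_self[OF equiv_bqf_equiv] by blast
        ultimately show "q' \<in> (\<Union>K1\<in>Cl_plus D1. K1 \<inter> T K)" using q' by blast
      qed
    qed blast
    finally show ?thesis .
  qed
  \<comment> \<open>With the second class outermost, the classes of discriminant D1 partition the
    crossings of one fixed geodesic.\<close>
  have "total_int_num D1 D2 = (\<Sum>K2\<in>Cl_plus D2. \<Sum>K1\<in>Cl_plus D1. int_num (rep K1) (rep K2))"
    unfolding total_int_num_def rep_def by (rule sum.swap)
  also have "\<dots> = (\<Sum>K2\<in>Cl_plus D2. card (T K2))" using inner by simp
  also have "\<dots> = card (SIGMA K:Cl_plus D2. T K)"
    using finite_Cl_plus[OF D(2)] finT by (simp add: card_SigmaI)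
  also have "\<dots> = card (crossing_pairs D1 D2 // bqf_equiv2)" by (rule bij_betw_same_card[OF bij])
  finally show ?thesis .
qed

theorem corollary4:
  fixes D1 D2 :: int
  assumes "pos_fundamental_disc D1" and "pos_fundamental_disc D2" and "coprime D1 D2"
  shows "total_int_num D1 D2 = (\<Sum>n\<in>S_set D1 D2. pair_count D1 D2 n) \<and>
         int (\<Sum>n\<in>S_set D1 D2. pair_count D1 D2 n) =
           2 * (\<Sum>n\<in>S_set D1 D2.
                 \<Sum>d | d > 0 \<and> int d dvd (D1 * D2 - n\<^sup>2) div 4. eps D1 D2 d)"
proof
  have D: "fund_disc D1" "fund_disc D2"
    using assms(1,2) by (simp_all add: pos_fundamental_disc_imp_fund_disc)
  note card = card_crossing_pairs[OF D assms(3)]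
  show "total_int_num D1 D2 = (\<Sum>n\<in>S_set D1 D2. pair_count D1 D2 n)"
    unfolding total_int_num_eq[OF D card(1)] by (rule card(2))
  show "int (\<Sum>n\<in>S_set D1 D2. pair_count D1 D2 n) =
           2 * (\<Sum>n\<in>S_set D1 D2.
                 \<Sum>d | d > 0 \<and> int d dvd (D1 * D2 - n\<^sup>2) div 4. eps D1 D2 d)"
    by (simp add: pair_count_formula(1)[OF D assms(3)] sum_distrib_left)
qed

end
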